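(* Let $C$ be a $k$-dimensional tropical variety in $\mathbb{R}^d$. Then the largest integer $n$ such that $C$ has $n$ linearly independent balanced weightings is equal to $\dim \ker R(C)^T$. Hence $C$ is extremal if and only if $\operatorname{rank} R(C) = |\widetilde{E}|-1$.
   Context: Tropical varieties. Polyhedral complexes are finite and nonempty; their cells are convex polyhedra, possibly unbounded. Let $C \subset \mathbb{R}^d$ be a polyhedral complex of dimension $k$ (identified with its underlying set). $\widetilde{E}$ is the set of its $k$-dimensional cells (maximal faces) and $\widetilde{V}$ the set of its $(k-1)$-dimensional cells (ridges). $C$ is always assumed pure (every cell of dimension less than $k$ is a face of a $k$-dimensional cell) and rational: for each cell $\rho \in \widetilde{E}\cup\widetilde{V}$, with $L_\rho$ the linear space parallel to $\rho$, the lattice $L_\rho \cap \mathbb{Z}^d$ has rank $\dim \rho$. For $\tau \in \widetilde{V}$, $\sigma \in \widetilde{E}$ with $\tau \subset \sigma$, fix $z_\tau(\sigma) \in L_\sigma \cap \mathbb{Z}^d$ such that $L_\sigma \cap \mathbb{Z}^d = (L_\tau \cap \mathbb{Z}^d) + \mathbb{Z} z_\tau(\sigma)$ and $x + \lambda z_\tau(\sigma) \in \sigma$ for some $x \in \tau$, $\lambda > 0$ (it is unique modulo $L_\tau \cap \mathbb{Z}^d$). A weighting is a map $\omega: \widetilde{E} \to \mathbb{Z}_{>0}$; it is balanced if for every $\tau \in \widetilde{V}$, $\sum_{\sigma \supset \tau} \omega(\sigma) z_\tau(\sigma) \in L_\tau$ (sum over $\sigma \in \widetilde{E}$ having $\tau$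 as a face). $C$ is a tropical variety of dimension $k$ if it has a balanced weighting. A tropical variety $C$ is extremal if it cannot be written as $C = C_1 \cup C_2$ with $C_1, C_2$ tropical varieties in $\mathbb{R}^d$ that are both proper subsets of $C$. The matrix $R(C)$. Let $t = d-(k-1)$. $\widetilde{R}(C)$ is the $|\widetilde{E}| \times d|\widetilde{V}|$ integer matrix whose $d$ entries in row $\sigma$ and the columns of $\tau$ form the vector $z_\tau(\sigma)^\top$ if $\tau \subset \sigma$ and $(0,\ldots,0)$ otherwise. For each $\tau \in \widetilde{V}$ fix $t$ linearly independent vectors $x_1(\tau),\ldots,x_t(\tau) \in L_\tau^\perp \cap \mathbb{Z}^d$ (the standard basis of $\mathbb{R}^d$ if $t=d$). $L(C)$ is the $d|\widetilde{V}| \times t|\widetilde{V}|$ integer matrix whose column indexed by $(\tau,i)$ has $x_i(\tau)$ in the $d$ rows of $\tau$ and $0$ elsewhere. Then $R(C) := \widetilde{R}(C)L(C)$, a $|\widetilde{E}| \times t|\widetilde{V}|$ integer matrix; its entry in row $\sigma$ and column $(\tau,i)$ is $z_\tau(\sigma)\cdot x_i(\tau)$ if $\tau \subset \sigma$, and $0$ otherwise. Rank, kernel and linear independence (of weightings as vectors in $\mathbb{R}^{\widetilde{E}}$) are over $\mathbb{R}$. *)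

theory Defs
  imports "HOL-Analysis.Analysis" "Jordan_Normal_Form.Matrix_Kernel" "Jordan_Normal_Form.DL_Rank"
begin

section \<open>Polyhedral complexes\<close>

text \<open>
  A complex is represented by its set of cells; the point set it covers is the union of the cells.
  Cells are nonempty: since \<^term>\<open>aff_dim {} = -1\<close>, the empty set would otherwise be
  a ridge of a 0-dimensional complex. A 0-dimensional complex thus has no ridges.
\<close>

definition polyhedral_complex :: "(real ^ 'n) set set \<Rightarrow> bool" where
  "polyhedral_complex C \<longleftrightarrow>
     finite C \<and> C \<noteq> {} \<and>
     (\<forall>\<sigma>\<in>C. polyhedron \<sigma> \<and> \<sigma> \<noteq> {}) \<and>
     (\<forall>\<sigma>\<in>C. \<forall>F. F face_of \<sigma> \<and> F \<noteq> {} \<longrightarrow> F \<in> C) \<and>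
     (\<forall>\<sigma>\<in>C. \<forall>\<tau>\<in>C. \<sigma> \<inter> \<tau> \<noteq> {} \<longrightarrow> (\<sigma> \<inter> \<tau>) face_of \<sigma> \<and> (\<sigma> \<inter> \<tau>) face_of \<tau>)"

definition complex_dim :: "(real ^ 'n) set set \<Rightarrow> int" where
  "complex_dim C = Max (aff_dim ` C)"

definition max_cells :: "nat \<Rightarrow> (real ^ 'n) set set \<Rightarrow> (real ^ 'n) set set" where
  "max_cells k C = {\<sigma> \<in> C. aff_dim \<sigma> = int k}"

definition ridges :: "nat \<Rightarrow> (real ^ 'n) set set \<Rightarrow> (real ^ 'n) set set" where
  "ridges k C = {\<tau> \<in> C. aff_dim \<tau> = int k - 1}"

definition pure_complex :: "nat \<Rightarrow> (real ^ 'n) set set \<Rightarrow> bool" where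
  "pure_complex k C \<longleftrightarrow>
     polyhedral_complex C \<and> complex_dim C = int k \<and>
     (\<forall>\<tau>\<in>C. aff_dim \<tau> < int k \<longrightarrow> (\<exists>\<sigma>\<in>max_cells k C. \<tau> face_of \<sigma>))"


section \<open>Rationality and lattice normal vectors\<close>

definition lin_space :: "(real ^ 'n) set \<Rightarrow> (real ^ 'n) set" where
  "lin_space \<rho> = span {x - y | x y. x \<in> \<rho> \<and> y \<in> \<rho>}"

definition integer_points :: "(real ^ 'n) set" where
  "integer_points = {v. \<forall>i. vec_nth v i \<in> \<int>}"

definition cell_lattice :: "(real ^ 'n) set \<Rightarrow> (real ^ 'n) set" where
  "cell_lattice \<rho> = lin_space \<rho> \<inter> integer_points"

definition lattice_basis :: "(real ^ 'n) set \<Rightarrow> (real ^ 'n) set \<Rightarrow> bool" where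
  "lattice_basis B \<Lambda> \<longleftrightarrow>
     finite B \<and> independent B \<and>
     \<Lambda> = {(\<Sum>b\<in>B. of_int (c b) *\<^sub>R b) | c :: real ^ 'n \<Rightarrow> int. True}"

definition rational_complex :: "nat \<Rightarrow> (real ^ 'n) set set \<Rightarrow> bool" where
  "rational_complex k C \<longleftrightarrow>
     (\<forall>\<rho> \<in> max_cells k C \<union> ridges k C.
        \<exists>B. lattice_basis B (cell_lattice \<rho>) \<and> int (card B) = aff_dim \<rho>)"

definition lattice_normal :: "(real ^ 'n) set \<Rightarrow> (real ^ 'n) set \<Rightarrow> real ^ 'n \<Rightarrow> bool" where
  "lattice_normal \<tau> \<sigma> z \<longleftrightarrow>
     z \<in> cell_lattice \<sigma> \<and>
     cell_lattice \<sigma> = {u + of_int m *\<^sub>R z | u (m :: int). u \<in> cell_lattice \<tau>} \<and>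
     (\<exists>x\<in>\<tau>. \<exists>r>0. x + r *\<^sub>R z \<in> \<sigma>)"

definition lattice_normals ::
    "nat \<Rightarrow> (real ^ 'n) set set \<Rightarrow> ((real ^ 'n) set \<Rightarrow> (real ^ 'n) set \<Rightarrow> real ^ 'n) \<Rightarrow> bool" where
  "lattice_normals k C z \<longleftrightarrow>
     (\<forall>\<tau>\<in>ridges k C. \<forall>\<sigma>\<in>max_cells k C. \<tau> \<subseteq> \<sigma> \<longrightarrow> lattice_normal \<tau> \<sigma> (z \<tau> \<sigma>))"


section \<open>Balanced weightings and tropical varieties\<close>

text \<open>Only the values of a weighting on the maximal cells are meaningful.\<close>

definition weighting :: "nat \<Rightarrow> (real ^ 'n) set set \<Rightarrow> ((real ^ 'n) set \<Rightarrow> int) \<Rightarrow> bool" where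
  "weighting k C \<omega> \<longleftrightarrow> (\<forall>\<sigma>\<in>max_cells k C. \<omega> \<sigma> > 0)"

definition balanced_weighting ::
    "nat \<Rightarrow> (real ^ 'n) set set \<Rightarrow> ((real ^ 'n) set \<Rightarrow> (real ^ 'n) set \<Rightarrow> real ^ 'n)
      \<Rightarrow> ((real ^ 'n) set \<Rightarrow> int) \<Rightarrow> bool" where
  "balanced_weighting k C z \<omega> \<longleftrightarrow>
     weighting k C \<omega> \<and>
     (\<forall>\<tau>\<in>ridges k C.
        (\<Sum>\<sigma> | \<sigma> \<in> max_cells k C \<and> \<tau> face_of \<sigma>. of_int (\<omega> \<sigma>) *\<^sub>R z \<tau> \<sigma>) \<in> lin_space \<tau>)"

text \<open>
  Whether a weighting is balanced does not depend on the chosen lattice normal vectors, which are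
  unique modulo the lattice of the ridge; rationality ensures that a choice exists.
\<close>

definition tropical_variety :: "nat \<Rightarrow> (real ^ 'n) set set \<Rightarrow> bool" where
  "tropical_variety k C \<longleftrightarrow>
     pure_complex k C \<and> rational_complex k C \<and>
     (\<exists>z. lattice_normals k C z \<and> (\<exists>\<omega>. balanced_weighting k C z \<omega>))"

text \<open>
  The decomposition is one of underlying sets: the cells of the two parts need not be cells of
  \<^term>\<open>C\<close>, and their dimensions are unrestricted.
\<close>

definition extremal :: "(real ^ 'n) set set \<Rightarrow> bool" where
  "extremal C \<longleftrightarrow>
     \<not> (\<exists>k1 k2 C1 C2. tropical_variety k1 C1 \<and> tropical_variety k2 C2 \<and>
           \<Union>C = \<Union>C1 \<union> \<Union>C2 \<and> \<Union>C1 \<subset> \<Union>C \<and> \<Union>C2 \<subset> \<Union>C)"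


section \<open>The matrix of a complex\<close>

text \<open>
  The codimension \<open>d - (k - 1)\<close> of a ridge; the natural-number subtraction below is never
  truncated because \<open>k \<le> d\<close> for every \<open>k\<close>-dimensional complex.
\<close>

definition ridge_codim :: "'n itself \<Rightarrow> nat \<Rightarrow> nat" where
  "ridge_codim _ k = CARD('n) + 1 - k"

definition conormal_basis :: "nat \<Rightarrow> (real ^ 'n) set \<Rightarrow> (nat \<Rightarrow> real ^ 'n) \<Rightarrow> bool" where
  "conormal_basis k \<tau> x \<longleftrightarrow>
     (let t = ridge_codim TYPE('n) k in
        inj_on x {..<t} \<and> independent (x ` {..<t}) \<and>
        x ` {..<t} \<subseteq> orthogonal_comp (lin_space \<tau>) \<inter> integer_points \<and>
        (t = CARD('n) \<longrightarrow> x ` {..<t} = Basis))"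

definition conormal_bases ::
    "nat \<Rightarrow> (real ^ 'n) set set \<Rightarrow> ((real ^ 'n) set \<Rightarrow> nat \<Rightarrow> real ^ 'n) \<Rightarrow> bool" where
  "conormal_bases k C x \<longleftrightarrow> (\<forall>\<tau>\<in>ridges k C. conormal_basis k \<tau> (x \<tau>))"

text \<open>
  Matrices are indexed by natural numbers, so the maximal cells, the ridges and the coordinates
  are enumerated by lists \<open>Es\<close>, \<open>Vs\<close> and \<open>cs\<close>. The index \<open>j\<close> of a block of width \<open>b\<close> per ridge
  stands for entry \<open>j mod b\<close> of the block of ridge \<open>Vs ! (j div b)\<close>. All matrices have integer
  entries but are taken over the reals, where rank and kernel are computed.
\<close>

definition enumerates :: "'a list \<Rightarrow> 'a set \<Rightarrow> bool" where
  "enumerates xs A \<longleftrightarrow> distinct xs \<and> set xs = A"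

definition Rtilde_matrix ::
    "'n list \<Rightarrow> (real ^ 'n) set list \<Rightarrow> (real ^ 'n) set list
      \<Rightarrow> ((real ^ 'n) set \<Rightarrow> (real ^ 'n) set \<Rightarrow> real ^ 'n) \<Rightarrow> real mat" where
  "Rtilde_matrix cs Es Vs z =
     Matrix.mat (length Es) (CARD('n) * length Vs)
       (\<lambda>(i, j). let \<sigma> = Es ! i; \<tau> = Vs ! (j div CARD('n)) in
          if \<tau> \<subseteq> \<sigma> then vec_nth (z \<tau> \<sigma>) (cs ! (j mod CARD('n))) else 0)"

definition L_matrix ::
    "nat \<Rightarrow> 'n list \<Rightarrow> (real ^ 'n) set list
      \<Rightarrow> ((real ^ 'n) set \<Rightarrow> nat \<Rightarrow> real ^ 'n) \<Rightarrow> real mat" where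
  "L_matrix k cs Vs x =
     (let t = ridge_codim TYPE('n) k in
      Matrix.mat (CARD('n) * length Vs) (t * length Vs)
        (\<lambda>(i, j). if i div CARD('n) = j div t
           then vec_nth (x (Vs ! (j div t)) (j mod t)) (cs ! (i mod CARD('n))) else 0))"

definition R_matrix ::
    "nat \<Rightarrow> 'n list \<Rightarrow> (real ^ 'n) set list \<Rightarrow> (real ^ 'n) set list
      \<Rightarrow> ((real ^ 'n) set \<Rightarrow> (real ^ 'n) set \<Rightarrow> real ^ 'n)
      \<Rightarrow> ((real ^ 'n) set \<Rightarrow> nat \<Rightarrow> real ^ 'n) \<Rightarrow> real mat" where
  "R_matrix k cs Es Vs z x = Rtilde_matrix cs Es Vs z * L_matrix k cs Vs x"

definition weight_vec :: "(real ^ 'n) set list \<Rightarrow> ((real ^ 'n) set \<Rightarrow> int) \<Rightarrow> real Matrix.vec" where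
  "weight_vec Es \<omega> = Matrix.vec (length Es) (\<lambda>i. of_int (\<omega> (Es ! i)))"

definition lin_indpt_vecs :: "nat \<Rightarrow> real Matrix.vec set \<Rightarrow> bool" where
  "lin_indpt_vecs n W \<longleftrightarrow> \<not> LinearCombinations.module.lin_dep class_ring (module_vec TYPE(real) n) W"

definition has_independent_balanced_weightings ::
    "nat \<Rightarrow> (real ^ 'n) set set \<Rightarrow> ((real ^ 'n) set \<Rightarrow> (real ^ 'n) set \<Rightarrow> real ^ 'n)
      \<Rightarrow> (real ^ 'n) set list \<Rightarrow> nat \<Rightarrow> bool" where
  "has_independent_balanced_weightings k C z Es n \<longleftrightarrow>
     (\<exists>W. W \<subseteq> {weight_vec Es \<omega> | \<omega>. balanced_weighting k C z \<omega>} \<and>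
          finite W \<and> card W = n \<and> lin_indpt_vecs (length Es) W)"

lemma R_matrix_carrier:
  fixes cs :: "'n::finite list"
  shows "R_matrix k cs Es Vs z x \<in>
    carrier_mat (length Es) (ridge_codim TYPE('n) k * length Vs)"
  unfolding R_matrix_def Rtilde_matrix_def L_matrix_def Let_def
  by (rule mult_carrier_mat[OF mat_carrier mat_carrier])

lemma R_matrix_entry:
  fixes cs :: "'n::finite list"
  assumes cs: "enumerates cs UNIV"
    and i: "i < length Es" and j: "j < length Vs" and l: "l < ridge_codim TYPE('n) k"
  shows "R_matrix k cs Es Vs z x $$ (i, j * ridge_codim TYPE('n) k + l) =
    (if Vs ! j \<subseteq> Es ! i then inner (z (Vs ! j) (Es ! i)) (x (Vs ! j) l) else 0)"
proof -
  define d where "d = CARD('n)"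
  define t where "t = ridge_codim TYPE('n) k"
  define J where "J = j * t + l"
  have d0: "d > 0" and t0: "t > 0" using l by (auto simp: d_def t_def)
  have Jdiv: "J div t = j" and Jmod: "J mod t = l" using l by (auto simp: J_def t_def)
  have J: "J < t * length Vs"
  proof -
    have "J < (j + 1) * t" using l by (simp add: J_def t_def)
    also have "\<dots> \<le> length Vs * t" using j by (intro mult_right_mono) auto
    finally show ?thesis by (simp add: mult.commute)
  qed
  have len: "length cs = d"
    using cs by (metis d_def distinct_card enumerates_def)
  have bij: "bij_betw (\<lambda>c. cs ! c) {..<d} UNIV"
    using bij_betw_nth[of cs "{..<d}" UNIV] cs len by (simp add: enumerates_def)
  define a where "a c = (if Vs ! j \<subseteq> Es ! i then vec_nth (z (Vs ! j) (Es ! i)) c else 0)" for c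
  define b where "b c = vec_nth (x (Vs ! j) l) c" for c
  have "R_matrix k cs Es Vs z x $$ (i, J) =
    (\<Sum>m\<in>{0..<d * length Vs}. Rtilde_matrix cs Es Vs z $$ (i, m) * L_matrix k cs Vs x $$ (m, J))"
    using i J by (simp add: R_matrix_def Rtilde_matrix_def L_matrix_def Let_def
        scalar_prod_def d_def t_def)
  also have "\<dots> = (\<Sum>m\<in>{0..<d * length Vs}. if m div d = j then a (cs ! (m mod d)) * b (cs ! (m mod d)) else 0)"
    using i J Jdiv Jmod
    by (intro sum.cong) (auto simp: Rtilde_matrix_def L_matrix_def Let_def d_def[symmetric]
        t_def[symmetric] a_def b_def)
  also have "\<dots> = (\<Sum>m | m < d * length Vs \<and> m div d = j. a (cs ! (m mod d)) * b (cs ! (m mod d)))"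
    by (simp add: sum.If_cases atLeast0LessThan lessThan_def Collect_conj_eq)
  also have "\<dots> = (\<Sum>c<d. a (cs ! c) * b (cs ! c))"
  proof (rule sum.reindex_bij_witness[of _ "\<lambda>c. j * d + c" "\<lambda>m. m mod d"], goal_cases)
    case (4 c)
    have "j * d + c < (j + 1) * d" using 4 by simp
    also have "\<dots> \<le> length Vs * d" using j by (intro mult_right_mono) auto
    finally show ?case using 4 d0 by (simp add: mult.commute)
  next
    case (1 m)
    then have "m div d = j" by simp
    then show ?case using div_mult_mod_eq[of m d] by simp
  qed (use d0 in auto)
  also have "\<dots> = (\<Sum>c\<in>UNIV. a c * b c)"
    by (rule sum.reindex_bij_betw[OF bij])
  also have "\<dots> = (if Vs ! j \<subseteq> Es ! i then inner (z (Vs ! j) (Es ! i)) (x (Vs ! j) l) else 0)"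
    by (auto simp: inner_vec_def a_def b_def)
  finally show ?thesis by (simp add: J_def t_def)
qed

end

theory Submission
  imports Defs
begin

text \<open>
  Because the conormal vectors of a ridge span the orthogonal complement of its linear space, the
  kernel of \<open>R\<^sup>T\<close> consists of the real solutions of the balancing conditions. The matrix has integer
  entries, so its kernel is spanned by integer vectors, and, after adding multiples of a fixed balanced
  weighting, by balanced weightings. Two independent balanced weightings have differences with
  nonnegative, proper supports, which decompose the variety. Conversely, if a tropical variety \<open>D\<close> of
  the same dimension is properly contained in \<open>C\<close>, then the weight of \<open>D\<close> is constant along each
  maximal cell of \<open>C\<close>, by balancing at the ridges of \<open>D\<close> inside that cell; balancing at generic points of
  the ridges of \<open>C\<close> then shows that these constants solve the balancing conditions of \<open>C\<close>. They vanish
  on some cell, but not on all, so the kernel has dimension at least two.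
\<close>

text \<open>The cells of a variety \<open>D\<close> inside \<open>C\<close> need not be related to
  the cells of \<open>C\<close>, and no common refinement is built. The two complexes are compared
  at single points through tangent cones: near a point in general position both are invariant under
  translation by one space \<open>H\<close> of dimension k - 1, so only finitely many directions
  modulo \<open>H\<close> matter. An integer vector that is primitive modulo \<open>H\<close> is
  determined up to sign modulo \<open>H\<close>; this allows the balancing of \<open>D\<close> to be
  rewritten in the lattice normals of \<open>C\<close>. The definition of \<open>extremal\<close>
  leaves the dimensions of the two parts free; since finitely many cells of smaller dimension cannot
  cover a k-dimensional cell, one part has dimension k, and that part yields the kernel vector. A
  balanced weighting is strictly positive, so a nonzero kernel vector with a zero entry is not a
  multiple of it.\<close>

hide_const (open) VectorSpace.subspace Matrix.orthogonal
hide_fact (open) Matrix.orthogonal_def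


section \<open>Tangent cones\<close>

text \<open>For convex \<open>S\<close> containing \<open>p\<close> this is the cone of directions
  that stay in \<open>S\<close> for a short time. No closure is taken, so each of its directions is
  realised by a point of \<open>S\<close>.\<close>

definition tangent_cone :: "'a::real_vector \<Rightarrow> 'a set \<Rightarrow> 'a set" where
  "tangent_cone p S = {v. \<exists>e>0. p + e *\<^sub>R v \<in> S}"

lemma tangent_cone_mono: "S \<subseteq> T \<Longrightarrow> tangent_cone p S \<subseteq> tangent_cone p T"
  by (auto simp: tangent_cone_def)

lemma tangent_cone_small:
  assumes "convex S" "p \<in> S" "v \<in> tangent_cone p S"
  obtains e where "e > 0" "\<And>t. 0 \<le> t \<Longrightarrow> t \<le> e \<Longrightarrow> p + t *\<^sub>R v \<in> S"
proof -
  obtain e where e: "e > 0" "p + e *\<^sub>R v \<in> S" using assms(3) by (auto simp: tangent_cone_def)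
  have "p + t *\<^sub>R v \<in> S" if "0 \<le> t" "t \<le> e" for t
  proof -
    have "(1 - t/e) *\<^sub>R p + (t/e) *\<^sub>R (p + e *\<^sub>R v) \<in> S"
      using assms e that by (intro convexD) (auto simp: field_simps)
    then show ?thesis using e by (simp add: algebra_simps)
  qed
  with e(1) that show ?thesis by blast
qed

lemma tangent_cone_Int:
  assumes "convex A" "convex B" "p \<in> A" "p \<in> B"
  shows "tangent_cone p (A \<inter> B) = tangent_cone p A \<inter> tangent_cone p B"
proof
  show "tangent_cone p (A \<inter> B) \<subseteq> tangent_cone p A \<inter> tangent_cone p B"
    by (auto simp: tangent_cone_def)
  show "tangent_cone p A \<inter> tangent_cone p B \<subseteq> tangent_cone p (A \<inter> B)"
  proof
    fix v assume v: "v \<in> tangent_cone p A \<inter> tangent_cone p B"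
    obtain a where a: "a > 0" "\<And>t. 0 \<le> t \<Longrightarrow> t \<le> a \<Longrightarrow> p + t *\<^sub>R v \<in> A"
      using tangent_cone_small assms v by (metis IntE)
    obtain b where b: "b > 0" "\<And>t. 0 \<le> t \<Longrightarrow> t \<le> b \<Longrightarrow> p + t *\<^sub>R v \<in> B"
      using tangent_cone_small assms v by (metis IntE)
    show "v \<in> tangent_cone p (A \<inter> B)"
      unfolding tangent_cone_def using a b by (auto intro!: exI[of _ "min a b"])
  qed
qed

lemma tangent_cone_scale:
  assumes "v \<in> tangent_cone p S" "c > 0" shows "c *\<^sub>R v \<in> tangent_cone p S"
proof -
  obtain e where "e > 0" "p + e *\<^sub>R v \<in> S" using assms(1) by (auto simp: tangent_cone_def)
  then have "e / c > 0 \<and> p + (e / c) *\<^sub>R (c *\<^sub>R v) \<in> S" using assms(2) by simp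
  then show ?thesis unfolding tangent_cone_def by blast
qed

lemma tangent_cone_add:
  assumes "convex S" "p \<in> S" "v \<in> tangent_cone p S" "w \<in> tangent_cone p S"
  shows "v + w \<in> tangent_cone p S"
proof -
  obtain a where a: "a > 0" "\<And>t. 0 \<le> t \<Longrightarrow> t \<le> a \<Longrightarrow> p + t *\<^sub>R v \<in> S"
    using tangent_cone_small assms by metis
  obtain b where b: "b > 0" "\<And>t. 0 \<le> t \<Longrightarrow> t \<le> b \<Longrightarrow> p + t *\<^sub>R w \<in> S"
    using tangent_cone_small assms by metis
  define t where "t = min a b"
  have t: "t > 0" "p + t *\<^sub>R v \<in> S" "p + t *\<^sub>R w \<in> S" using a b by (auto simp: t_def)
  have "(1/2) *\<^sub>R (p + t *\<^sub>R v) + (1/2) *\<^sub>R (p + t *\<^sub>R w) \<in> S"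
    using assms t by (intro convexD) auto
  also have "(1/2) *\<^sub>R (p + t *\<^sub>R v) + (1/2) *\<^sub>R (p + t *\<^sub>R w) = p + (t/2) *\<^sub>R (v + w)"
    by (simp add: algebra_simps flip: scaleR_left_distrib)
  finally show ?thesis using t(1) unfolding tangent_cone_def by (auto intro!: exI[of _ "t/2"])
qed

text \<open>A sequence on the ray from \<open>p\<close> along \<open>v\<close> that tends to
  \<open>p\<close> stays in \<open>A\<close> by convexity, so one of the finitely many sets contains
  infinitely many of its points. Being closed, this set contains \<open>p\<close> as well.\<close>

lemma tangent_cone_Union:
  fixes A :: "'a::real_normed_vector set"
  assumes "finite X" and closed: "\<And>B. B \<in> X \<Longrightarrow> closed B"
    and A: "convex A" "p \<in> A" "A \<subseteq> \<Union>X" "v \<in> tangent_cone p A"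
  shows "\<exists>B\<in>X. p \<in> B \<and> v \<in> tangent_cone p B"
proof -
  obtain e where e: "e > 0" "\<And>t. 0 \<le> t \<Longrightarrow> t \<le> e \<Longrightarrow> p + t *\<^sub>R v \<in> A"
    using tangent_cone_small A by metis
  define f where "f n = p + (e / real (Suc n)) *\<^sub>R v" for n
  have "f n \<in> \<Union>X" for n
  proof -
    have "f n \<in> A" unfolding f_def using e(1) by (intro e(2)) (auto simp: field_simps)
    then show ?thesis using A(3) by blast
  qed
  then have "\<forall>n. \<exists>B. B \<in> X \<and> f n \<in> B" by blast
  then obtain g where g: "\<And>n. g n \<in> X" "\<And>n. f n \<in> g n" by metis
  have "finite (g ` UNIV)" using \<open>finite X\<close> g by (meson finite_subset image_subsetI)
  then obtain n0 where inf: "infinite {n \<in> UNIV. g n = g n0}"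
    using pigeonhole_infinite[of UNIV g] by auto
  have "p \<in> g n0"
  proof -
    have lim: "f \<longlonglongrightarrow> p"
    proof -
      have "(\<lambda>n. e * inverse (real (Suc n))) \<longlonglongrightarrow> e * 0"
        by (intro tendsto_mult tendsto_const LIMSEQ_inverse_real_of_nat)
      then have "(\<lambda>n. p + (e * inverse (real (Suc n))) *\<^sub>R v) \<longlonglongrightarrow> p + (e * 0) *\<^sub>R v"
        by (intro tendsto_add tendsto_scaleR tendsto_const)
      then show ?thesis by (simp add: f_def[abs_def] divide_inverse)
    qed
    have "p \<in> closure (g n0)"
      unfolding closure_approachable
    proof (intro allI impI)
      fix d :: real assume "d > 0"
      then obtain N where N: "\<And>n. n \<ge> N \<Longrightarrow> dist (f n) p < d"
        using lim by (auto simp: lim_sequentially)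
      obtain n where "n \<ge> N" "g n = g n0"
        using inf unfolding infinite_nat_iff_unbounded_le by auto
      then show "\<exists>y\<in>g n0. dist y p < d" using N g(2) by metis
    qed
    then show ?thesis using closed[OF g(1)] by simp
  qed
  moreover have "v \<in> tangent_cone p (g n0)"
    using e g(2)[of n0] unfolding tangent_cone_def f_def
    by (auto intro!: exI[of _ "e / real (Suc n0)"])
  ultimately show ?thesis using g(1) by blast
qed

section \<open>The linear space parallel to a cell, and generic points\<close>

lemma lin_space_eq_span:
  assumes "a \<in> S" shows "lin_space S = span ((\<lambda>x. x - a) ` S)"
proof
  show "lin_space S \<subseteq> span ((\<lambda>x. x - a) ` S)"
    unfolding lin_space_def
  proof (rule span_minimal)
    show "{x - y |x y. x \<in> S \<and> y \<in> S} \<subseteq> span ((\<lambda>x. x - a) ` S)"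
    proof safe
      fix x y assume "x \<in> S" "y \<in> S"
      then have "(x - a) - (y - a) \<in> span ((\<lambda>x. x - a) ` S)"
        by (intro span_diff span_base) auto
      then show "x - y \<in> span ((\<lambda>x. x - a) ` S)" by simp
    qed
  qed simp
  show "span ((\<lambda>x. x - a) ` S) \<subseteq> lin_space S"
    unfolding lin_space_def using assms by (intro span_mono) auto
qed

lemma subspace_lin_space [simp]: "subspace (lin_space S)"
  by (simp add: lin_space_def)

lemma lin_space_mono: "S \<subseteq> T \<Longrightarrow> lin_space S \<subseteq> lin_space T"
  unfolding lin_space_def by (intro span_mono) auto

lemma dim_lin_space:
  assumes "S \<noteq> {}" shows "int (dim (lin_space S)) = aff_dim S"
proof -
  obtain a where a: "a \<in> S" using assms by blast
  have "aff_dim S = int (dim ((\<lambda>x. x - a) ` S))"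
    using aff_dim_eq_dim_subtract[OF hull_inc[OF a]] by simp
  then show ?thesis by (simp add: lin_space_eq_span[OF a])
qed

lemma tangent_cone_subset_lin_space:
  assumes "p \<in> S" shows "tangent_cone p S \<subseteq> lin_space S"
proof
  fix v assume "v \<in> tangent_cone p S"
  then obtain e where e: "e > 0" "p + e *\<^sub>R v \<in> S" by (auto simp: tangent_cone_def)
  have "(p + e *\<^sub>R v) - p \<in> lin_space S"
    unfolding lin_space_def using assms e by (intro span_base) blast
  then have "(1/e) *\<^sub>R (e *\<^sub>R v) \<in> lin_space S"
    using subspace_scale[OF subspace_lin_space] by (metis add_diff_cancel_left')
  then show "v \<in> lin_space S" using e by simp
qed

lemma tangent_cone_rel_interior:
  assumes "p \<in> rel_interior S" shows "tangent_cone p S = lin_space S"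
proof
  have p: "p \<in> S" using assms rel_interior_subset by blast
  then show "tangent_cone p S \<subseteq> lin_space S" by (rule tangent_cone_subset_lin_space)
  obtain e where e: "e > 0" "ball p e \<inter> affine hull S \<subseteq> S"
    using assms by (auto simp: mem_rel_interior_ball)
  show "lin_space S \<subseteq> tangent_cone p S"
  proof
    fix v assume v: "v \<in> lin_space S"
    \<comment> \<open>The summand 1 covers \<open>v = 0\<close>, and the factor 1/2 keeps the point
      strictly inside the ball.\<close>
    define t where "t = e / (norm v + 1) / 2"
    have t: "t > 0" using e by (auto simp: t_def intro!: divide_pos_pos add_nonneg_pos)
    have "t * norm v < e"
    proof -
      have "t * norm v \<le> t * (norm v + 1)" using t by simp
      also have "\<dots> = e / 2" using norm_ge_zero[of v] by (simp add: t_def field_simps add_nonneg_eq_0_iff)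
      also have "\<dots> < e" using e by simp
      finally show ?thesis .
    qed
    moreover have "p + t *\<^sub>R v \<in> affine hull S"
    proof -
      have "(\<lambda>x. x - p) ` S = insert 0 ((\<lambda>x. - p + x) ` (S - {p}))" using p by auto
      then have "lin_space S = span ((\<lambda>x. - p + x) ` (S - {p}))"
        by (simp only: lin_space_eq_span[OF p] span_insert_0)
      then show ?thesis
        unfolding affine_hull_span2[OF p] using v by (auto intro!: imageI span_scale)
    qed
    ultimately have "p + t *\<^sub>R v \<in> S" using e t by (auto simp: dist_norm)
    then show "v \<in> tangent_cone p S" using t by (auto simp: tangent_cone_def)
  qed
qed

lemma subspace_eq_span_insert:
  fixes H :: "'a::euclidean_space set"
  assumes "subspace H" "subspace L" "H \<subseteq> L" "v \<in> L" "v \<notin> H" "dim L = Suc (dim H)"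
  shows "L = span (insert v H)"
proof -
  have "span (insert v H) \<subseteq> L" using assms by (intro span_minimal) auto
  moreover have "dim (span (insert v H)) = dim L"
    using assms by (simp add: dim_insert span_eq_iff[THEN iffD2])
  ultimately show ?thesis
    by (metis assms(2) order_refl subspace_dim_equal subspace_span)
qed

lemma span_insert_subspace:
  assumes "subspace H" shows "w \<in> span (insert v H) \<longleftrightarrow> (\<exists>a. w - a *\<^sub>R v \<in> H)"
  using span_insert[of v H] span_eq_iff[THEN iffD2, OF assms] by auto

text \<open>The points of \<open>rel_interior T\<close> serve as generic points of \<open>S\<close> with respect to \<open>D\<close>.\<close>

lemma convex_generic_piece:
  fixes S :: "'a::euclidean_space set"
  assumes "finite D" "\<And>B. B \<in> D \<Longrightarrow> closed B \<and> convex B" "convex S"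
  shows "\<exists>T\<subseteq>S. convex T \<and> aff_dim T = aff_dim S \<and> (\<forall>B\<in>D. T \<subseteq> B \<or> T \<inter> B = {})"
  using assms(1,2)
proof (induction D rule: finite_induct)
  case empty
  then show ?case using assms(3) by auto
next
  case (insert B D)
  then obtain T where T: "T \<subseteq> S" "convex T" "aff_dim T = aff_dim S" "\<forall>B\<in>D. T \<subseteq> B \<or> T \<inter> B = {}"
    by auto
  have B: "closed B" "convex B" using insert.prems by auto
  \<comment> \<open>A full-dimensional intersection with \<open>B\<close> replaces \<open>T\<close>.
    Otherwise some relative interior point of \<open>T\<close> lies off the closed set
    \<open>B\<close>, and a small ball around it cuts out a full-dimensional piece disjoint from
    \<open>B\<close>.\<close>
  show ?case
  proof (cases "aff_dim (T \<inter> B) = aff_dim T")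
    case True
    then show ?thesis using T B by (intro exI[of _ "T \<inter> B"]) (auto simp: convex_Int)
  next
    case False
    have "\<not> rel_interior T \<subseteq> B"
    proof
      assume "rel_interior T \<subseteq> B"
      then have "aff_dim (rel_interior T) \<le> aff_dim (T \<inter> B)"
        using rel_interior_subset by (intro aff_dim_subset) blast
      then show False
        using False aff_dim_subset[of "T \<inter> B" T] rel_interior_aff_dim[OF T(2)] by auto
    qed
    then obtain q where q: "q \<in> rel_interior T" "q \<in> - B" by blast
    have "open (- B)" using B by auto
    then obtain r where r: "r > 0" "ball q r \<subseteq> - B" using q openE by blast
    have "q \<in> T" using q rel_interior_subset by blast
    then have "T \<inter> ball q r \<noteq> {}" using r by auto
    then have "aff_dim (T \<inter> ball q r) = aff_dim T"
      using aff_dim_convex_Int_open[OF T(2) open_ball] by blast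
    then show ?thesis using T r by (intro exI[of _ "T \<inter> ball q r"]) (auto simp: convex_Int)
  qed
qed

lemma rel_interior_mono_aff_dim:
  fixes S T :: "'a::euclidean_space set"
  assumes "T \<subseteq> S" "aff_dim T = aff_dim S" shows "rel_interior T \<subseteq> rel_interior S"
proof (cases "T = {}")
  case False
  then have "affine hull T = affine hull S"
    using assms by (metis aff_dim_eq_full_gen)
  then show ?thesis using assms subset_rel_interior by blast
qed simp


section \<open>Polyhedral complexes with lattice normals\<close>

lemma polyhedral_complex_cellD:
  assumes "polyhedral_complex C" "\<sigma> \<in> C"
  shows "polyhedron \<sigma>" "convex \<sigma>" "closed \<sigma>" "\<sigma> \<noteq> {}"
  using assms by (auto simp: polyhedral_complex_def polyhedron_imp_convex polyhedron_imp_closed)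

lemma complex_Int_face_of:
  assumes "polyhedral_complex C" "\<tau> \<in> C" "\<sigma> \<in> C" "\<tau> \<inter> \<sigma> \<noteq> {}"
  shows "(\<tau> \<inter> \<sigma>) face_of \<tau>" "(\<tau> \<inter> \<sigma>) face_of \<sigma>"
  using assms unfolding polyhedral_complex_def by blast+

text \<open>A face of \<open>\<tau>\<close> that meets the relative interior of
  \<open>\<tau>\<close> is all of \<open>\<tau>\<close>. Hence the cell with \<open>p\<close> in its
  relative interior is a face of every cell through \<open>p\<close>.\<close>

lemma complex_face_of:
  assumes C: "polyhedral_complex C" "\<tau> \<in> C" "\<sigma> \<in> C" and p: "p \<in> rel_interior \<tau>" "p \<in> \<sigma>"
  shows "\<tau> face_of \<sigma>"
proof -
  have "p \<in> \<tau>" using p rel_interior_subset by blast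
  then have f: "(\<tau> \<inter> \<sigma>) face_of \<tau>" "(\<tau> \<inter> \<sigma>) face_of \<sigma>"
    using C p unfolding polyhedral_complex_def by blast+
  have "\<tau> \<subseteq> \<tau> \<inter> \<sigma>"
    by (rule subset_of_face_of[OF f(1)]) (use p \<open>p \<in> \<tau>\<close> in auto)
  then have "\<tau> \<inter> \<sigma> = \<tau>" by blast
  then show ?thesis using f by simp
qed

lemma complex_subset_face_of:
  assumes C: "polyhedral_complex C" "\<tau> \<in> C" "\<sigma> \<in> C" "\<tau> \<subseteq> \<sigma>"
  shows "\<tau> face_of \<sigma>"
proof -
  have "\<tau> \<inter> \<sigma> = \<tau>" "\<tau> \<noteq> {}" using C polyhedral_complex_cellD(4) by auto
  then show ?thesis using C unfolding polyhedral_complex_def by metis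
qed

text \<open>Descent through facets: a point of a cell outside its relative interior lies on a facet,
  which has smaller dimension. The measure is shifted by one because \<open>aff_dim\<close> starts
  at -1.\<close>

lemma complex_rel_interior_cell:
  assumes C: "polyhedral_complex C" and "\<sigma> \<in> C" "p \<in> \<sigma>"
  obtains \<tau> where "\<tau> \<in> C" "p \<in> rel_interior \<tau>"
proof -
  have "\<exists>\<tau>\<in>C. p \<in> rel_interior \<tau>"
    using assms(2,3)
  proof (induction "nat (aff_dim \<sigma> + 1)" arbitrary: \<sigma> rule: less_induct)
    case less
    show ?case
    proof (cases "p \<in> rel_interior \<sigma>")
      case False
      have "p \<in> rel_frontier \<sigma>"
        using less.prems False polyhedral_complex_cellD(3)[OF C] by (simp add: rel_frontier_def)
      then obtain F where F: "F facet_of \<sigma>" "p \<in> F"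
        using rel_frontier_of_polyhedron polyhedral_complex_cellD(1)[OF C] less.prems by blast
      then have "F \<in> C"
        using C less.prems facet_of_imp_face_of[OF F(1)] unfolding polyhedral_complex_def by blast
      moreover have "nat (aff_dim F + 1) < nat (aff_dim \<sigma> + 1)"
        using F(1) aff_dim_geq[of F] unfolding facet_of_def by linarith
      ultimately show ?thesis using less.hyps F(2) by blast
    qed (use less.prems in blast)
  qed
  with that show ?thesis by blast
qed

text \<open>The class of \<open>n\<close> generates the integer points of
  \<open>span (insert n H)\<close> modulo those of \<open>H\<close>. No cell is mentioned, so
  normals coming from two different complexes can be compared.\<close>

definition primitive_modulo :: "(real ^ 'n) set \<Rightarrow> real ^ 'n \<Rightarrow> bool" where
  "primitive_modulo H n \<longleftrightarrow> n \<notin> H \<and>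
     span (insert n H) \<inter> integer_points = {u + of_int m *\<^sub>R n |u m. u \<in> H \<inter> integer_points}"

lemma primitive_modulo_decompose:
  assumes "primitive_modulo H n" "w \<in> span (insert n H)" "w \<in> integer_points"
  obtains u m where "u \<in> H" "w = u + of_int m *\<^sub>R n"
proof -
  have "w \<in> {u + of_int m *\<^sub>R n |u m. u \<in> H \<inter> integer_points}"
    using assms unfolding primitive_modulo_def by (metis IntI)
  then show ?thesis using that by auto
qed

lemma primitive_modulo_integer:
  assumes "subspace H" "primitive_modulo H n" shows "n \<in> integer_points"
proof -
  have "0 \<in> H \<inter> integer_points" using assms(1) by (auto simp: integer_points_def subspace_0)
  then have "n \<in> {u + of_int m *\<^sub>R n |u m. u \<in> H \<inter> integer_points}"
    by (intro CollectI exI[of _ 0] exI[of _ 1]) simp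
  then show ?thesis using assms(2) unfolding primitive_modulo_def by (metis IntD2)
qed

text \<open>Modulo \<open>H\<close> both vectors generate the same infinite cyclic group, so each is
  an integer multiple of the other and the factors \<open>m\<close> and \<open>m'\<close> are
  inverse integers.\<close>

lemma primitive_modulo_unique:
  assumes H: "subspace H" and n: "primitive_modulo H n" and n': "primitive_modulo H n'"
    and a: "n' - a *\<^sub>R n \<in> H"
  shows "a = 1 \<or> a = -1"
proof -
  have nH: "n \<notin> H" "n' \<notin> H" using n n' by (auto simp: primitive_modulo_def)
  have a0: "a \<noteq> 0" using a nH by auto
  have "n' \<in> span (insert n H)" using a span_insert_subspace[OF H] by blast
  then obtain u m where u: "u \<in> H" "n' = u + of_int m *\<^sub>R n"
    using primitive_modulo_decompose[OF n] primitive_modulo_integer[OF H n'] by blast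
  have "(- (1/a)) *\<^sub>R (n' - a *\<^sub>R n) \<in> H" using a H by (rule subspace_scale[rotated])
  then have "n - (1/a) *\<^sub>R n' \<in> H" using a0 by (simp add: algebra_simps)
  then have "n \<in> span (insert n' H)" using span_insert_subspace[OF H] by blast
  then obtain u' m' where u': "u' \<in> H" "n = u' + of_int m' *\<^sub>R n'"
    using primitive_modulo_decompose[OF n'] primitive_modulo_integer[OF H n] by blast
  have am: "a = of_int m"
  proof (rule ccontr)
    assume ne: "a \<noteq> of_int m"
    have "(n' - a *\<^sub>R n) - u = (of_int m - a) *\<^sub>R n" using u by (simp add: algebra_simps)
    then have "(of_int m - a) *\<^sub>R n \<in> H" using a u H by (metis subspace_diff)
    then have "(1 / (of_int m - a)) *\<^sub>R ((of_int m - a) *\<^sub>R n) \<in> H" using H by (rule subspace_scale[rotated])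
    then show False using ne nH by simp
  qed
  \<comment> \<open>Substituting one expression into the other puts \<open>n\<close>, multiplied by
    \<open>1 - m * m'\<close>, into \<open>H\<close>, while \<open>n\<close> itself is not in
    \<open>H\<close>.\<close>
  have "m * m' = 1"
  proof (rule ccontr)
    assume ne: "m * m' \<noteq> 1"
    define c :: real where "c = 1 - of_int (m * m')"
    have "c = of_int (1 - m * m')" by (simp add: c_def)
    then have c: "c \<noteq> 0" using ne by (metis diff_eq_eq add_0 of_int_0_eq_iff)
    have "c *\<^sub>R n = u' + of_int m' *\<^sub>R u"
    proof -
      have "n = u' + of_int m' *\<^sub>R (u + of_int m *\<^sub>R n)" using u' u by simp
      then show ?thesis unfolding c_def by (simp add: algebra_simps)
    qed
    then have "c *\<^sub>R n \<in> H" using u u' H by (metis subspace_add subspace_scale)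
    then have "(1 / c) *\<^sub>R (c *\<^sub>R n) \<in> H" using H by (rule subspace_scale[rotated])
    then show False using c nH by simp
  qed
  then have "m = 1 \<or> m = -1" by (metis zmult_eq_1_iff)
  then show ?thesis using am by auto
qed

lemma primitive_modulo_uminus:
  assumes "subspace H" "primitive_modulo H n" shows "primitive_modulo H (- n)"
proof -
  have "span (insert (- n) H) = span (insert n H)"
  proof -
    have "(\<exists>a. w - a *\<^sub>R (- n) \<in> H) \<longleftrightarrow> (\<exists>a. w - a *\<^sub>R n \<in> H)" for w
    proof safe
      fix a assume "w - a *\<^sub>R (- n) \<in> H"
      then show "\<exists>a. w - a *\<^sub>R n \<in> H" by (intro exI[of _ "- a"]) simp
    next
      fix a assume "w - a *\<^sub>R n \<in> H"
      then show "\<exists>a. w - a *\<^sub>R (- n) \<in> H" by (intro exI[of _ "- a"]) simp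
    qed
    then show ?thesis using span_insert_subspace[OF assms(1)] by blast
  qed
  moreover have "{u + of_int m *\<^sub>R (- n) |u m. u \<in> H \<inter> integer_points} = {u + of_int m *\<^sub>R n |u m. u \<in> H \<inter> integer_points}"
  proof -
    have "\<exists>u' m'. u + of_int m *\<^sub>R w = u' + of_int m' *\<^sub>R (- w) \<and> u' \<in> H \<inter> integer_points"
      if "u \<in> H \<inter> integer_points" for u w and m :: int
      by (rule exI[of _ u], rule exI[of _ "- m"]) (use that in simp)
    from this[where w = n] this[where w = "- n"] show ?thesis by auto
  qed
  moreover have "- n \<notin> H" using assms subspace_neg[of H "- n"] by (auto simp: primitive_modulo_def)
  ultimately show ?thesis using assms(2) by (simp add: primitive_modulo_def)
qed

section \<open>Cells, ridges and lattice normals of a rational complex\<close>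

locale lattice_complex =
  fixes k :: nat and C :: "(real ^ 'n) set set"
    and z :: "(real ^ 'n) set \<Rightarrow> (real ^ 'n) set \<Rightarrow> real ^ 'n"
  assumes pure: "pure_complex k C" and rational: "rational_complex k C"
    and normals: "lattice_normals k C z"
begin

lemma complex: "polyhedral_complex C"
  using pure by (simp add: pure_complex_def)

lemmas cellD = polyhedral_complex_cellD[OF complex]

lemma finite_cells: "finite C" "finite (max_cells k C)" "finite (ridges k C)"
proof -
  show "finite C" using complex unfolding polyhedral_complex_def by (rule conjunct1)
  then show "finite (max_cells k C)" "finite (ridges k C)" by (auto simp: max_cells_def ridges_def)
qed

lemma max_cellD: "\<sigma> \<in> max_cells k C \<Longrightarrow> \<sigma> \<in> C" "\<sigma> \<in> max_cells k C \<Longrightarrow> aff_dim \<sigma> = int k"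
  by (auto simp: max_cells_def)

lemma ridgeD: "\<tau> \<in> ridges k C \<Longrightarrow> \<tau> \<in> C" "\<tau> \<in> ridges k C \<Longrightarrow> aff_dim \<tau> = int k - 1"
  by (auto simp: ridges_def)

lemma aff_dim_cell_le: "\<sigma> \<in> C \<Longrightarrow> aff_dim \<sigma> \<le> int k"
proof -
  assume "\<sigma> \<in> C"
  then have "aff_dim \<sigma> \<le> complex_dim C"
    unfolding complex_dim_def using finite_cells(1) by (intro Max_ge) auto
  then show ?thesis using pure by (simp only: pure_complex_def)
qed

lemma cell_subset_max_cell:
  assumes "\<sigma> \<in> C" obtains \<rho> where "\<rho> \<in> max_cells k C" "\<sigma> face_of \<rho>"
proof (cases "aff_dim \<sigma> < int k")
  case True
  moreover have "\<forall>\<tau>\<in>C. aff_dim \<tau> < int k \<longrightarrow> (\<exists>\<sigma>\<in>max_cells k C. \<tau> face_of \<sigma>)"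
    using pure unfolding pure_complex_def by (elim conjE)
  ultimately show ?thesis using assms that by metis
next
  case False
  then have "\<sigma> \<in> max_cells k C"
    using assms aff_dim_cell_le[OF assms] by (simp add: max_cells_def)
  then show ?thesis using that[of \<sigma>] face_of_refl[OF cellD(2)[OF assms]] by blast
qed

lemma Union_max_cells: "\<Union>(max_cells k C) = \<Union>C"
proof
  show "\<Union>C \<subseteq> \<Union>(max_cells k C)"
  proof
    fix p assume "p \<in> \<Union>C"
    then obtain \<sigma> where \<sigma>: "\<sigma> \<in> C" "p \<in> \<sigma>" by blast
    obtain \<rho> where "\<rho> \<in> max_cells k C" "\<sigma> face_of \<rho>" using cell_subset_max_cell[OF \<sigma>(1)] .
    then show "p \<in> \<Union>(max_cells k C)" using \<sigma>(2) face_of_imp_subset by blast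
  qed
qed (auto simp: max_cells_def)

lemma max_cells_nonempty: "max_cells k C \<noteq> {}"
proof -
  have "C \<noteq> {}" using complex unfolding polyhedral_complex_def by (elim conjE)
  then obtain \<sigma> where "\<sigma> \<in> C" by (metis all_not_in_conv)
  then obtain \<rho> where "\<rho> \<in> max_cells k C" by (rule cell_subset_max_cell)
  then show ?thesis by (metis empty_iff)
qed

lemma max_cell_eq:
  assumes "\<sigma> \<in> max_cells k C" "\<sigma> face_of \<rho>" "\<rho> \<in> C" shows "\<rho> = \<sigma>"
  using assms face_of_aff_dim_lt[OF cellD(2)[OF assms(3)] assms(2)] aff_dim_cell_le[OF assms(3)]
    max_cellD(2)[OF assms(1)] by fastforce

text \<open>The intersection is a face of both cells, and a proper face has smaller dimension.
  Overlap in full dimension is the test by which maximal cells are identified.\<close>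

lemma max_cells_eqI:
  assumes "\<sigma> \<in> max_cells k C" "\<rho> \<in> max_cells k C" "int k \<le> aff_dim (\<sigma> \<inter> \<rho>)"
  shows "\<sigma> = \<rho>"
proof -
  have "\<sigma> \<inter> \<rho> \<noteq> {}" using assms(3) by auto
  then have f: "(\<sigma> \<inter> \<rho>) face_of \<sigma>" "(\<sigma> \<inter> \<rho>) face_of \<rho>"
    using complex_Int_face_of[OF complex max_cellD(1)[OF assms(1)] max_cellD(1)[OF assms(2)]] by blast+
  have "\<sigma> \<inter> \<rho> = \<sigma>"
    using face_of_aff_dim_lt[OF cellD(2)[OF max_cellD(1)[OF assms(1)]] f(1)] assms(3)
      max_cellD(2)[OF assms(1)] by fastforce
  moreover have "\<sigma> \<inter> \<rho> = \<rho>"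
    using face_of_aff_dim_lt[OF cellD(2)[OF max_cellD(1)[OF assms(2)]] f(2)] assms(3)
      max_cellD(2)[OF assms(2)] by fastforce
  ultimately
  show ?thesis by simp
qed

lemma dim_lin_space_max_cell: "\<sigma> \<in> max_cells k C \<Longrightarrow> dim (lin_space \<sigma>) = k"
  by (metis dim_lin_space cellD(4) max_cellD of_nat_eq_iff)

lemma dim_lin_space_ridge: "\<tau> \<in> ridges k C \<Longrightarrow> Suc (dim (lin_space \<tau>)) = k"
proof -
  assume "\<tau> \<in> ridges k C"
  then have "int (dim (lin_space \<tau>)) = int k - 1"
    by (metis dim_lin_space cellD(4) ridgeD)
  then show ?thesis by linarith
qed

context
  fixes \<tau> \<sigma> assumes \<tau>: "\<tau> \<in> ridges k C" and \<sigma>: "\<sigma> \<in> max_cells k C" and sub: "\<tau> \<subseteq> \<sigma>"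
begin

lemma lattice_normal: "lattice_normal \<tau> \<sigma> (z \<tau> \<sigma>)"
  using normals \<tau> \<sigma> sub unfolding lattice_normals_def by blast

lemma
  shows normal_in_cell_lattice: "z \<tau> \<sigma> \<in> cell_lattice \<sigma>"
    and cell_lattice_eq: "cell_lattice \<sigma> = {u + of_int m *\<^sub>R z \<tau> \<sigma> |u m. u \<in> cell_lattice \<tau>}"
    and normal_direction: "\<exists>x\<in>\<tau>. \<exists>r>0. x + r *\<^sub>R z \<tau> \<sigma> \<in> \<sigma>"
proof -
  show "z \<tau> \<sigma> \<in> cell_lattice \<sigma>"
    using lattice_normal unfolding lattice_normal_def by (elim conjE)
  show "cell_lattice \<sigma> = {u + of_int m *\<^sub>R z \<tau> \<sigma> |u m. u \<in> cell_lattice \<tau>}"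
    using lattice_normal unfolding lattice_normal_def by (elim conjE)
  show "\<exists>x\<in>\<tau>. \<exists>r>0. x + r *\<^sub>R z \<tau> \<sigma> \<in> \<sigma>"
    using lattice_normal unfolding lattice_normal_def by (elim conjE)
qed

lemma ridge_lin_space_subset: "lin_space \<tau> \<subseteq> lin_space \<sigma>"
  using sub by (rule lin_space_mono)

lemma normal_in_lin_space: "z \<tau> \<sigma> \<in> lin_space \<sigma>"
  using normal_in_cell_lattice by (simp add: cell_lattice_def)

text \<open>Otherwise the whole lattice of \<open>\<sigma>\<close>, which by rationality contains k
  independent vectors, would lie in the (k-1)-dimensional space of \<open>\<tau>\<close>.\<close>

lemma normal_notin_lin_space: "z \<tau> \<sigma> \<notin> lin_space \<tau>"
proof
  assume zt: "z \<tau> \<sigma> \<in> lin_space \<tau>"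
  obtain B where B: "lattice_basis B (cell_lattice \<sigma>)" "int (card B) = aff_dim \<sigma>"
    using rational \<sigma> unfolding rational_complex_def by blast
  then have fin: "finite B" and ind: "independent B" by (auto simp: lattice_basis_def)
  have "B \<subseteq> cell_lattice \<sigma>"
  proof
    fix b assume b: "b \<in> B"
    have "(\<Sum>x\<in>B. of_int (if x = b then 1 else 0) *\<^sub>R x) = (\<Sum>x\<in>B. if x = b then x else 0)"
      by (intro sum.cong) auto
    then have eq: "b = (\<Sum>x\<in>B. of_int (if x = b then 1 else 0) *\<^sub>R x)"
      using fin b by simp
    have lat: "cell_lattice \<sigma> = {(\<Sum>x\<in>B. of_int (c x) *\<^sub>R x) | c :: real ^ 'n \<Rightarrow> int. True}"
      using B(1) unfolding lattice_basis_def by (elim conjE)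
    show "b \<in> cell_lattice \<sigma>"
      unfolding lat
      by (rule CollectI, rule exI[of _ "\<lambda>x. if x = b then 1 else 0"], rule conjI[OF eq TrueI])
  qed
  also have "\<dots> \<subseteq> lin_space \<tau>"
  proof
    fix v assume "v \<in> cell_lattice \<sigma>"
    then obtain u m where "u \<in> cell_lattice \<tau>" "v = u + of_int m *\<^sub>R z \<tau> \<sigma>"
      unfolding cell_lattice_eq by blast
    then show "v \<in> lin_space \<tau>"
      using zt by (simp add: cell_lattice_def subspace_add subspace_scale)
  qed
  finally have "card B \<le> dim (lin_space \<tau>)" using ind by (simp add: independent_card_le_dim)
  then show False using B(2) dim_lin_space_ridge[OF \<tau>] max_cellD(2)[OF \<sigma>] by simp
qed

lemma lin_space_eq: "lin_space \<sigma> = span (insert (z \<tau> \<sigma>) (lin_space \<tau>))"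
  by (rule subspace_eq_span_insert[OF subspace_lin_space subspace_lin_space ridge_lin_space_subset
        normal_in_lin_space normal_notin_lin_space])
    (simp add: dim_lin_space_ridge[OF \<tau>] dim_lin_space_max_cell[OF \<sigma>])

lemma normal_primitive: "primitive_modulo (lin_space \<tau>) (z \<tau> \<sigma>)"
  using cell_lattice_eq normal_notin_lin_space
  by (simp only: primitive_modulo_def cell_lattice_def lin_space_eq) simp

text \<open>The normal is only known to point into \<open>\<sigma>\<close> from some point
  \<open>x\<close> of \<open>\<tau>\<close>. At a relative interior point all directions along
  \<open>\<tau>\<close> are tangent, so the displacement \<open>p - x\<close> can be added.\<close>

lemma normal_in_tangent_cone:
  assumes p: "p \<in> rel_interior \<tau>" shows "z \<tau> \<sigma> \<in> tangent_cone p \<sigma>"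
proof -
  have p\<tau>: "p \<in> \<tau>" using p rel_interior_subset by blast
  obtain x r where x: "x \<in> \<tau>" "r > 0" "x + r *\<^sub>R z \<tau> \<sigma> \<in> \<sigma>"
    using normal_direction by blast
  have "p - x \<in> lin_space \<tau>" using p\<tau> x unfolding lin_space_def by (intro span_base) blast
  then have "p - x \<in> tangent_cone p \<sigma>"
    using tangent_cone_rel_interior[OF p] tangent_cone_mono[OF sub] by blast
  moreover have "x + r *\<^sub>R z \<tau> \<sigma> - p \<in> tangent_cone p \<sigma>"
    using x unfolding tangent_cone_def by (auto intro!: exI[of _ 1])
  ultimately have "(p - x) + (x + r *\<^sub>R z \<tau> \<sigma> - p) \<in> tangent_cone p \<sigma>"
    using cellD(2) max_cellD(1)[OF \<sigma>] p\<tau> sub by (intro tangent_cone_add) auto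
  then have "r *\<^sub>R z \<tau> \<sigma> \<in> tangent_cone p \<sigma>" by simp
  then have "(1/r) *\<^sub>R (r *\<^sub>R z \<tau> \<sigma>) \<in> tangent_cone p \<sigma>"
    by (rule tangent_cone_scale) (use x(2) in simp)
  then show ?thesis using x(2) by simp
qed

text \<open>A negative coefficient would put \<open>p\<close> inside a segment of
  \<open>\<sigma>\<close> transversal to the face \<open>\<tau>\<close>, which is impossible. The
  tangent cone is thus a closed half-space of \<open>lin_space \<sigma>\<close> with boundary
  \<open>lin_space \<tau>\<close>.\<close>

lemma tangent_cone_ridge:
  assumes p: "p \<in> rel_interior \<tau>"
  shows "v \<in> tangent_cone p \<sigma> \<longleftrightarrow> (\<exists>a\<ge>0. v - a *\<^sub>R z \<tau> \<sigma> \<in> lin_space \<tau>)"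
proof
  have p\<tau>: "p \<in> \<tau>" using p rel_interior_subset by blast
  have conv: "convex \<sigma>" using cellD(2) max_cellD(1)[OF \<sigma>] .
  have Hsub: "lin_space \<tau> \<subseteq> tangent_cone p \<sigma>"
    using tangent_cone_rel_interior[OF p] tangent_cone_mono[OF sub] by blast
  have zT: "z \<tau> \<sigma> \<in> tangent_cone p \<sigma>" using normal_in_tangent_cone[OF p] .
  {
    assume v: "v \<in> tangent_cone p \<sigma>"
    then have "v \<in> lin_space \<sigma>" using tangent_cone_subset_lin_space p\<tau> sub by blast
    then obtain a where a: "v - a *\<^sub>R z \<tau> \<sigma> \<in> lin_space \<tau>"
      using lin_space_eq span_insert_subspace[OF subspace_lin_space] by blast
    have "a \<ge> 0"
    proof (rule ccontr)
      assume "\<not> a \<ge> 0"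
      define w where "w = (- a) *\<^sub>R z \<tau> \<sigma>"
      have "- (v - a *\<^sub>R z \<tau> \<sigma>) \<in> lin_space \<tau>" using a by (rule subspace_neg[OF subspace_lin_space])
      then have "v + (- (v - a *\<^sub>R z \<tau> \<sigma>)) \<in> tangent_cone p \<sigma>"
        using v Hsub conv p\<tau> sub by (intro tangent_cone_add) auto
      then have w1: "- w \<in> tangent_cone p \<sigma>" by (simp add: w_def)
      have w2: "w \<in> tangent_cone p \<sigma>"
        unfolding w_def using zT \<open>\<not> a \<ge> 0\<close> by (intro tangent_cone_scale) auto
      obtain e1 where e1: "e1 > 0" "\<And>t. 0 \<le> t \<Longrightarrow> t \<le> e1 \<Longrightarrow> p + t *\<^sub>R w \<in> \<sigma>"
        using tangent_cone_small[OF conv _ w2] p\<tau> sub by blast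
      obtain e2 where e2: "e2 > 0" "\<And>t. 0 \<le> t \<Longrightarrow> t \<le> e2 \<Longrightarrow> p + t *\<^sub>R (- w) \<in> \<sigma>"
        using tangent_cone_small[OF conv _ w1] p\<tau> sub by blast
      define e where "e = min e1 e2"
      have e: "e > 0" "p + e *\<^sub>R w \<in> \<sigma>" "p - e *\<^sub>R w \<in> \<sigma>"
        using e1 e2(1) e2(2)[of e] by (auto simp: e_def)
      have w0: "w \<noteq> 0" using \<open>\<not> a \<ge> 0\<close> normal_notin_lin_space subspace_0[OF subspace_lin_space, of \<tau>]
        by (auto simp: w_def)
      have "midpoint (p - e *\<^sub>R w) (p + e *\<^sub>R w) = p"
        by (simp add: midpoint_def scaleR_2[symmetric])
      moreover have "p - e *\<^sub>R w \<noteq> p + e *\<^sub>R w"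
      proof
        assume "p - e *\<^sub>R w = p + e *\<^sub>R w"
        then have "2 *\<^sub>R (e *\<^sub>R w) = 0" unfolding scaleR_2 by (simp add: algebra_simps)
        then show False using e w0 by simp
      qed
      ultimately have "p \<in> open_segment (p - e *\<^sub>R w) (p + e *\<^sub>R w)"
        using midpoint_in_open_segment by metis
      then have "p + e *\<^sub>R w \<in> \<tau>"
        using face_ofD[OF complex_subset_face_of[OF complex ridgeD(1)[OF \<tau>] max_cellD(1)[OF \<sigma>] sub]] e p\<tau>
        by blast
      then have "w \<in> lin_space \<tau>"
        using e(1) tangent_cone_subset_lin_space[OF p\<tau>] unfolding tangent_cone_def by blast
      then have "(1 / (- a)) *\<^sub>R w \<in> lin_space \<tau>" by (rule subspace_scale[OF subspace_lin_space])
      then show False using normal_notin_lin_space \<open>\<not> a \<ge> 0\<close> by (simp add: w_def)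
    qed
    with a show "\<exists>a\<ge>0. v - a *\<^sub>R z \<tau> \<sigma> \<in> lin_space \<tau>" by blast
  }
  {
    assume "\<exists>a\<ge>0. v - a *\<^sub>R z \<tau> \<sigma> \<in> lin_space \<tau>"
    then obtain a where a: "a \<ge> 0" "v - a *\<^sub>R z \<tau> \<sigma> \<in> lin_space \<tau>" by blast
    show "v \<in> tangent_cone p \<sigma>"
    proof (cases "a = 0")
      case True
      then show ?thesis using a Hsub by auto
    next
      case False
      then have "(v - a *\<^sub>R z \<tau> \<sigma>) + a *\<^sub>R z \<tau> \<sigma> \<in> tangent_cone p \<sigma>"
        using a Hsub zT conv p\<tau> sub by (intro tangent_cone_add tangent_cone_scale) auto
      then show ?thesis by simp
    qed
  }
qed

end

end


section \<open>Balancing at a point\<close>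

lemma aff_dim_ge_tangent_cone:
  fixes S :: "(real ^ 'n) set"
  assumes "subspace H" "p \<in> S" "H \<subseteq> tangent_cone p S" "v \<in> tangent_cone p S" "v \<notin> H"
  shows "int (Suc (dim H)) \<le> aff_dim S"
proof -
  have "insert v H \<subseteq> lin_space S"
    using assms tangent_cone_subset_lin_space[OF assms(2)] by blast
  then have "dim (insert v H) \<le> dim (lin_space S)" by (rule dim_subset)
  moreover have "dim (insert v H) = Suc (dim H)"
    using assms by (simp add: dim_insert span_eq_iff[THEN iffD2])
  moreover have "int (dim (lin_space S)) = aff_dim S"
    using assms(2) by (intro dim_lin_space) blast
  ultimately show ?thesis by linarith
qed

context lattice_complex
begin

text \<open>Tangent cones of convex sets commute with intersection, so a common direction outside
  \<open>H\<close> raises the dimension of the intersection to k. The convex set \<open>B\<close>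
  may be a cell of another complex or of \<open>C\<close> itself.\<close>

lemma aff_dim_Int_max_cell:
  assumes "subspace H" "Suc (dim H) = k" "\<sigma> \<in> max_cells k C" "convex B" "p \<in> \<sigma>" "p \<in> B"
    and "H \<subseteq> tangent_cone p \<sigma>" "H \<subseteq> tangent_cone p B"
    and "v \<in> tangent_cone p \<sigma>" "v \<in> tangent_cone p B" "v \<notin> H"
  shows "aff_dim (\<sigma> \<inter> B) = int k"
proof (rule antisym)
  show "aff_dim (\<sigma> \<inter> B) \<le> int k"
    using aff_dim_subset[of "\<sigma> \<inter> B" \<sigma>] max_cellD(2)[OF assms(3)] by simp
  have "tangent_cone p (\<sigma> \<inter> B) = tangent_cone p \<sigma> \<inter> tangent_cone p B"
    using assms cellD(2)[OF max_cellD(1)[OF assms(3)]] by (intro tangent_cone_Int)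
  then have "int (Suc (dim H)) \<le> aff_dim (\<sigma> \<inter> B)"
    using assms by (intro aff_dim_ge_tangent_cone[where v = v and p = p]) auto
  then show "int k \<le> aff_dim (\<sigma> \<inter> B)" using assms(2) by simp
qed

lemma max_cell_tangent_unique:
  assumes "subspace H" "Suc (dim H) = k" "\<sigma> \<in> max_cells k C" "\<rho> \<in> max_cells k C" "p \<in> \<sigma>" "p \<in> \<rho>"
    and "H \<subseteq> tangent_cone p \<sigma>" "H \<subseteq> tangent_cone p \<rho>"
    and "v \<in> tangent_cone p \<sigma>" "v \<in> tangent_cone p \<rho>" "v \<notin> H"
  shows "\<sigma> = \<rho>"
  using aff_dim_Int_max_cell[OF assms(1-3) cellD(2)[OF max_cellD(1)[OF assms(4)]] assms(5-11)]
  by (intro max_cells_eqI[OF assms(3,4)]) simp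

end

locale balanced_complex = lattice_complex k C z
  for k :: nat and C :: "(real ^ 'n) set set" and z +
  fixes \<eta> :: "(real ^ 'n) set \<Rightarrow> int"
  assumes balanced: "balanced_weighting k C z \<eta>"
begin

lemma weight_pos: "\<sigma> \<in> max_cells k C \<Longrightarrow> \<eta> \<sigma> > 0"
  using balanced unfolding balanced_weighting_def weighting_def by blast

lemma balanced_ridge:
  "\<tau> \<in> ridges k C \<Longrightarrow>
    (\<Sum>\<sigma> | \<sigma> \<in> max_cells k C \<and> \<tau> face_of \<sigma>. of_int (\<eta> \<sigma>) *\<^sub>R z \<tau> \<sigma>) \<in> lin_space \<tau>"
  using balanced unfolding balanced_weighting_def by blast

text \<open>Balancing holds at every point \<open>p\<close> near which the complex is invariant under translation by
  \<open>H\<close>, with \<open>N\<close> listing the directions modulo \<open>H\<close>. If \<open>p\<close> is interior to a maximal cell, two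
  opposite directions cancel; otherwise \<open>p\<close> is interior to a ridge parallel to \<open>H\<close>.\<close>

lemma local_balance:
  assumes H: "subspace H" "Suc (dim H) = k" and p: "p \<in> \<Union>C"
    and tangent: "\<And>\<kappa>. \<kappa> \<in> C \<Longrightarrow> p \<in> \<kappa> \<Longrightarrow> H \<subseteq> tangent_cone p \<kappa>"
    and N: "finite N" "\<And>n. n \<in> N \<Longrightarrow> primitive_modulo H n"
    and sep: "\<And>n n' a. n \<in> N \<Longrightarrow> n' \<in> N \<Longrightarrow> a > 0 \<Longrightarrow> n' - a *\<^sub>R n \<in> H \<Longrightarrow> n' = n"
    and cover: "\<And>\<rho> v. \<rho> \<in> max_cells k C \<Longrightarrow> p \<in> \<rho> \<Longrightarrow> v \<in> tangent_cone p \<rho> \<Longrightarrow> v \<notin> H \<Longrightarrow>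
      \<exists>n\<in>N. \<exists>a>0. v - a *\<^sub>R n \<in> H"
  shows "(\<Sum>n\<in>N. \<Sum>\<rho> | \<rho> \<in> max_cells k C \<and> p \<in> \<rho> \<and> n \<in> tangent_cone p \<rho>. of_int (\<eta> \<rho>) *\<^sub>R n) \<in> H"
proof -
  define M where "M = {\<rho> \<in> max_cells k C. p \<in> \<rho>}"
  have finM: "finite M" using finite_cells(2) by (simp add: M_def)
  \<comment> \<open>Regrouping by cells leaves, for each cell at \<open>p\<close>, the sum of the
    directions of \<open>N\<close> that point into it; the two cases below evaluate this inner
    sum.\<close>
  have "(\<Sum>n\<in>N. \<Sum>\<rho> | \<rho> \<in> max_cells k C \<and> p \<in> \<rho> \<and> n \<in> tangent_cone p \<rho>. of_int (\<eta> \<rho>) *\<^sub>R n)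
    = (\<Sum>n\<in>N. \<Sum>\<rho> | \<rho> \<in> M \<and> n \<in> tangent_cone p \<rho>. of_int (\<eta> \<rho>) *\<^sub>R n)"
    by (simp add: M_def)
  also have "\<dots> = (\<Sum>\<rho>\<in>M. \<Sum>n | n \<in> N \<and> n \<in> tangent_cone p \<rho>. of_int (\<eta> \<rho>) *\<^sub>R n)"
    using N(1) finM by (rule sum.swap_restrict)
  also have "\<dots> = (\<Sum>\<rho>\<in>M. of_int (\<eta> \<rho>) *\<^sub>R (\<Sum>n | n \<in> N \<and> n \<in> tangent_cone p \<rho>. n))"
    by (simp add: scaleR_sum_right)
  finally have swap: "(\<Sum>n\<in>N. \<Sum>\<rho> | \<rho> \<in> max_cells k C \<and> p \<in> \<rho> \<and> n \<in> tangent_cone p \<rho>. of_int (\<eta> \<rho>) *\<^sub>R n)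
    = (\<Sum>\<rho>\<in>M. of_int (\<eta> \<rho>) *\<^sub>R (\<Sum>n | n \<in> N \<and> n \<in> tangent_cone p \<rho>. n))" .
  obtain \<kappa> where \<kappa>: "\<kappa> \<in> C" "p \<in> rel_interior \<kappa>"
    using p complex_rel_interior_cell[OF complex] by blast
  have p\<kappa>: "p \<in> \<kappa>" using \<kappa>(2) rel_interior_subset by blast
  have H\<kappa>: "H \<subseteq> lin_space \<kappa>" using tangent[OF \<kappa>(1) p\<kappa>] tangent_cone_rel_interior[OF \<kappa>(2)] by simp
  have NH: "n \<notin> H" if "n \<in> N" for n using N(2)[OF that] by (simp add: primitive_modulo_def)
  show ?thesis
  proof (cases "\<kappa> \<in> max_cells k C")
    case True
    have M: "M = {\<kappa>}"
    proof -
      have "\<rho> = \<kappa>" if "\<rho> \<in> M" for \<rho>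
      proof -
        have "\<rho> \<in> C" "p \<in> \<rho>" using that max_cellD(1) by (auto simp: M_def)
        then show ?thesis by (intro max_cell_eq[OF True] complex_face_of[OF complex \<kappa>(1) _ \<kappa>(2)])
      qed
      moreover have "\<kappa> \<in> M" using True p\<kappa> by (simp add: M_def)
      ultimately show ?thesis by blast
    qed
    have T: "tangent_cone p \<kappa> = lin_space \<kappa>" by (rule tangent_cone_rel_interior[OF \<kappa>(2)])
    have "\<not> lin_space \<kappa> \<subseteq> H"
      using dim_subset[of "lin_space \<kappa>" H] dim_lin_space_max_cell[OF True] H(2) by auto
    then obtain v where v: "v \<in> lin_space \<kappa>" "v \<notin> H" by blast
    have v': "- v \<in> lin_space \<kappa>" "- v \<notin> H"
      using v subspace_neg[OF subspace_lin_space] subspace_neg[OF H(1), of "- v"] by auto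
    \<comment> \<open>Both \<open>v\<close> and \<open>- v\<close> are tangent to the single cell at
      \<open>p\<close>; \<open>n1\<close> and \<open>n2\<close> represent the two sides of
      \<open>H\<close> in it.\<close>
    obtain n1 a1 where n1: "n1 \<in> N" "a1 > 0" "v - a1 *\<^sub>R n1 \<in> H"
      using cover[OF True p\<kappa>] v T by blast
    obtain n2 a2 where n2: "n2 \<in> N" "a2 > 0" "- v - a2 *\<^sub>R n2 \<in> H"
      using cover[OF True p\<kappa>] v' T by blast
    have L: "lin_space \<kappa> = span (insert v H)"
      using v H H\<kappa> dim_lin_space_max_cell[OF True] by (intro subspace_eq_span_insert) auto
    have "- (v - a1 *\<^sub>R n1) - (- v - a2 *\<^sub>R n2) \<in> H"
      by (rule subspace_diff[OF H(1) subspace_neg[OF H(1) n1(3)] n2(3)])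
    then have "(1 / a2) *\<^sub>R (- (v - a1 *\<^sub>R n1) - (- v - a2 *\<^sub>R n2)) \<in> H"
      using H(1) by (intro subspace_scale)
    moreover have "(1 / a2) *\<^sub>R (- (v - a1 *\<^sub>R n1) - (- v - a2 *\<^sub>R n2)) = n2 - (- (a1 / a2)) *\<^sub>R n1"
      using n2(2) by (simp add: algebra_simps)
    ultimately have d: "n2 - (- (a1 / a2)) *\<^sub>R n1 \<in> H" by simp
    \<comment> \<open>So \<open>n2\<close> is a negative multiple of \<open>n1\<close> modulo
      \<open>H\<close>; as both are primitive, the factor is -1.\<close>
    have "- (a1 / a2) < 0" using n1(2) n2(2) by simp
    moreover have "- (a1 / a2) = 1 \<or> - (a1 / a2) = - 1"
      using primitive_modulo_unique[OF H(1) N(2)[OF n1(1)] N(2)[OF n2(1)] d] .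
    ultimately have "- (a1 / a2) = - 1" by linarith
    then have sum: "n1 + n2 \<in> H" using d by (simp add: add.commute)
    have ne: "n1 \<noteq> n2"
    proof
      assume "n1 = n2"
      then have "(1/2) *\<^sub>R (n1 + n1) \<in> H" using sum H(1) by (metis subspace_scale)
      moreover have "(1/2) *\<^sub>R (n1 + n1) = n1" by (metis scaleR_half_double)
      ultimately show False using NH[OF n1(1)] by simp
    qed
    have "{n \<in> N. n \<in> tangent_cone p \<kappa>} = {n1, n2}"
    proof
      show "{n \<in> N. n \<in> tangent_cone p \<kappa>} \<subseteq> {n1, n2}"
      proof
        fix n assume "n \<in> {n \<in> N. n \<in> tangent_cone p \<kappa>}"
        then have n: "n \<in> N" "n \<in> span (insert v H)" using T L by auto
        then obtain b where b: "n - b *\<^sub>R v \<in> H" using span_insert_subspace[OF H(1)] by blast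
        have "b \<noteq> 0" using b NH[OF n(1)] by auto
        then consider "b > 0" | "b < 0" by linarith
        then show "n \<in> {n1, n2}"
        proof cases
          case 1
          have "(n - b *\<^sub>R v) + b *\<^sub>R (v - a1 *\<^sub>R n1) \<in> H"
            using b n1(3) H(1) by (intro subspace_add subspace_scale)
          then have "n - (b * a1) *\<^sub>R n1 \<in> H" by (simp add: algebra_simps)
          then have "n = n1" using sep[OF n1(1) n(1), of "b * a1"] 1 n1(2) by simp
          then show ?thesis by simp
        next
          case 2
          have "(n - b *\<^sub>R v) + (- b) *\<^sub>R (- v - a2 *\<^sub>R n2) \<in> H"
            using b n2(3) H(1) by (intro subspace_add subspace_scale)
          then have "n - ((- b) * a2) *\<^sub>R n2 \<in> H" by (simp add: algebra_simps)
          then have "n = n2" using sep[OF n2(1) n(1), of "(- b) * a2"] 2 n2(2)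
            by (simp add: mult_neg_pos)
          then show ?thesis by simp
        qed
      qed
      have mem: "n \<in> tangent_cone p \<kappa>" if "a > 0" "w \<in> lin_space \<kappa>" "w - a *\<^sub>R n \<in> H" for n w a
      proof -
        have "w - (w - a *\<^sub>R n) \<in> lin_space \<kappa>"
          by (rule subspace_diff[OF subspace_lin_space that(2) subsetD[OF H\<kappa> that(3)]])
        then have "(1 / a) *\<^sub>R (w - (w - a *\<^sub>R n)) \<in> lin_space \<kappa>" by (intro subspace_scale) simp
        then show ?thesis using that(1) T by simp
      qed
      show "{n1, n2} \<subseteq> {n \<in> N. n \<in> tangent_cone p \<kappa>}"
        using mem[OF n1(2) v(1) n1(3)] mem[OF n2(2) v'(1) n2(3)] n1(1) n2(1) by blast
    qed
    then have "(\<Sum>n | n \<in> N \<and> n \<in> tangent_cone p \<kappa>. n) = n1 + n2" using ne by simp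
    then show ?thesis unfolding swap M using sum H(1) by (simp add: subspace_scale)
  next
    case False
    \<comment> \<open>The space of \<open>\<kappa>\<close> contains \<open>H\<close>, of dimension k
      - 1, and does not have dimension k. Therefore \<open>\<kappa>\<close> is a ridge parallel to
      \<open>H\<close>.\<close>
    have "int (dim (lin_space \<kappa>)) = aff_dim \<kappa>" using dim_lin_space[OF cellD(4)[OF \<kappa>(1)]] .
    moreover have "aff_dim \<kappa> \<le> int k" "aff_dim \<kappa> \<noteq> int k"
      using aff_dim_cell_le[OF \<kappa>(1)] False \<kappa>(1) by (auto simp: max_cells_def)
    moreover have "dim H \<le> dim (lin_space \<kappa>)" using H\<kappa> by (rule dim_subset)
    ultimately have dims: "dim (lin_space \<kappa>) = dim H" "aff_dim \<kappa> = int k - 1" using H(2) by linarith+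
    have ridge: "\<kappa> \<in> ridges k C" using dims \<kappa>(1) by (simp add: ridges_def)
    have lin: "lin_space \<kappa> = H"
      using subspace_dim_equal[OF H(1) subspace_lin_space H\<kappa>] dims by simp
    have M: "M = {\<rho>. \<rho> \<in> max_cells k C \<and> \<kappa> face_of \<rho>}"
    proof -
      have "p \<in> \<rho> \<longleftrightarrow> \<kappa> face_of \<rho>" if "\<rho> \<in> max_cells k C" for \<rho>
        using complex_face_of[OF complex \<kappa>(1) max_cellD(1)[OF that] \<kappa>(2)] face_of_imp_subset p\<kappa> by blast
      then show ?thesis unfolding M_def by blast
    qed
    \<comment> \<open>Exactly one direction of \<open>N\<close> points into each cell at
      \<open>p\<close>, and it agrees with the lattice normal modulo \<open>H\<close>; the condition
      at the ridge can then be transferred to \<open>N\<close>.\<close>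
    have diff: "(\<Sum>n | n \<in> N \<and> n \<in> tangent_cone p \<rho>. n) - z \<kappa> \<rho> \<in> H" if "\<rho> \<in> M" for \<rho>
    proof -
      have \<rho>: "\<rho> \<in> max_cells k C" "p \<in> \<rho>" using that by (auto simp: M_def)
      have sub: "\<kappa> \<subseteq> \<rho>" using that M face_of_imp_subset by blast
      note tc = tangent_cone_ridge[OF ridge \<rho>(1) sub \<kappa>(2), unfolded lin]
      have z: "z \<kappa> \<rho> \<in> tangent_cone p \<rho>" "z \<kappa> \<rho> \<notin> H" "primitive_modulo H (z \<kappa> \<rho>)"
        using normal_in_tangent_cone[OF ridge \<rho>(1) sub \<kappa>(2)] normal_notin_lin_space[OF ridge \<rho>(1) sub]
          normal_primitive[OF ridge \<rho>(1) sub] lin by auto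
      obtain n a where n: "n \<in> N" "a > 0" "z \<kappa> \<rho> - a *\<^sub>R n \<in> H"
        using cover[OF \<rho> z(1,2)] by blast
      have "a = 1" using primitive_modulo_unique[OF H(1) N(2)[OF n(1)] z(3) n(3)] n(2) by linarith
      then have zn: "z \<kappa> \<rho> - n \<in> H" using n(3) by simp
      have nz: "n - z \<kappa> \<rho> \<in> H" using subspace_neg[OF H(1) zn] by simp
      have "{n' \<in> N. n' \<in> tangent_cone p \<rho>} = {n}"
      proof
        show "{n' \<in> N. n' \<in> tangent_cone p \<rho>} \<subseteq> {n}"
        proof
          fix n' assume "n' \<in> {n' \<in> N. n' \<in> tangent_cone p \<rho>}"
          then obtain b where b: "n' \<in> N" "b \<ge> 0" "n' - b *\<^sub>R z \<kappa> \<rho> \<in> H" using tc by blast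
          then have "b \<noteq> 0" using NH by force
          have "(n' - b *\<^sub>R z \<kappa> \<rho>) + b *\<^sub>R (z \<kappa> \<rho> - n) \<in> H"
            using b(3) zn H(1) by (intro subspace_add subspace_scale)
          then have "n' - b *\<^sub>R n \<in> H" by (simp add: algebra_simps)
          then show "n' \<in> {n}" using sep[OF n(1) b(1), of b] b(2) \<open>b \<noteq> 0\<close> by simp
        qed
        have "n \<in> tangent_cone p \<rho>" unfolding tc using nz by (intro exI[of _ 1]) simp
        then show "{n} \<subseteq> {n' \<in> N. n' \<in> tangent_cone p \<rho>}" using n(1) by blast
      qed
      then show ?thesis using nz by simp
    qed
    have "(\<Sum>\<rho>\<in>M. of_int (\<eta> \<rho>) *\<^sub>R ((\<Sum>n | n \<in> N \<and> n \<in> tangent_cone p \<rho>. n) - z \<kappa> \<rho>)) \<in> H"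
      using diff H(1) by (intro subspace_sum subspace_scale)
    moreover have "(\<Sum>\<rho>\<in>M. of_int (\<eta> \<rho>) *\<^sub>R z \<kappa> \<rho>) \<in> H"
      using balanced_ridge[OF ridge] unfolding M lin .
    ultimately have "(\<Sum>\<rho>\<in>M. of_int (\<eta> \<rho>) *\<^sub>R ((\<Sum>n | n \<in> N \<and> n \<in> tangent_cone p \<rho>. n) - z \<kappa> \<rho>))
      + (\<Sum>\<rho>\<in>M. of_int (\<eta> \<rho>) *\<^sub>R z \<kappa> \<rho>) \<in> H"
      using H(1) by (rule subspace_add[rotated])
    then show ?thesis unfolding swap by (simp add: scaleR_diff_right sum_subtractf)
  qed
qed

end


section \<open>Tropical varieties inside a complex\<close>

text \<open>A point of a segment other than one end spans, with that end, the line of the segment.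
  It traces the last covered point of a walk back to its start.\<close>

lemma affine_hull_extend:
  fixes x y p :: "'a::real_vector"
  assumes "p \<in> closed_segment x y" "p \<noteq> y"
  shows "x \<in> affine hull {y, p}"
proof -
  obtain u where u: "p = (1 - u) *\<^sub>R x + u *\<^sub>R y"
    using assms(1) by (auto simp: in_segment)
  have "u \<noteq> 1" using u assms(2) by auto
  then have u1: "1 - u \<noteq> 0" by simp
  have "p - u *\<^sub>R y = (1 - u) *\<^sub>R x" using u by simp
  then have "x = (1 / (1 - u)) *\<^sub>R (p - u *\<^sub>R y)" using u1 by simp
  then have x: "x = (- u / (1 - u)) *\<^sub>R y + (1 / (1 - u)) *\<^sub>R p"
    by (simp add: scaleR_diff_right)
  have "- u / (1 - u) + 1 / (1 - u) = 1"
    using u1 by (simp add: divide_simps)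
  then show ?thesis unfolding affine_hull_2 using x by blast
qed

text \<open>Only \<open>D\<close> carries a weighting; the weight to be constructed on
  \<open>C\<close> comes entirely from it. Containment is one of point sets.\<close>

locale complex_inside = C: lattice_complex k C z + D: balanced_complex k D y \<eta>
  for k :: nat and C :: "(real ^ 'n) set set" and z and D y \<eta> +
  assumes inside: "\<Union>D \<subseteq> \<Union>C"
begin

lemma tangent_cone_inside:
  assumes "\<kappa> \<in> D" "p \<in> \<kappa>" "v \<in> tangent_cone p \<kappa>"
  obtains \<sigma> where "\<sigma> \<in> C" "p \<in> \<sigma>" "v \<in> tangent_cone p \<sigma>"
proof -
  have "\<kappa> \<subseteq> \<Union>C" using assms(1) inside by blast
  then have "\<exists>\<sigma>\<in>C. p \<in> \<sigma> \<and> v \<in> tangent_cone p \<sigma>"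
    using tangent_cone_Union[OF C.finite_cells(1) C.cellD(3) D.cellD(2)[OF assms(1)] assms(2) _ assms(3)]
    by blast
  then show ?thesis using that by blast
qed

text \<open>The proof walks from a point of the covered part of \<open>\<sigma>\<close> to a generic uncovered one. At the
  last covered point, the complex \<open>D\<close> has a ridge, and balancing there provides a maximal cell of the
  same weight on the other side of it.\<close>

lemma max_cell_covered:
  assumes \<sigma>: "\<sigma> \<in> max_cells k C" and \<rho>0: "\<rho>0 \<in> max_cells k D" "aff_dim (\<sigma> \<inter> \<rho>0) = int k"
  shows "\<sigma> \<subseteq> \<Union>{\<rho> \<in> max_cells k D. aff_dim (\<sigma> \<inter> \<rho>) = int k \<and> \<eta> \<rho> = \<eta> \<rho>0}"
proof (rule ccontr)
  \<comment> \<open>The value of the weight is built into \<open>F\<close>, so that being covered by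
    \<open>F\<close> carries the information about weights.\<close>
  define F where "F = {\<rho> \<in> max_cells k D. aff_dim (\<sigma> \<inter> \<rho>) = int k \<and> \<eta> \<rho> = \<eta> \<rho>0}"
  assume "\<not> \<sigma> \<subseteq> \<Union>{\<rho> \<in> max_cells k D. aff_dim (\<sigma> \<inter> \<rho>) = int k \<and> \<eta> \<rho> = \<eta> \<rho>0}"
  then have not_covered: "\<not> \<sigma> \<subseteq> \<Union>F" by (simp add: F_def)
  have finF: "finite F" using D.finite_cells(2) by (simp add: F_def)
  have FD: "\<rho> \<in> max_cells k D" "\<rho> \<in> D" "aff_dim (\<sigma> \<inter> \<rho>) = int k" "\<eta> \<rho> = \<eta> \<rho>0" if "\<rho> \<in> F" for \<rho>
    using that D.max_cellD(1) by (auto simp: F_def)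
  have \<rho>0F: "\<rho>0 \<in> F" using \<rho>0 by (simp add: F_def)
  have \<sigma>C: "\<sigma> \<in> C" and \<sigma>dim: "aff_dim \<sigma> = int k" using C.max_cellD[OF \<sigma>] by auto
  note conv\<sigma> = C.cellD(2)[OF \<sigma>C]
  have closedF: "closed (\<Union>F)" using finF FD(2) D.cellD(3) by (intro closed_Union) auto

  \<comment> \<open>The uncovered set is relatively open in \<open>\<sigma>\<close>, so it contains
    a relative interior point.\<close>
  obtain q where q: "q \<in> rel_interior \<sigma>" "q \<notin> \<Union>F"
  proof -
    have "\<not> rel_interior \<sigma> \<subseteq> \<Union>F"
    proof
      assume "rel_interior \<sigma> \<subseteq> \<Union>F"
      then have "closure (rel_interior \<sigma>) \<subseteq> \<Union>F" using closedF by (rule closure_minimal)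
      then show False
        using not_covered closure_subset[of \<sigma>] convex_closure_rel_interior[OF conv\<sigma>] by simp
    qed
    then show ?thesis using that by blast
  qed

  \<comment> \<open>Cells of \<open>D\<close> of dimension at most k - 2 span, together with
    \<open>q\<close>, dimension at most k - 1. A full-dimensional generic piece \<open>T\<close>
    avoids these spans, so a segment from \<open>T\<close> to \<open>q\<close> meets such cells at
    most in \<open>q\<close>.\<close>
  define low where "low = {\<kappa> \<in> D. aff_dim \<kappa> < int k - 1}"
  have finlow: "finite ((\<lambda>\<kappa>. affine hull (insert q \<kappa>)) ` low)" using D.finite_cells(1) by (simp add: low_def)
  have low_dim: "aff_dim (affine hull (insert q \<kappa>)) < int k" if "\<kappa> \<in> low" for \<kappa>
    using that by (simp add: low_def aff_dim_insert)
  have "convex (\<sigma> \<inter> \<rho>0)" using conv\<sigma> D.cellD(2) FD(2)[OF \<rho>0F] by (simp add: convex_Int)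
  then obtain T where T: "T \<subseteq> \<sigma> \<inter> \<rho>0" "convex T" "aff_dim T = aff_dim (\<sigma> \<inter> \<rho>0)"
    "\<forall>B\<in>(\<lambda>\<kappa>. affine hull (insert q \<kappa>)) ` low. T \<subseteq> B \<or> T \<inter> B = {}"
    using convex_generic_piece[OF finlow, of "\<sigma> \<inter> \<rho>0"] closed_affine_hull affine_imp_convex[OF affine_affine_hull]
    by (metis (no_types, lifting) imageE)
  have Tdim: "aff_dim T = int k" using T(3) \<rho>0(2) by simp
  then have "T \<noteq> {}" by auto
  then obtain x where x: "x \<in> rel_interior T" using rel_interior_eq_empty[OF T(2)] by blast
  have xT: "x \<in> T" using x rel_interior_subset by blast
  have x\<sigma>: "x \<in> rel_interior \<sigma>"
    using x rel_interior_mono_aff_dim[of T \<sigma>] T(1) Tdim \<sigma>dim by auto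
  have x_low: "x \<notin> affine hull (insert q \<kappa>)" if "\<kappa> \<in> low" for \<kappa>
  proof
    assume "x \<in> affine hull (insert q \<kappa>)"
    then have "T \<subseteq> affine hull (insert q \<kappa>)" using T(4) that xT by blast
    then have "aff_dim T \<le> aff_dim (affine hull (insert q \<kappa>))" by (rule aff_dim_subset)
    then show False using low_dim[OF that] Tdim by simp
  qed

  \<comment> \<open>A covered point \<open>p\<close> of the segment nearest to \<open>q\<close> is
    the exit point: from it, the direction \<open>v\<close> towards \<open>q\<close> leaves every
    cell of \<open>F\<close>.\<close>
  have "closed (\<Union>F \<inter> closed_segment x q)" using closedF by (intro closed_Int) auto
  moreover have "\<Union>F \<inter> closed_segment x q \<noteq> {}" using xT T(1) \<rho>0F by auto
  ultimately obtain p where p: "p \<in> \<Union>F \<inter> closed_segment x q"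
    "\<And>p'. p' \<in> \<Union>F \<inter> closed_segment x q \<Longrightarrow> dist q p \<le> dist q p'"
    using distance_attains_inf[of "\<Union>F \<inter> closed_segment x q" q] by blast
  have pq: "p \<noteq> q" using p(1) q(2) by blast
  have p\<sigma>: "p \<in> rel_interior \<sigma>"
    using p(1) closed_segment_subset[OF x\<sigma> q(1) convex_rel_interior[OF conv\<sigma>]] by blast
  have p\<sigma>': "p \<in> \<sigma>" using p\<sigma> rel_interior_subset by blast
  define v where "v = q - p"
  have tc\<sigma>: "tangent_cone p \<sigma> = lin_space \<sigma>" by (rule tangent_cone_rel_interior[OF p\<sigma>])
  have v\<sigma>: "v \<in> lin_space \<sigma>"
    using p\<sigma>' q(1) rel_interior_subset unfolding v_def lin_space_def by (intro span_base) blast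

  have v_leaves: "v \<notin> tangent_cone p \<rho>" if \<rho>: "\<rho> \<in> F" "p \<in> \<rho>" for \<rho>
  proof
    assume "v \<in> tangent_cone p \<rho>"
    then obtain e where e: "e > 0" "\<And>t. 0 \<le> t \<Longrightarrow> t \<le> e \<Longrightarrow> p + t *\<^sub>R v \<in> \<rho>"
      using tangent_cone_small[OF D.cellD(2)[OF FD(2)[OF \<rho>(1)]] \<rho>(2)] by blast
    define t where "t = min e 1"
    have t: "0 < t" "t \<le> 1" "p + t *\<^sub>R v \<in> \<rho>" using e by (auto simp: t_def)
    have "p + t *\<^sub>R v = (1 - t) *\<^sub>R p + t *\<^sub>R q" by (simp add: v_def algebra_simps)
    then have "p + t *\<^sub>R v \<in> closed_segment p q" using t unfolding in_segment by (intro exI[of _ t]) auto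
    then have "p + t *\<^sub>R v \<in> closed_segment x q"
      using p(1) subset_closed_segment[of p q x q] by auto
    then have "dist q p \<le> dist q (p + t *\<^sub>R v)" using p(2) t(3) \<rho>(1) by blast
    moreover have "q - (p + t *\<^sub>R v) = (1 - t) *\<^sub>R v" by (simp add: v_def algebra_simps)
    then have "dist q (p + t *\<^sub>R v) = (1 - t) * norm v" using t by (simp add: dist_norm)
    moreover have "dist q p = norm v" by (simp add: dist_norm v_def)
    moreover have "t * norm v > 0" using pq t(1) by (simp add: v_def)
    ultimately show False by (simp add: algebra_simps)
  qed

  \<comment> \<open>The point \<open>p\<close> is in the relative interior of
    \<open>\<sigma>\<close>, so \<open>\<sigma>\<close> is the only cell of \<open>C\<close> through
    it, and near \<open>p\<close> all of \<open>D\<close> lies in \<open>\<sigma>\<close>.\<close>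
  have tcD: "tangent_cone p \<kappa> \<subseteq> lin_space \<sigma>" if \<kappa>: "\<kappa> \<in> D" "p \<in> \<kappa>" for \<kappa>
  proof
    fix w assume "w \<in> tangent_cone p \<kappa>"
    then obtain \<sigma>' where \<sigma>': "\<sigma>' \<in> C" "p \<in> \<sigma>'" "w \<in> tangent_cone p \<sigma>'"
      using tangent_cone_inside[OF \<kappa>] by blast
    have "\<sigma>' = \<sigma>"
      by (rule C.max_cell_eq[OF \<sigma> complex_face_of[OF C.complex \<sigma>C \<sigma>'(1) p\<sigma> \<sigma>'(2)] \<sigma>'(1)])
    then show "w \<in> lin_space \<sigma>" using \<sigma>'(3) tc\<sigma> by simp
  qed

  obtain \<rho>1 where \<rho>1: "\<rho>1 \<in> F" "p \<in> \<rho>1" using p(1) by blast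
  obtain \<kappa> where \<kappa>: "\<kappa> \<in> D" "p \<in> rel_interior \<kappa>"
    using complex_rel_interior_cell[OF D.complex FD(2)[OF \<rho>1(1)] \<rho>1(2)] .
  have p\<kappa>: "p \<in> \<kappa>" using \<kappa>(2) rel_interior_subset by blast
  have face: "\<kappa> face_of \<rho>" if "\<rho> \<in> D" "p \<in> \<rho>" for \<rho>
    by (rule complex_face_of[OF D.complex \<kappa>(1) that(1) \<kappa>(2) that(2)])
  define H where "H = lin_space \<kappa>"
  have H: "subspace H" by (simp add: H_def)
  have tc\<kappa>: "tangent_cone p \<kappa> = H" unfolding H_def by (rule tangent_cone_rel_interior[OF \<kappa>(2)])
  have Htc: "H \<subseteq> tangent_cone p \<rho>" if "\<rho> \<in> D" "p \<in> \<rho>" for \<rho>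
    using tangent_cone_mono[OF face_of_imp_subset[OF face[OF that]], of p] tc\<kappa> by simp
  have vH: "v \<notin> H" using v_leaves[OF \<rho>1] Htc[OF FD(2)[OF \<rho>1(1)] \<rho>1(2)] by blast

  \<comment> \<open>A low cell through \<open>p\<close> would put \<open>x\<close> into one of the
    avoided affine hulls.\<close>
  have "\<kappa> \<notin> low"
  proof
    assume low: "\<kappa> \<in> low"
    have "x \<in> affine hull {q, p}" using p(1) pq by (intro affine_hull_extend) auto
    also have "\<dots> \<subseteq> affine hull (insert q \<kappa>)" using p\<kappa> by (intro hull_mono) auto
    finally show False using x_low[OF low] by simp
  qed
  moreover have lin_max: "lin_space \<rho> = lin_space \<sigma>" if "\<rho> \<in> F" for \<rho>
  proof -
    have ne: "\<sigma> \<inter> \<rho> \<noteq> {}" using FD(3)[OF that] by auto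
    have "dim (lin_space (\<sigma> \<inter> \<rho>)) = k" using dim_lin_space[OF ne] FD(3)[OF that] by simp
    then have "lin_space (\<sigma> \<inter> \<rho>) = lin_space \<sigma>" "lin_space (\<sigma> \<inter> \<rho>) = lin_space \<rho>"
      using subspace_dim_equal[OF subspace_lin_space subspace_lin_space lin_space_mono[OF Int_lower1[of \<sigma> \<rho>]]]
        subspace_dim_equal[OF subspace_lin_space subspace_lin_space lin_space_mono[OF Int_lower2[of \<sigma> \<rho>]]]
        C.dim_lin_space_max_cell[OF \<sigma>] D.dim_lin_space_max_cell[OF FD(1)[OF that]]
      by simp_all
    then show ?thesis by simp
  qed
  \<comment> \<open>A maximal \<open>\<kappa>\<close> would be \<open>\<rho>1\<close> with
    \<open>p\<close> in its relative interior, and \<open>v\<close> would not leave it.\<close>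
  moreover have "aff_dim \<kappa> \<noteq> int k"
  proof
    assume "aff_dim \<kappa> = int k"
    then have "\<kappa> \<in> max_cells k D" using \<kappa>(1) by (simp add: max_cells_def)
    then have "\<rho>1 = \<kappa>"
      using D.max_cell_eq face[OF FD(2)[OF \<rho>1(1)] \<rho>1(2)] FD(2)[OF \<rho>1(1)] by blast
    then show False using vH v\<sigma> lin_max[OF \<rho>1(1)] by (simp add: H_def)
  qed
  ultimately have ridge: "\<kappa> \<in> ridges k D"
    using D.aff_dim_cell_le[OF \<kappa>(1)] \<kappa>(1) by (simp add: ridges_def low_def)
  have Hdim: "Suc (dim H) = k" unfolding H_def by (rule D.dim_lin_space_ridge[OF ridge])
  note normal_args = ridge FD(1)[OF \<rho>1(1)] face_of_imp_subset[OF face[OF FD(2)[OF \<rho>1(1)] \<rho>1(2)]]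
  define n where "n = y \<kappa> \<rho>1"
  have n: "n \<in> tangent_cone p \<rho>1" "n \<notin> H" "primitive_modulo H n"
    using D.normal_in_tangent_cone[OF normal_args \<kappa>(2)] D.normal_notin_lin_space[OF normal_args]
      D.normal_primitive[OF normal_args] by (simp_all add: n_def H_def)
  have L: "lin_space \<sigma> = span (insert n H)"
    using D.lin_space_eq[OF normal_args] lin_max[OF \<rho>1(1)] by (simp add: n_def H_def)
  have scale: "a = 0" if "a *\<^sub>R n \<in> H" for a
  proof (rule ccontr)
    assume "a \<noteq> 0"
    then have "(1 / a) *\<^sub>R (a *\<^sub>R n) = n" by simp
    then show False using subspace_scale[OF H that, of "1 / a"] n(2) by simp
  qed
  have n0: "n \<noteq> - n"
  proof
    assume "n = - n"
    then have "2 *\<^sub>R n = 0" by (simp add: scaleR_2 add_eq_0_iff2)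
    then show False using n(2) subspace_0[OF H] by simp
  qed

  \<comment> \<open>Modulo \<open>H\<close> and positive factors only \<open>n\<close> and
    \<open>- n\<close> occur as directions of \<open>D\<close> at \<open>p\<close>; \<open>w\<close>
    is the weight of \<open>D\<close> on either side of the ridge.\<close>
  define w where "w n = (\<Sum>\<rho> | \<rho> \<in> max_cells k D \<and> p \<in> \<rho> \<and> n \<in> tangent_cone p \<rho>. \<eta> \<rho>)" for n
  have w_eq: "w m = \<eta> \<rho>" if m: "\<rho> \<in> max_cells k D" "p \<in> \<rho>" "m \<in> tangent_cone p \<rho>" "m \<notin> H" for m \<rho>
  proof -
    have "\<rho>' = \<rho>" if \<rho>': "\<rho>' \<in> max_cells k D" "p \<in> \<rho>'" "m \<in> tangent_cone p \<rho>'" for \<rho>'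
      by (rule D.max_cell_tangent_unique[OF H Hdim \<rho>'(1) m(1) \<rho>'(2) m(2)
            Htc[OF D.max_cellD(1)[OF \<rho>'(1)] \<rho>'(2)] Htc[OF D.max_cellD(1)[OF m(1)] m(2)]
            \<rho>'(3) m(3) m(4)])
    then have "{\<rho>. \<rho> \<in> max_cells k D \<and> p \<in> \<rho> \<and> m \<in> tangent_cone p \<rho>} = {\<rho>}"
      using m by blast
    then show ?thesis by (simp add: w_def)
  qed
  have "(\<Sum>m\<in>{n, - n}. \<Sum>\<rho> | \<rho> \<in> max_cells k D \<and> p \<in> \<rho> \<and> m \<in> tangent_cone p \<rho>. of_int (\<eta> \<rho>) *\<^sub>R m) \<in> H"
  proof (rule D.local_balance[OF H Hdim])
    show "p \<in> \<Union>D" using \<kappa>(1) p\<kappa> by blast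
    show "H \<subseteq> tangent_cone p \<kappa>'" if "\<kappa>' \<in> D" "p \<in> \<kappa>'" for \<kappa>' by (rule Htc[OF that])
    show "primitive_modulo H m" if "m \<in> {n, - n}" for m
      using that n(3) primitive_modulo_uminus[OF H n(3)] by auto
    show "m' = m" if "m \<in> {n, - n}" "m' \<in> {n, - n}" "a > 0" "m' - a *\<^sub>R m \<in> H" for m m' a
    proof (rule ccontr)
      assume "m' \<noteq> m"
      then have "m' = - m" using that(1,2) by auto
      then have "- (m' - a *\<^sub>R m) = (1 + a) *\<^sub>R m" by (simp add: algebra_simps)
      then have mH: "(1 + a) *\<^sub>R m \<in> H" using subspace_neg[OF H that(4)] by simp
      have "(1 + a) *\<^sub>R n \<in> H" using that(1) mH subspace_neg[OF H mH] by auto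
      then show False using scale that(3) by fastforce
    qed
    show "\<exists>m\<in>{n, - n}. \<exists>a>0. u - a *\<^sub>R m \<in> H"
      if "\<rho> \<in> max_cells k D" "p \<in> \<rho>" "u \<in> tangent_cone p \<rho>" "u \<notin> H" for \<rho> u
    proof -
      have "u \<in> span (insert n H)" using tcD[OF D.max_cellD(1)[OF that(1)] that(2)] that(3) L by blast
      then obtain b where b: "u - b *\<^sub>R n \<in> H" using span_insert_subspace[OF H] by blast
      have "b \<noteq> 0" using b that(4) by auto
      then consider "b > 0" | "- b > 0" by linarith
      then show ?thesis
      proof cases
        case 2
        moreover have "u - (- b) *\<^sub>R (- n) \<in> H" using b by simp
        ultimately show ?thesis by blast
      qed (use b in blast)
    qed
  qed simp
  then have "of_int (w n) *\<^sub>R n - of_int (w (- n)) *\<^sub>R n \<in> H"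
    using n0 by (simp add: w_def scaleR_sum_left sum_negf)
  then have "(of_int (w n) - of_int (w (- n))) *\<^sub>R n \<in> H" by (simp add: scaleR_diff_left)
  then have w: "w (- n) = w n" using scale by fastforce
  also have "w n = \<eta> \<rho>1" by (rule w_eq[OF FD(1)[OF \<rho>1(1)] \<rho>1(2) n(1,2)])
  finally have w\<rho>1: "w (- n) = \<eta> \<rho>1" .
  \<comment> \<open>An empty sum would be 0, so the nonzero weight on the far side produces a cell
    \<open>\<rho>2\<close> there, and it has the weight of \<open>\<rho>1\<close>.\<close>
  then have "w (- n) \<noteq> 0" using D.weight_pos[OF FD(1)[OF \<rho>1(1)]] by simp
  then obtain \<rho>2 where \<rho>2: "\<rho>2 \<in> max_cells k D" "p \<in> \<rho>2" "- n \<in> tangent_cone p \<rho>2"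
    unfolding w_def by (metis (mono_tags, lifting) mem_Collect_eq sum.neutral)
  have "- n \<notin> H" using n(2) subspace_neg[OF H, of "- n"] by auto
  then have weight2: "\<eta> \<rho>2 = \<eta> \<rho>0" using w_eq[OF \<rho>2] w\<rho>1 FD(4)[OF \<rho>1(1)] by simp
  obtain a where a: "v - a *\<^sub>R n \<in> H" using v\<sigma> L span_insert_subspace[OF H] by blast
  \<comment> \<open>A nonnegative coefficient would make \<open>v\<close> tangent to
    \<open>\<rho>1\<close>. Hence \<open>v\<close> points into \<open>\<rho>2\<close>, which turns
    out to be a cell of \<open>F\<close> that \<open>v\<close> does not leave.\<close>
  have "a < 0"
  proof (rule ccontr)
    assume "\<not> a < 0"
    then have "v \<in> tangent_cone p \<rho>1"
      unfolding D.tangent_cone_ridge[OF normal_args \<kappa>(2)] using a unfolding n_def H_def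
      by (intro exI[of _ a]) simp
    then show False using v_leaves[OF \<rho>1] by simp
  qed
  note \<rho>2D = D.max_cellD(1)[OF \<rho>2(1)]
  have "(v - a *\<^sub>R n) + (- a) *\<^sub>R (- n) \<in> tangent_cone p \<rho>2"
  proof (rule tangent_cone_add[OF D.cellD(2)[OF \<rho>2D] \<rho>2(2)])
    show "v - a *\<^sub>R n \<in> tangent_cone p \<rho>2" using a Htc[OF \<rho>2D \<rho>2(2)] by blast
    show "(- a) *\<^sub>R (- n) \<in> tangent_cone p \<rho>2"
      by (rule tangent_cone_scale[OF \<rho>2(3)]) (use \<open>a < 0\<close> in simp)
  qed
  then have v2: "v \<in> tangent_cone p \<rho>2" by simp
  have "aff_dim (\<sigma> \<inter> \<rho>2) = int k"
    using tc\<sigma> v\<sigma> Htc[OF \<rho>2D \<rho>2(2)] tcD[OF \<rho>2D \<rho>2(2)]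
    by (intro C.aff_dim_Int_max_cell[OF H Hdim \<sigma> D.cellD(2)[OF \<rho>2D] p\<sigma>' \<rho>2(2) _ _ _ v2 vH]) auto
  then have "\<rho>2 \<in> F" using \<rho>2(1) weight2 by (simp add: F_def)
  then show False using v_leaves \<rho>2(2) v2 by blast
qed

text \<open>The cell \<open>\<sigma>\<close> is covered once by cells with the weight of
  \<open>\<rho>1\<close> and once by cells with the weight of \<open>\<rho>2\<close>. A generic
  piece of \<open>\<sigma>\<close> lies in a cell of each cover, and maximal cells sharing a
  full-dimensional piece are equal.\<close>

lemma covering_weight_unique:
  assumes \<sigma>: "\<sigma> \<in> max_cells k C"
    and \<rho>1: "\<rho>1 \<in> max_cells k D" "aff_dim (\<sigma> \<inter> \<rho>1) = int k"
    and \<rho>2: "\<rho>2 \<in> max_cells k D" "aff_dim (\<sigma> \<inter> \<rho>2) = int k"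
  shows "\<eta> \<rho>1 = \<eta> \<rho>2"
proof -
  obtain T where T: "T \<subseteq> \<sigma>" "convex T" "aff_dim T = aff_dim \<sigma>" "\<forall>B\<in>D. T \<subseteq> B \<or> T \<inter> B = {}"
    using convex_generic_piece[OF D.finite_cells(1), of \<sigma>] D.cellD(2,3) C.cellD(2) C.max_cellD(1)[OF \<sigma>] by blast
  have Tdim: "aff_dim T = int k" using T(3) C.max_cellD(2)[OF \<sigma>] by simp
  then have "T \<noteq> {}" by auto
  then obtain p where p: "p \<in> T" by blast
  have sub: "\<exists>\<rho>'\<in>max_cells k D. T \<subseteq> \<rho>' \<and> \<eta> \<rho>' = \<eta> \<rho>"
    if \<rho>: "\<rho> \<in> max_cells k D" "aff_dim (\<sigma> \<inter> \<rho>) = int k" for \<rho>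
  proof -
    have "p \<in> \<sigma>" using p T(1) by blast
    then obtain \<rho>' where "\<rho>' \<in> max_cells k D" "p \<in> \<rho>'" "\<eta> \<rho>' = \<eta> \<rho>"
      using max_cell_covered[OF \<sigma> \<rho>] by blast
    then show ?thesis using T(4) p D.max_cellD(1) by (metis IntI empty_iff)
  qed
  obtain \<rho>1' where \<rho>1': "\<rho>1' \<in> max_cells k D" "T \<subseteq> \<rho>1'" "\<eta> \<rho>1' = \<eta> \<rho>1" using sub[OF \<rho>1] by blast
  obtain \<rho>2' where \<rho>2': "\<rho>2' \<in> max_cells k D" "T \<subseteq> \<rho>2'" "\<eta> \<rho>2' = \<eta> \<rho>2" using sub[OF \<rho>2] by blast
  have "T \<subseteq> \<rho>1' \<inter> \<rho>2'" using \<rho>1'(2) \<rho>2'(2) by blast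
  then have "int k \<le> aff_dim (\<rho>1' \<inter> \<rho>2')" using aff_dim_subset Tdim by metis
  then have "\<rho>1' = \<rho>2'" by (rule D.max_cells_eqI[OF \<rho>1'(1) \<rho>2'(1)])
  then show ?thesis using \<rho>1'(3) \<rho>2'(3) by simp
qed

text \<open>The choice made by \<open>SOME\<close> is immaterial because the covering weight is
  unique. The value 0 stands for cells that no maximal cell of \<open>D\<close> overlaps in full
  dimension.\<close>

definition induced_weight :: "(real ^ 'n) set \<Rightarrow> int" where
  "induced_weight \<sigma> = (if \<exists>\<rho>\<in>max_cells k D. aff_dim (\<sigma> \<inter> \<rho>) = int k
     then \<eta> (SOME \<rho>. \<rho> \<in> max_cells k D \<and> aff_dim (\<sigma> \<inter> \<rho>) = int k) else 0)"

lemma induced_weight_eq: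
  assumes \<sigma>: "\<sigma> \<in> max_cells k C" and \<rho>: "\<rho> \<in> max_cells k D" "aff_dim (\<sigma> \<inter> \<rho>) = int k"
  shows "induced_weight \<sigma> = \<eta> \<rho>"
proof -
  define \<rho>' where "\<rho>' = (SOME \<rho>. \<rho> \<in> max_cells k D \<and> aff_dim (\<sigma> \<inter> \<rho>) = int k)"
  have "\<rho>' \<in> max_cells k D \<and> aff_dim (\<sigma> \<inter> \<rho>') = int k"
    unfolding \<rho>'_def by (rule someI[of _ \<rho>]) (use \<rho> in simp)
  then have "\<eta> \<rho>' = \<eta> \<rho>" using covering_weight_unique[OF \<sigma> _ _ \<rho>] by blast
  moreover have "induced_weight \<sigma> = \<eta> \<rho>'" using \<rho> unfolding induced_weight_def \<rho>'_def by auto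
  ultimately show ?thesis by simp
qed

lemma induced_weight_nonneg:
  assumes \<sigma>: "\<sigma> \<in> max_cells k C" shows "induced_weight \<sigma> \<ge> 0"
proof (cases "\<exists>\<rho>\<in>max_cells k D. aff_dim (\<sigma> \<inter> \<rho>) = int k")
  case True
  then show ?thesis using induced_weight_eq[OF \<sigma>] D.weight_pos by fastforce
qed (simp add: induced_weight_def)

lemma induced_weight_covered:
  assumes \<sigma>: "\<sigma> \<in> max_cells k C" and "induced_weight \<sigma> \<noteq> 0"
  shows "\<sigma> \<subseteq> \<Union>{\<rho> \<in> max_cells k D. aff_dim (\<sigma> \<inter> \<rho>) = int k}"
proof -
  obtain \<rho> where \<rho>: "\<rho> \<in> max_cells k D" "aff_dim (\<sigma> \<inter> \<rho>) = int k"
    using assms(2) unfolding induced_weight_def by (auto split: if_splits)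
  show ?thesis using max_cell_covered[OF \<sigma> \<rho>] by blast
qed

text \<open>Near a generic point of \<open>\<tau>\<close> the directions of \<open>D\<close> lie in
  the cells of \<open>C\<close> around \<open>\<tau>\<close>, so the normals
  \<open>z \<tau> \<sigma>\<close> represent all of them modulo \<open>H\<close>. The weight of
  \<open>D\<close> in the direction of \<open>z \<tau> \<sigma>\<close> is the induced weight of
  \<open>\<sigma>\<close>.\<close>

lemma induced_weight_balanced:
  assumes \<tau>: "\<tau> \<in> ridges k C"
  shows "(\<Sum>\<sigma> | \<sigma> \<in> max_cells k C \<and> \<tau> face_of \<sigma>. of_int (induced_weight \<sigma>) *\<^sub>R z \<tau> \<sigma>) \<in> lin_space \<tau>"
proof -
  define S where "S = {\<sigma>. \<sigma> \<in> max_cells k C \<and> \<tau> face_of \<sigma>}"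
  define H where "H = lin_space \<tau>"
  have H: "subspace H" "Suc (dim H) = k" using C.dim_lin_space_ridge[OF \<tau>] by (auto simp: H_def)
  have finS: "finite S" using C.finite_cells(2) by (simp add: S_def)
  note \<tau>C = C.ridgeD(1)[OF \<tau>]
  \<comment> \<open>Every cell of \<open>D\<close> contains \<open>T\<close> or misses it; hence all
    directions of \<open>H\<close> are tangent to each cell of \<open>D\<close> through
    \<open>p\<close>.\<close>
  obtain T where T: "T \<subseteq> \<tau>" "convex T" "aff_dim T = aff_dim \<tau>" "\<forall>B\<in>D. T \<subseteq> B \<or> T \<inter> B = {}"
    using convex_generic_piece[OF D.finite_cells(1), of \<tau>] D.cellD(2,3) C.cellD(2)[OF \<tau>C] by blast
  have Tne: "T \<noteq> {}" using T(3) H(2) C.ridgeD(2)[OF \<tau>] by auto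
  then obtain p where pT: "p \<in> rel_interior T" using rel_interior_eq_empty[OF T(2)] by blast
  have p: "p \<in> rel_interior \<tau>" using rel_interior_mono_aff_dim[OF T(1,3)] pT by blast
  have pT': "p \<in> T" using pT rel_interior_subset by blast
  then have p\<tau>: "p \<in> \<tau>" using T(1) by blast
  have "dim (lin_space T) = dim (lin_space \<tau>)"
    using dim_lin_space[OF Tne] dim_lin_space[OF C.cellD(4)[OF \<tau>C]] T(3) by simp
  then have "lin_space T = H"
    unfolding H_def using lin_space_mono[OF T(1)] by (intro subspace_dim_equal) auto
  then have HT: "tangent_cone p T = H" using tangent_cone_rel_interior[OF pT] by simp
  have HD: "H \<subseteq> tangent_cone p \<kappa>" if "\<kappa> \<in> D" "p \<in> \<kappa>" for \<kappa>
  proof -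
    have "T \<subseteq> \<kappa>" using T(4) that pT' by blast
    then show ?thesis using tangent_cone_mono HT by blast
  qed
  have tc\<tau>: "tangent_cone p \<tau> = H" unfolding H_def by (rule tangent_cone_rel_interior[OF p])
  have S: "\<sigma> \<in> max_cells k C" "\<tau> \<subseteq> \<sigma>" "p \<in> \<sigma>" "H \<subseteq> tangent_cone p \<sigma>"
    "z \<tau> \<sigma> \<in> tangent_cone p \<sigma>" "z \<tau> \<sigma> \<notin> H" "primitive_modulo H (z \<tau> \<sigma>)" if "\<sigma> \<in> S" for \<sigma>
  proof -
    show \<sigma>: "\<sigma> \<in> max_cells k C" "\<tau> \<subseteq> \<sigma>" using that face_of_imp_subset by (auto simp: S_def)
    show "p \<in> \<sigma>" using \<sigma>(2) p\<tau> by blast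
    show "H \<subseteq> tangent_cone p \<sigma>" using tangent_cone_mono[OF \<sigma>(2), of p] tc\<tau> by simp
    show "z \<tau> \<sigma> \<in> tangent_cone p \<sigma>" by (rule C.normal_in_tangent_cone[OF \<tau> \<sigma> p])
    show "z \<tau> \<sigma> \<notin> H" unfolding H_def by (rule C.normal_notin_lin_space[OF \<tau> \<sigma>])
    show "primitive_modulo H (z \<tau> \<sigma>)" unfolding H_def by (rule C.normal_primitive[OF \<tau> \<sigma>])
  qed
  have unique: "\<sigma> = \<sigma>'" if "\<sigma> \<in> S" "\<sigma>' \<in> S" "v \<in> tangent_cone p \<sigma>" "v \<in> tangent_cone p \<sigma>'" "v \<notin> H" for \<sigma> \<sigma>' v
    using C.max_cell_tangent_unique[OF H S(1)[OF that(1)] S(1)[OF that(2)] S(3)[OF that(1)] S(3)[OF that(2)]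
        S(4)[OF that(1)] S(4)[OF that(2)] that(3-5)] .
  have "(\<Sum>\<sigma>\<in>S. of_int (induced_weight \<sigma>) *\<^sub>R z \<tau> \<sigma>) \<in> H"
  proof (cases "p \<in> \<Union>D")
    case False
    have "induced_weight \<sigma> = 0" if "\<sigma> \<in> S" for \<sigma>
      using induced_weight_covered[OF S(1)[OF that]] S(3)[OF that] False D.max_cellD(1) by blast
    then show ?thesis using subspace_0[OF H(1)] by simp
  next
    case True
    \<comment> \<open>Distinct cells have distinct normals, so the sum over directions can be
      reindexed by the cells around \<open>\<tau>\<close>.\<close>
    have inj: "inj_on (z \<tau>) S"
    proof (rule inj_onI)
      fix \<sigma> \<sigma>' assume *: "\<sigma> \<in> S" "\<sigma>' \<in> S" "z \<tau> \<sigma> = z \<tau> \<sigma>'"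
      show "\<sigma> = \<sigma>'"
        using unique[OF *(1,2) S(5)[OF *(1)] _ S(6)[OF *(1)]] S(5)[OF *(2)] *(3) by simp
    qed
    \<comment> \<open>In the direction of \<open>z \<tau> \<sigma>\<close> there is either no
      maximal cell of \<open>D\<close> at \<open>p\<close>, or exactly one, and this one overlaps
      \<open>\<sigma>\<close> in full dimension.\<close>
    have weight: "(\<Sum>\<rho> | \<rho> \<in> max_cells k D \<and> p \<in> \<rho> \<and> z \<tau> \<sigma> \<in> tangent_cone p \<rho>. of_int (\<eta> \<rho>) *\<^sub>R z \<tau> \<sigma>)
      = of_int (induced_weight \<sigma>) *\<^sub>R z \<tau> \<sigma>" if \<sigma>: "\<sigma> \<in> S" for \<sigma>
    proof -
      let ?M = "{\<rho>. \<rho> \<in> max_cells k D \<and> p \<in> \<rho> \<and> z \<tau> \<sigma> \<in> tangent_cone p \<rho>}"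
      have M: "aff_dim (\<sigma> \<inter> \<rho>) = int k" if "\<rho> \<in> ?M" for \<rho>
        using that D.max_cellD(1)[of \<rho>]
        by (intro C.aff_dim_Int_max_cell[OF H S(1)[OF \<sigma>] _ S(3)[OF \<sigma>] _ S(4)[OF \<sigma>] _ S(5)[OF \<sigma>] _ S(6)[OF \<sigma>]])
          (auto intro: D.cellD(2) dest: HD[THEN subsetD])
      show ?thesis
      proof (cases "induced_weight \<sigma> = 0")
        case True
        have "?M = {}" using M induced_weight_eq[OF S(1)[OF \<sigma>]] D.weight_pos True by fastforce
        then show ?thesis using True by (simp only: sum.empty) simp
      next
        case False
        define F where "F = {\<rho> \<in> max_cells k D. aff_dim (\<sigma> \<inter> \<rho>) = int k}"
        have "\<sigma> \<subseteq> \<Union>F" unfolding F_def by (rule induced_weight_covered[OF S(1)[OF \<sigma>] False])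
        moreover have "finite F" "\<And>B. B \<in> F \<Longrightarrow> closed B"
          using D.finite_cells(2) D.cellD(3) D.max_cellD(1) by (auto simp: F_def)
        ultimately have "\<exists>\<rho>\<in>F. p \<in> \<rho> \<and> z \<tau> \<sigma> \<in> tangent_cone p \<rho>"
          using C.cellD(2)[OF C.max_cellD(1)[OF S(1)[OF \<sigma>]]] S(3)[OF \<sigma>] S(5)[OF \<sigma>]
          by (intro tangent_cone_Union) auto
        then obtain \<rho> where \<rho>: "\<rho> \<in> ?M" by (auto simp: F_def)
        have "\<rho>' = \<rho>" if "\<rho>' \<in> ?M" for \<rho>'
          using D.max_cell_tangent_unique[OF H _ _ _ _ _ _ _ _ S(6)[OF \<sigma>], of \<rho>' \<rho> p]
            that \<rho> HD D.max_cellD(1) by simp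
        then have "?M = {\<rho>}" using \<rho> by blast
        moreover have "induced_weight \<sigma> = \<eta> \<rho>"
          using induced_weight_eq[OF S(1)[OF \<sigma>] _ M[OF \<rho>]] \<rho> by blast
        ultimately show ?thesis by simp
      qed
    qed
    have "(\<Sum>n\<in>z \<tau> ` S. \<Sum>\<rho> | \<rho> \<in> max_cells k D \<and> p \<in> \<rho> \<and> n \<in> tangent_cone p \<rho>. of_int (\<eta> \<rho>) *\<^sub>R n) \<in> H"
    proof (rule D.local_balance[OF H True HD])
      show "finite (z \<tau> ` S)" using finS by simp
      show "primitive_modulo H n" if "n \<in> z \<tau> ` S" for n using that S(7) by blast
      \<comment> \<open>A positive multiple of a normal modulo \<open>H\<close> stays in the same
        half-space and so points into the same cell.\<close>
      show "n' = n" if n: "n \<in> z \<tau> ` S" "n' \<in> z \<tau> ` S" "a > 0" "n' - a *\<^sub>R n \<in> H" for n n' a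
      proof -
        obtain \<sigma> \<sigma>' where \<sigma>: "\<sigma> \<in> S" "\<sigma>' \<in> S" "n = z \<tau> \<sigma>" "n' = z \<tau> \<sigma>'" using n by blast
        have "n' \<in> tangent_cone p \<sigma>"
          unfolding C.tangent_cone_ridge[OF \<tau> S(1,2)[OF \<sigma>(1)] p]
          using n(3,4) \<sigma>(3) by (intro exI[of _ a]) (simp add: H_def)
        then have "\<sigma> = \<sigma>'" using unique[OF \<sigma>(1,2), of n'] S(5,6)[OF \<sigma>(2)] \<sigma>(4) by simp
        then show ?thesis using \<sigma> by simp
      qed
      show "\<exists>n\<in>z \<tau> ` S. \<exists>a>0. v - a *\<^sub>R n \<in> H"
        if v: "\<rho> \<in> max_cells k D" "p \<in> \<rho>" "v \<in> tangent_cone p \<rho>" "v \<notin> H" for \<rho> v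
      proof -
        obtain \<kappa> where \<kappa>: "\<kappa> \<in> C" "p \<in> \<kappa>" "v \<in> tangent_cone p \<kappa>"
          using tangent_cone_inside[OF D.max_cellD(1)[OF v(1)] v(2,3)] .
        obtain \<sigma> where \<sigma>: "\<sigma> \<in> max_cells k C" "\<kappa> face_of \<sigma>" using C.cell_subset_max_cell[OF \<kappa>(1)] .
        have \<kappa>\<sigma>: "\<kappa> \<subseteq> \<sigma>" using face_of_imp_subset[OF \<sigma>(2)] .
        have "\<tau> face_of \<sigma>"
          using complex_face_of[OF C.complex \<tau>C C.max_cellD(1)[OF \<sigma>(1)] p] \<kappa>(2) \<kappa>\<sigma> by blast
        then have \<sigma>S: "\<sigma> \<in> S" using \<sigma>(1) by (simp add: S_def)
        have "v \<in> tangent_cone p \<sigma>" using \<kappa>(3) tangent_cone_mono[OF \<kappa>\<sigma>] by blast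
        then obtain a where a: "a \<ge> 0" "v - a *\<^sub>R z \<tau> \<sigma> \<in> H"
          unfolding C.tangent_cone_ridge[OF \<tau> S(1,2)[OF \<sigma>S] p] H_def by blast
        have "a \<noteq> 0" using a(2) v(4) by auto
        then have "a > 0" using a(1) by simp
        then show ?thesis using a(2) \<sigma>S by blast
      qed
    qed
    then show ?thesis by (simp add: sum.reindex[OF inj] weight cong: sum.cong)
  qed
  then show ?thesis by (simp add: S_def H_def)
qed

end


section \<open>Decompositions and weightings\<close>

text \<open>A generic piece of \<open>S\<close> lies inside every member of \<open>X\<close> that it
  meets. Finite covers by sets of smaller dimension are thereby excluded.\<close>

lemma convex_covered_full_dim:
  fixes S :: "'a::euclidean_space set"
  assumes S: "convex S" "S \<noteq> {}" "S \<subseteq> \<Union>X" and X: "finite X" "\<And>B. B \<in> X \<Longrightarrow> closed B \<and> convex B"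
  shows "\<exists>B\<in>X. aff_dim (S \<inter> B) = aff_dim S"
proof -
  obtain T where T: "T \<subseteq> S" "aff_dim T = aff_dim S" "\<forall>B\<in>X. T \<subseteq> B \<or> T \<inter> B = {}"
    using convex_generic_piece[OF X S(1)] by blast
  have "T \<noteq> {}" using T(2) S(2) by (metis aff_dim_empty)
  then obtain p where p: "p \<in> T" by blast
  then obtain B where B: "B \<in> X" "p \<in> B" using S(3) T(1) by blast
  then have "T \<subseteq> S \<inter> B" using T(1,3) p by blast
  then have "aff_dim S \<le> aff_dim (S \<inter> B)" using aff_dim_subset T(2) by metis
  moreover have "aff_dim (S \<inter> B) \<le> aff_dim S" by (intro aff_dim_subset) simp
  ultimately show ?thesis using B(1) by (intro bexI[of _ B]) auto
qed

lemma tropical_varietyE: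
  assumes "tropical_variety k C"
  obtains z \<omega> where "balanced_complex k C z \<omega>"
  using assms unfolding tropical_variety_def balanced_complex_def lattice_complex_def balanced_complex_axioms_def
  by metis

context lattice_complex
begin

text \<open>Some cell of \<open>X\<close> overlaps \<open>\<sigma>\<close> in full dimension and
  hence equals it. Deleting a maximal cell therefore makes the set covered by the maximal cells
  strictly smaller.\<close>

lemma max_cell_covered_self:
  assumes \<sigma>: "\<sigma> \<in> max_cells k C" and X: "X \<subseteq> max_cells k C" "\<sigma> \<subseteq> \<Union>X"
  shows "\<sigma> \<in> X"
proof -
  have "\<exists>B\<in>X. aff_dim (\<sigma> \<inter> B) = aff_dim \<sigma>"
  proof (rule convex_covered_full_dim[OF _ _ X(2)])
    show "convex \<sigma>" "\<sigma> \<noteq> {}" using cellD max_cellD(1)[OF \<sigma>] by auto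
    show "finite X" using X(1) finite_cells(2) by (rule finite_subset)
    show "closed B \<and> convex B" if "B \<in> X" for B
      using that X(1) max_cellD(1) cellD(2,3) by blast
  qed
  then obtain B where B: "B \<in> X" "aff_dim (\<sigma> \<inter> B) = int k" using max_cellD(2)[OF \<sigma>] by auto
  have "\<sigma> = B" by (rule max_cells_eqI[OF \<sigma>]) (use B X(1) in auto)
  then show ?thesis using B(1) by simp
qed

text \<open>Compares dimensions through underlying sets, the only relation between \<open>C\<close>
  and the parts of a decomposition.\<close>

lemma dim_le_of_covered:
  assumes D: "lattice_complex k' D z'" and X: "finite X" "\<And>B. B \<in> X \<Longrightarrow> closed B \<and> convex B" "\<Union>D \<subseteq> \<Union>X"
  shows "\<exists>B\<in>X. int k' \<le> aff_dim B"
proof -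
  interpret D: lattice_complex k' D z' by fact
  obtain \<rho> where \<rho>: "\<rho> \<in> max_cells k' D" using D.max_cells_nonempty by blast
  note \<rho>D = D.max_cellD(1)[OF \<rho>]
  have "\<rho> \<subseteq> \<Union>X" using \<rho>D X(3) by blast
  then obtain B where "B \<in> X" "aff_dim (\<rho> \<inter> B) = aff_dim \<rho>"
    using convex_covered_full_dim[OF D.cellD(2)[OF \<rho>D] D.cellD(4)[OF \<rho>D] _ X(1,2)] by blast
  moreover have "aff_dim (\<rho> \<inter> B) \<le> aff_dim B" by (intro aff_dim_subset) simp
  ultimately show ?thesis using D.max_cellD(2)[OF \<rho>] by (intro bexI[of _ B]) auto
qed

text \<open>If the induced weight had no zero, \<open>D\<close> would cover every maximal cell of
  \<open>C\<close>, contrary to properness. It is nonzero where a maximal cell of \<open>D\<close>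
  overlaps one of \<open>C\<close> in full dimension.\<close>

lemma proper_subvariety_weight:
  assumes "tropical_variety k D" "\<Union>D \<subset> \<Union>C"
  shows "\<exists>m :: (real ^ 'n) set \<Rightarrow> int. (\<forall>\<sigma>\<in>max_cells k C. m \<sigma> \<ge> 0) \<and>
    (\<exists>\<sigma>\<in>max_cells k C. m \<sigma> = 0) \<and> (\<exists>\<sigma>\<in>max_cells k C. m \<sigma> \<noteq> 0) \<and>
    (\<forall>\<tau>\<in>ridges k C. (\<Sum>\<sigma> | \<sigma> \<in> max_cells k C \<and> \<tau> face_of \<sigma>. of_int (m \<sigma>) *\<^sub>R z \<tau> \<sigma>) \<in> lin_space \<tau>)"
proof -
  obtain y \<eta> where "balanced_complex k D y \<eta>" using tropical_varietyE[OF assms(1)] .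
  then interpret D: balanced_complex k D y \<eta> .
  interpret I: complex_inside k C z D y \<eta> by unfold_locales (use assms(2) in blast)
  have "\<exists>\<sigma>\<in>max_cells k C. I.induced_weight \<sigma> = 0"
  proof (rule ccontr)
    assume "\<not> (\<exists>\<sigma>\<in>max_cells k C. I.induced_weight \<sigma> = 0)"
    then have "\<sigma> \<subseteq> \<Union>D" if "\<sigma> \<in> max_cells k C" for \<sigma>
      using I.induced_weight_covered[OF that] that D.max_cellD(1) by blast
    then have "\<Union>(max_cells k C) \<subseteq> \<Union>D" by blast
    then show False using assms(2) unfolding Union_max_cells by blast
  qed
  moreover have "\<exists>\<sigma>\<in>max_cells k C. I.induced_weight \<sigma> \<noteq> 0"
  proof -
    obtain \<rho> where \<rho>: "\<rho> \<in> max_cells k D" using D.max_cells_nonempty by blast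
    note \<rho>D = D.max_cellD(1)[OF \<rho>]
    have "\<rho> \<subseteq> \<Union>(max_cells k C)" unfolding Union_max_cells using \<rho>D assms(2) by blast
    then have "\<exists>\<sigma>\<in>max_cells k C. aff_dim (\<rho> \<inter> \<sigma>) = aff_dim \<rho>"
      using finite_cells(2) cellD(2,3) max_cellD(1)
      by (intro convex_covered_full_dim[OF D.cellD(2)[OF \<rho>D] D.cellD(4)[OF \<rho>D]]) auto
    then obtain \<sigma> where \<sigma>: "\<sigma> \<in> max_cells k C" "aff_dim (\<sigma> \<inter> \<rho>) = int k"
      using D.max_cellD(2)[OF \<rho>] by (auto simp: Int_commute)
    have "I.induced_weight \<sigma> = \<eta> \<rho>" by (rule I.induced_weight_eq[OF \<sigma>(1) \<rho> \<sigma>(2)])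
    then show ?thesis using D.weight_pos[OF \<rho>] \<sigma>(1) by (intro bexI[of _ \<sigma>]) auto
  qed
  ultimately show ?thesis
    by (intro exI[of _ I.induced_weight] conjI ballI I.induced_weight_nonneg I.induced_weight_balanced)
qed

lemma not_extremal_weight:
  assumes "\<not> extremal C"
  shows "\<exists>m :: (real ^ 'n) set \<Rightarrow> int. (\<forall>\<sigma>\<in>max_cells k C. m \<sigma> \<ge> 0) \<and>
    (\<exists>\<sigma>\<in>max_cells k C. m \<sigma> = 0) \<and> (\<exists>\<sigma>\<in>max_cells k C. m \<sigma> \<noteq> 0) \<and>
    (\<forall>\<tau>\<in>ridges k C. (\<Sum>\<sigma> | \<sigma> \<in> max_cells k C \<and> \<tau> face_of \<sigma>. of_int (m \<sigma>) *\<^sub>R z \<tau> \<sigma>) \<in> lin_space \<tau>)"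
proof -
  obtain k1 k2 C1 C2 where C1: "tropical_variety k1 C1" and C2: "tropical_variety k2 C2"
    and un: "\<Union>C = \<Union>C1 \<union> \<Union>C2" and proper: "\<Union>C1 \<subset> \<Union>C" "\<Union>C2 \<subset> \<Union>C"
    using assms unfolding extremal_def by blast
  obtain z1 \<eta>1 where "balanced_complex k1 C1 z1 \<eta>1" using tropical_varietyE[OF C1] .
  then interpret C1: balanced_complex k1 C1 z1 \<eta>1 .
  obtain z2 \<eta>2 where "balanced_complex k2 C2 z2 \<eta>2" using tropical_varietyE[OF C2] .
  then interpret C2: balanced_complex k2 C2 z2 \<eta>2 .
  have "\<exists>B\<in>C. int k1 \<le> aff_dim B"
    by (rule dim_le_of_covered[OF C1.lattice_complex_axioms finite_cells(1)]) (use cellD(2,3) proper(1) in auto)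
  then have k1: "k1 \<le> k" using aff_dim_cell_le by fastforce
  have "\<exists>B\<in>C. int k2 \<le> aff_dim B"
    by (rule dim_le_of_covered[OF C2.lattice_complex_axioms finite_cells(1)]) (use cellD(2,3) proper(2) in auto)
  then have k2: "k2 \<le> k" using aff_dim_cell_le by fastforce
  have "\<exists>B\<in>C1 \<union> C2. int k \<le> aff_dim B"
    by (rule dim_le_of_covered[OF lattice_complex_axioms])
      (use C1.finite_cells(1) C2.finite_cells(1) C1.cellD(2,3) C2.cellD(2,3) un in auto)
  then have "k \<le> k1 \<or> k \<le> k2" using C1.aff_dim_cell_le C2.aff_dim_cell_le by fastforce
  then have "k1 = k \<or> k2 = k" using k1 k2 by linarith
  then show ?thesis
  proof
    assume "k1 = k"
    then show ?thesis using C1 by (intro proper_subvariety_weight[OF _ proper(1)]) simp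
  next
    assume "k2 = k"
    then show ?thesis using C2 by (intro proper_subvariety_weight[OF _ proper(2)]) simp
  qed
qed

text \<open>The nonempty faces of the maximal cells of nonzero weight form a complex that is pure by
  construction. Its ridges are ridges of \<open>C\<close>, and the terms missing from a balancing
  sum have weight 0.\<close>

lemma support_tropical:
  fixes w :: "(real ^ 'n) set \<Rightarrow> int"
  assumes nonneg: "\<And>\<sigma>. \<sigma> \<in> max_cells k C \<Longrightarrow> w \<sigma> \<ge> 0" and nonzero: "\<exists>\<sigma>\<in>max_cells k C. w \<sigma> \<noteq> 0"
    and balanced: "\<And>\<tau>. \<tau> \<in> ridges k C \<Longrightarrow>
      (\<Sum>\<sigma> | \<sigma> \<in> max_cells k C \<and> \<tau> face_of \<sigma>. of_int (w \<sigma>) *\<^sub>R z \<tau> \<sigma>) \<in> lin_space \<tau>"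
  shows "\<exists>D. tropical_variety k D \<and> \<Union>D = \<Union>{\<sigma> \<in> max_cells k C. w \<sigma> \<noteq> 0}"
proof -
  define P where "P = {\<sigma> \<in> max_cells k C. w \<sigma> \<noteq> 0}"
  define D where "D = {F. F \<noteq> {} \<and> (\<exists>\<sigma>\<in>P. F face_of \<sigma>)}"
  have PC: "\<sigma> \<in> max_cells k C" "\<sigma> \<in> C" if "\<sigma> \<in> P" for \<sigma> using that max_cellD(1) by (auto simp: P_def)
  have PD: "P \<subseteq> D"
  proof
    fix \<sigma> assume \<sigma>: "\<sigma> \<in> P"
    have "\<sigma> face_of \<sigma>" "\<sigma> \<noteq> {}" using face_of_refl cellD(2,4) PC(2)[OF \<sigma>] by auto
    then show "\<sigma> \<in> D" using \<sigma> unfolding D_def by blast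
  qed
  have face: "F \<in> C" if "\<sigma> \<in> C" "F face_of \<sigma>" "F \<noteq> {}" for F \<sigma>
    using complex that unfolding polyhedral_complex_def by blast
  have DC: "D \<subseteq> C" unfolding D_def using face PC by blast
  have finD: "finite D" using DC finite_cells(1) by (rule finite_subset)
  have maxD: "max_cells k D = P"
  proof
    show "P \<subseteq> max_cells k D" using PD max_cellD(2) PC by (auto simp: max_cells_def)
    show "max_cells k D \<subseteq> P"
    proof
      fix \<sigma> assume "\<sigma> \<in> max_cells k D"
      then have \<sigma>: "\<sigma> \<in> D" "\<sigma> \<in> max_cells k C" using DC by (auto simp: max_cells_def)
      then obtain \<rho> where \<rho>: "\<rho> \<in> P" "\<sigma> face_of \<rho>" by (auto simp: D_def)
      then show "\<sigma> \<in> P" using max_cell_eq[OF \<sigma>(2) \<rho>(2) PC(2)[OF \<rho>(1)]] by simp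
    qed
  qed
  have ridgesD: "ridges k D \<subseteq> ridges k C" using DC by (auto simp: ridges_def)
  obtain \<sigma>0 where \<sigma>0: "\<sigma>0 \<in> P" using nonzero by (auto simp: P_def)
  have "polyhedral_complex D"
    unfolding polyhedral_complex_def
  proof (intro conjI ballI allI impI)
    show "finite D" by fact
    show "D \<noteq> {}" using \<sigma>0 PD by blast
    show "polyhedron \<sigma>" "\<sigma> \<noteq> {}" if "\<sigma> \<in> D" for \<sigma> using that DC cellD(1,4) by auto
    show "F \<in> D" if "\<sigma> \<in> D" "F face_of \<sigma> \<and> F \<noteq> {}" for \<sigma> F
      using that face_of_trans unfolding D_def by blast
    show "(\<sigma> \<inter> \<tau>) face_of \<sigma>" "(\<sigma> \<inter> \<tau>) face_of \<tau>" if "\<sigma> \<in> D" "\<tau> \<in> D" "\<sigma> \<inter> \<tau> \<noteq> {}" for \<sigma> \<tau>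
      using complex_Int_face_of[OF complex _ _ that(3)] that(1,2) DC by blast+
  qed
  moreover have "complex_dim D = int k"
    unfolding complex_dim_def
  proof (rule Max_eqI)
    show "finite (aff_dim ` D)" using finD by simp
    show "a \<le> int k" if "a \<in> aff_dim ` D" for a using that aff_dim_cell_le DC by blast
    show "int k \<in> aff_dim ` D" using \<sigma>0 PD max_cellD(2)[OF PC(1)[OF \<sigma>0]] by (metis image_eqI subsetD)
  qed
  moreover have "\<exists>\<sigma>\<in>max_cells k D. \<tau> face_of \<sigma>" if "\<tau> \<in> D" for \<tau>
    using that unfolding maxD by (simp add: D_def)
  ultimately have "pure_complex k D" by (simp add: pure_complex_def)
  moreover have "rational_complex k D"
    unfolding rational_complex_def maxD
  proof
    fix \<rho> assume "\<rho> \<in> P \<union> ridges k D"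
    then have "\<rho> \<in> max_cells k C \<union> ridges k C" using PC(1) ridgesD by blast
    then show "\<exists>B. lattice_basis B (cell_lattice \<rho>) \<and> int (card B) = aff_dim \<rho>"
      by (rule rational[unfolded rational_complex_def, rule_format])
  qed
  moreover have "lattice_normals k D z"
    unfolding lattice_normals_def maxD
    using normals[unfolded lattice_normals_def, rule_format] ridgesD PC(1) by (intro ballI impI) auto
  moreover have "balanced_weighting k D z w"
    unfolding balanced_weighting_def weighting_def maxD
  proof (intro conjI ballI)
    show "w \<sigma> > 0" if "\<sigma> \<in> P" for \<sigma> using that nonneg[of \<sigma>] by (simp add: P_def)
    fix \<tau> assume \<tau>: "\<tau> \<in> ridges k D"
    have "(\<Sum>\<sigma> | \<sigma> \<in> P \<and> \<tau> face_of \<sigma>. of_int (w \<sigma>) *\<^sub>R z \<tau> \<sigma>) =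
      (\<Sum>\<sigma> | \<sigma> \<in> max_cells k C \<and> \<tau> face_of \<sigma>. of_int (w \<sigma>) *\<^sub>R z \<tau> \<sigma>)"
      using finite_cells(2) by (intro sum.mono_neutral_left) (auto simp: P_def)
    then show "(\<Sum>\<sigma> | \<sigma> \<in> P \<and> \<tau> face_of \<sigma>. of_int (w \<sigma>) *\<^sub>R z \<tau> \<sigma>) \<in> lin_space \<tau>"
      using balanced \<tau> ridgesD by auto
  qed
  ultimately have "tropical_variety k D" unfolding tropical_variety_def by (intro conjI exI)
  moreover have "\<Union>D = \<Union>P"
  proof
    show "\<Union>D \<subseteq> \<Union>P" unfolding D_def using face_of_imp_subset by blast
    show "\<Union>P \<subseteq> \<Union>D" using PD by blast
  qed
  ultimately show ?thesis unfolding P_def by blast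
qed

text \<open>With \<open>a\<close> and \<open>b\<close> minimizing and maximizing the ratio of the two weightings, subtract the multiples
  that vanish at \<open>a\<close> and \<open>b\<close>; the supports of the differences are the two parts.\<close>

lemma two_weightings_not_extremal:
  assumes u: "balanced_weighting k C z u" and v: "balanced_weighting k C z v"
    and ne: "\<sigma>1 \<in> max_cells k C" "\<sigma>2 \<in> max_cells k C" "u \<sigma>1 * v \<sigma>2 \<noteq> u \<sigma>2 * v \<sigma>1"
  shows "\<not> extremal C"
proof -
  have pos: "u \<sigma> > 0" "v \<sigma> > 0" if "\<sigma> \<in> max_cells k C" for \<sigma>
    using u[unfolded balanced_weighting_def weighting_def, THEN conjunct1, rule_format, OF that]
      v[unfolded balanced_weighting_def weighting_def, THEN conjunct1, rule_format, OF that] by simp_all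
  define r where "r \<sigma> = real_of_int (u \<sigma>) / real_of_int (v \<sigma>)" for \<sigma>
  have r: "r \<sigma> \<le> r \<sigma>' \<longleftrightarrow> u \<sigma> * v \<sigma>' \<le> u \<sigma>' * v \<sigma>"
    if "\<sigma> \<in> max_cells k C" "\<sigma>' \<in> max_cells k C" for \<sigma> \<sigma>'
  proof -
    have "r \<sigma> \<le> r \<sigma>' \<longleftrightarrow> real_of_int (u \<sigma> * v \<sigma>') \<le> real_of_int (u \<sigma>' * v \<sigma>)"
      using pos[OF that(1)] pos[OF that(2)] by (simp add: r_def field_simps)
    then show ?thesis by (simp only: of_int_le_iff)
  qed
  obtain a where a: "a \<in> max_cells k C" "\<And>\<sigma>. \<sigma> \<in> max_cells k C \<Longrightarrow> r a \<le> r \<sigma>"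
    using arg_min_if_finite[OF finite_cells(2) max_cells_nonempty, of r] by (metis linorder_not_le)
  obtain b where b: "b \<in> max_cells k C" "\<And>\<sigma>. \<sigma> \<in> max_cells k C \<Longrightarrow> r \<sigma> \<le> r b"
    using arg_min_if_finite[OF finite_cells(2) max_cells_nonempty, of "\<lambda>\<sigma>. - r \<sigma>"]
    by (metis linorder_not_le neg_less_iff_less)
  have ab: "r a < r b"
  proof (rule ccontr)
    assume "\<not> r a < r b"
    then have "r \<sigma>1 = r \<sigma>2" using a(2)[OF ne(1)] a(2)[OF ne(2)] b(2)[OF ne(1)] b(2)[OF ne(2)] by linarith
    then have "u \<sigma>1 * v \<sigma>2 \<le> u \<sigma>2 * v \<sigma>1" "u \<sigma>2 * v \<sigma>1 \<le> u \<sigma>1 * v \<sigma>2"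
      using r[OF ne(1,2)] r[OF ne(2,1)] by simp_all
    then show False using ne(3) by simp
  qed
  have combine: "(\<Sum>\<sigma> | \<sigma> \<in> max_cells k C \<and> \<tau> face_of \<sigma>. of_int (c * u \<sigma> + d * v \<sigma>) *\<^sub>R z \<tau> \<sigma>) \<in> lin_space \<tau>"
    if "\<tau> \<in> ridges k C" for c d \<tau>
  proof -
    have eq: "(\<Sum>\<sigma> | \<sigma> \<in> max_cells k C \<and> \<tau> face_of \<sigma>. of_int (c * u \<sigma> + d * v \<sigma>) *\<^sub>R z \<tau> \<sigma>) =
      of_int c *\<^sub>R (\<Sum>\<sigma> | \<sigma> \<in> max_cells k C \<and> \<tau> face_of \<sigma>. of_int (u \<sigma>) *\<^sub>R z \<tau> \<sigma>) +
      of_int d *\<^sub>R (\<Sum>\<sigma> | \<sigma> \<in> max_cells k C \<and> \<tau> face_of \<sigma>. of_int (v \<sigma>) *\<^sub>R z \<tau> \<sigma>)"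
      by (simp add: scaleR_add_left sum.distrib scaleR_sum_right)
    show ?thesis
      unfolding eq
      by (intro subspace_add subspace_scale subspace_lin_space
          u[unfolded balanced_weighting_def, THEN conjunct2, rule_format, OF that]
          v[unfolded balanced_weighting_def, THEN conjunct2, rule_format, OF that])
  qed
  \<comment> \<open>In terms of ratios, \<open>w1 \<sigma>\<close> is
    \<open>v a * v \<sigma> * (r \<sigma> - r a)\<close> and \<open>w2 \<sigma>\<close> is
    \<open>v b * v \<sigma> * (r b - r \<sigma>)\<close>; clearing denominators keeps the weights
    integral.\<close>
  define w1 where "w1 \<sigma> = v a * u \<sigma> + (- u a) * v \<sigma>" for \<sigma>
  define w2 where "w2 \<sigma> = (- v b) * u \<sigma> + u b * v \<sigma>" for \<sigma>
  have w1: "w1 \<sigma> \<ge> 0" "w1 \<sigma> = 0 \<longleftrightarrow> r \<sigma> = r a" if "\<sigma> \<in> max_cells k C" for \<sigma>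
  proof -
    show "w1 \<sigma> \<ge> 0" using r[OF a(1) that] a(2)[OF that] by (simp add: w1_def mult.commute)
    have "w1 \<sigma> \<le> 0 \<longleftrightarrow> r \<sigma> \<le> r a" using r[OF that a(1)] by (simp add: w1_def mult.commute)
    then show "w1 \<sigma> = 0 \<longleftrightarrow> r \<sigma> = r a" using \<open>w1 \<sigma> \<ge> 0\<close> a(2)[OF that] by linarith
  qed
  have w2: "w2 \<sigma> \<ge> 0" "w2 \<sigma> = 0 \<longleftrightarrow> r \<sigma> = r b" if "\<sigma> \<in> max_cells k C" for \<sigma>
  proof -
    show "w2 \<sigma> \<ge> 0" using r[OF that b(1)] b(2)[OF that] by (simp add: w2_def mult.commute)
    have "w2 \<sigma> \<le> 0 \<longleftrightarrow> r b \<le> r \<sigma>" using r[OF b(1) that] by (simp add: w2_def mult.commute)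
    then show "w2 \<sigma> = 0 \<longleftrightarrow> r \<sigma> = r b" using \<open>w2 \<sigma> \<ge> 0\<close> b(2)[OF that] by linarith
  qed
  have "\<exists>D. tropical_variety k D \<and> \<Union>D = \<Union>{\<sigma> \<in> max_cells k C. w1 \<sigma> \<noteq> 0}"
  proof (rule support_tropical)
    show "\<exists>\<sigma>\<in>max_cells k C. w1 \<sigma> \<noteq> 0" using w1(2)[OF b(1)] ab b(1) by force
    show "(\<Sum>\<sigma> | \<sigma> \<in> max_cells k C \<and> \<tau> face_of \<sigma>. of_int (w1 \<sigma>) *\<^sub>R z \<tau> \<sigma>) \<in> lin_space \<tau>"
      if "\<tau> \<in> ridges k C" for \<tau> unfolding w1_def by (rule combine[OF that])
  qed (rule w1(1))
  then obtain D1 where D1: "tropical_variety k D1" "\<Union>D1 = \<Union>{\<sigma> \<in> max_cells k C. w1 \<sigma> \<noteq> 0}" by blast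
  have "\<exists>D. tropical_variety k D \<and> \<Union>D = \<Union>{\<sigma> \<in> max_cells k C. w2 \<sigma> \<noteq> 0}"
  proof (rule support_tropical)
    show "\<exists>\<sigma>\<in>max_cells k C. w2 \<sigma> \<noteq> 0" using w2(2)[OF a(1)] ab a(1) by force
    show "(\<Sum>\<sigma> | \<sigma> \<in> max_cells k C \<and> \<tau> face_of \<sigma>. of_int (w2 \<sigma>) *\<^sub>R z \<tau> \<sigma>) \<in> lin_space \<tau>"
      if "\<tau> \<in> ridges k C" for \<tau> unfolding w2_def by (rule combine[OF that])
  qed (rule w2(1))
  then obtain D2 where D2: "tropical_variety k D2" "\<Union>D2 = \<Union>{\<sigma> \<in> max_cells k C. w2 \<sigma> \<noteq> 0}" by blast
  \<comment> \<open>No cell has both the least and the greatest ratio, so the two supports together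
    contain all maximal cells.\<close>
  have "w1 \<sigma> \<noteq> 0 \<or> w2 \<sigma> \<noteq> 0" if "\<sigma> \<in> max_cells k C" for \<sigma>
    using w1(2)[OF that] w2(2)[OF that] ab by auto
  then have "max_cells k C = {\<sigma> \<in> max_cells k C. w1 \<sigma> \<noteq> 0} \<union> {\<sigma> \<in> max_cells k C. w2 \<sigma> \<noteq> 0}" by blast
  then have un: "\<Union>C = \<Union>D1 \<union> \<Union>D2"
    unfolding D1(2) D2(2) Union_max_cells[symmetric] by (metis Union_Un_distrib)
  \<comment> \<open>The cell \<open>a\<close> is outside the support of \<open>w1\<close>, and other
    maximal cells cannot cover it.\<close>
  have "\<not> a \<subseteq> \<Union>D1"
    using max_cell_covered_self[OF a(1), of "{\<sigma> \<in> max_cells k C. w1 \<sigma> \<noteq> 0}"] w1(2)[OF a(1)] D1(2) by auto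
  then have "\<Union>D1 \<subset> \<Union>C" using un max_cellD(1)[OF a(1)] by blast
  moreover have "\<not> b \<subseteq> \<Union>D2"
    using max_cell_covered_self[OF b(1), of "{\<sigma> \<in> max_cells k C. w2 \<sigma> \<noteq> 0}"] w2(2)[OF b(1)] D2(2) by auto
  then have "\<Union>D2 \<subset> \<Union>C" using un max_cellD(1)[OF b(1)] by blast
  ultimately have "\<exists>k1 k2 C1 C2. tropical_variety k1 C1 \<and> tropical_variety k2 C2 \<and>
      \<Union>C = \<Union>C1 \<union> \<Union>C2 \<and> \<Union>C1 \<subset> \<Union>C \<and> \<Union>C2 \<subset> \<Union>C"
    using D1(1) D2(1) un by (intro exI conjI)
  then show ?thesis unfolding extremal_def not_not .
qed

end


section \<open>Rank and kernel of real matrices\<close>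

lemma rank_plus_kernel_dim:
  fixes A :: "'a::field mat"
  assumes A: "A \<in> carrier_mat nr nc"
  shows "vec_space.rank nr A + kernel_dim A = nc"
proof -
  interpret V: vec_space "TYPE('a)" nc .
  interpret W: vec_space "TYPE('a)" nr .
  interpret K: kernel nr nc A by unfold_locales (rule A)
  interpret T: linear_map class_ring V.V W.V "\<lambda>v. A *\<^sub>v v"
  proof -
    have "(\<lambda>v. A *\<^sub>v v) \<in> module_hom class_ring V.V W.V"
      using A by (auto simp: module_hom_def module_vec_simps mult_add_distrib_mat_vec[OF A] mult_mat_vec[OF A])
    then show "linear_map class_ring V.V W.V (\<lambda>v. A *\<^sub>v v)"
      by (simp add: linear_map_def mod_hom_def mod_hom_axioms_def V.vectorspace_axioms W.vectorspace_axioms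
          V.module_axioms W.module_axioms)
  qed
  have "T.im = W.span (set (cols A))"
    using W.col_space_eq[OF A] A unfolding W.col_space_def T.im_def by (auto simp: module_vec_simps)
  moreover have "T.ker = mat_kernel A"
    unfolding T.ker_def mat_kernel[OF A] by (auto simp: module_vec_simps)
  ultimately show ?thesis
    using T.rank_nullity[OF V.fin_dim] V.dim_is_n unfolding W.rank_def K.kernel_dim by simp
qed

text \<open>For \<open>v\<close> in the kernel of the product, moving the transpose across the
  scalar product shows that \<open>transpose_mat A *\<^sub>v v\<close> has square norm 0; over the
  reals it vanishes.\<close>

lemma mat_kernel_mult_transpose:
  fixes A :: "real mat"
  assumes A: "A \<in> carrier_mat nr nc"
  shows "mat_kernel (A * transpose_mat A) = mat_kernel (transpose_mat A)"
proof
  have At: "transpose_mat A \<in> carrier_mat nc nr" using A by simp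
  then show "mat_kernel (transpose_mat A) \<subseteq> mat_kernel (A * transpose_mat A)"
    by (rule mat_kernel_mult_subset[OF _ A])
  show "mat_kernel (A * transpose_mat A) \<subseteq> mat_kernel (transpose_mat A)"
  proof
    fix v assume v: "v \<in> mat_kernel (A * transpose_mat A)"
    have AAt: "A * transpose_mat A \<in> carrier_mat nr nr" using A by simp
    have vc: "v \<in> carrier_vec nr" and v0: "A * transpose_mat A *\<^sub>v v = 0\<^sub>v nr"
      using mat_kernelD[OF AAt v] by auto
    define u where "u = transpose_mat A *\<^sub>v v"
    have u: "u \<in> carrier_vec nc" using At vc by (simp add: u_def)
    have "A *\<^sub>v u = 0\<^sub>v nr" using v0 assoc_mult_mat_vec[OF A At vc] by (simp add: u_def)
    have "scalar_prod u u = scalar_prod (transpose_mat A *\<^sub>v v) u" by (simp add: u_def)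
    also have "\<dots> = scalar_prod v (A *\<^sub>v u)" by (rule transpose_vec_mult_scalar[OF A u vc])
    also have "\<dots> = 0" using \<open>A *\<^sub>v u = 0\<^sub>v nr\<close> vc by simp
    finally have "(\<Sum>i\<in>{0..<nc}. u $ i * u $ i) = 0" using u by (simp add: scalar_prod_def)
    then have "\<forall>i\<in>{0..<nc}. u $ i * u $ i = 0"
      by (subst (asm) sum_nonneg_eq_0_iff) auto
    then have "u = 0\<^sub>v nc" using u by (intro eq_vecI) auto
    then show "v \<in> mat_kernel (transpose_mat A)" by (intro mat_kernelI[OF At vc]) (simp add: u_def)
  qed
qed

text \<open>The columns of the product are combinations of the columns of \<open>A\<close>, so a
  maximal independent set of them is independent inside the column space of
  \<open>A\<close>.\<close>

lemma rank_mult_le: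
  fixes A :: "'a::field mat"
  assumes A: "A \<in> carrier_mat n m" and B: "B \<in> carrier_mat m l"
  shows "vec_space.rank n (A * B) \<le> vec_space.rank n A"
proof -
  interpret W: vec_space "TYPE('a)" n .
  have AB: "A * B \<in> carrier_mat n l" using A B by simp
  have colsA: "set (cols A) \<subseteq> carrier_vec n" using A cols_dim[of A] by simp
  have sub: "VectorSpace.subspace class_ring (W.span (set (cols A))) W.V" by (rule W.span_is_subspace[OF colsA])
  interpret S: vectorspace class_ring "W.span_vs (set (cols A))" by (rule W.subspace_is_vs[OF sub])
  obtain U where U: "finite U" "maximal U (\<lambda>T. T \<subseteq> set (cols (A * B)) \<and> W.lin_indpt T)"
  proof -
    have "W.lin_indpt {}" by (auto simp: W.lin_dep_def)
    then show ?thesis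
      using maximal_exists_superset[of "set (cols (A * B))" "\<lambda>T. T \<subseteq> set (cols (A * B)) \<and> W.lin_indpt T" "{}"] that
      by auto
  qed
  then have Us: "U \<subseteq> set (cols (A * B))" "W.lin_indpt U" by (auto simp: maximal_def)
  have "set (cols (A * B)) \<subseteq> W.span (set (cols A))"
  proof
    fix c assume "c \<in> set (cols (A * B))"
    then obtain j where j: "j < l" "c = col (A * B) j" using AB by (auto simp: cols_def)
    then have "c = A *\<^sub>v col B j" using A B by (auto intro!: eq_vecI)
    then show "c \<in> W.span (set (cols A))"
      using W.col_space_eq[OF A] A B j unfolding W.col_space_def by auto
  qed
  then have UA: "U \<subseteq> W.span (set (cols A))" using Us(1) by blast
  have "S.lin_indpt U"
    using W.span_li_not_depend(2)[OF UA W.span_is_submodule[OF colsA]] Us(2) by simp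
  then have "card U \<le> S.dim"
    using UA by (intro S.li_le_dim(2)[OF W.fin_dim_span_cols[OF A]]) simp_all
  then show ?thesis using W.rank_card_indpt[OF AB U(2)] by (simp add: W.rank_def)
qed

text \<open>By equality of kernels, \<open>transpose_mat A\<close> has the rank of
  \<open>A * transpose_mat A\<close>, which is at most the rank of the left factor \<open>A\<close>.
  Exchanging \<open>A\<close> and its transpose gives the other inequality.\<close>

lemma rank_transpose:
  fixes A :: "real mat"
  assumes A: "A \<in> carrier_mat nr nc"
  shows "vec_space.rank nc (transpose_mat A) = vec_space.rank nr A"
proof -
  have le: "vec_space.rank m (transpose_mat B) \<le> vec_space.rank n B" if B: "B \<in> carrier_mat n m" for B :: "real mat" and n m
  proof -
    have Bt: "transpose_mat B \<in> carrier_mat m n" and BBt: "B * transpose_mat B \<in> carrier_mat n n" using B by auto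
    have "kernel_dim (B * transpose_mat B) = kernel_dim (transpose_mat B)"
      using B by (simp add: kernel_dim_def mat_kernel_mult_transpose[OF B])
    then have "vec_space.rank m (transpose_mat B) = vec_space.rank n (B * transpose_mat B)"
      using rank_plus_kernel_dim[OF Bt] rank_plus_kernel_dim[OF BBt] by simp
    then show ?thesis using rank_mult_le[OF B Bt] by simp
  qed
  show ?thesis using le[OF A] le[of "transpose_mat A" nc nr] A by simp
qed

lemma kernel_dim_transpose:
  fixes A :: "real mat"
  assumes A: "A \<in> carrier_mat nr nc"
  shows "vec_space.rank nr A + kernel_dim (transpose_mat A) = nr"
  using rank_plus_kernel_dim[of "transpose_mat A" nc nr] rank_transpose[OF A] A by simp

section \<open>Independent vectors in the kernel of a matrix\<close>

context kernel
begin

lemma fin_dim: "Ker.fin_dim"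
  using kernel_basis_exists[OF A] unfolding Ker.fin_dim_def Ker.basis_def by blast

lemma card_le_kernel_dim:
  assumes "W \<subseteq> mat_kernel A" "\<not> NC.lin_dep W"
  shows "finite W" "card W \<le> kernel_dim A"
  using Ker.li_le_dim[OF fin_dim] assms lindep_same[OF assms(1)] by auto

text \<open>A maximal independent subset of a spanning set is a basis. The balanced weightings, to
  which this is applied, are not closed under linear combinations, so the basis has to be selected
  among them.\<close>

lemma kernel_dim_attained:
  assumes W: "W \<subseteq> mat_kernel A" "mat_kernel A \<subseteq> NC.span W"
  shows "\<exists>B\<subseteq>W. finite B \<and> card B = kernel_dim A \<and> \<not> NC.lin_dep B"
proof -
  obtain B where B: "finite B" "maximal B (\<lambda>S. S \<subseteq> W \<and> Ker.lin_indpt S)"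
  proof -
    have "\<exists>B. finite B \<and> maximal B (\<lambda>S. S \<subseteq> W \<and> Ker.lin_indpt S)"
    proof (rule maximal_exists)
      show "finite S \<and> card S \<le> Ker.dim" if "S \<subseteq> W \<and> Ker.lin_indpt S" for S
        using Ker.li_le_dim[OF fin_dim, of S] that W(1) by auto
      show "{} \<subseteq> W \<and> Ker.lin_indpt {}" by (auto simp: Ker.lin_dep_def)
    qed
    then show ?thesis using that by blast
  qed
  then have BW: "B \<subseteq> W" "Ker.lin_indpt B" and max: "\<And>S. B \<subseteq> S \<Longrightarrow> S \<subseteq> W \<Longrightarrow> Ker.lin_indpt S \<Longrightarrow> S = B"
    by (auto simp: maximal_def)
  have BK: "B \<subseteq> mat_kernel A" using BW(1) W(1) by blast
  have "W \<subseteq> Ker.span B"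
  proof
    fix v assume v: "v \<in> W"
    show "v \<in> Ker.span B"
    proof (cases "v \<in> B")
      case True
      then show ?thesis using Ker.in_own_span[of B] BK by auto
    next
      case False
      then have "Ker.lin_dep (B \<union> {v})" using max[of "B \<union> {v}"] BW(1) v by blast
      then show ?thesis
        using Ker.lin_dep_iff_in_span[of B v] BK BW(2) v W(1) False by auto
    qed
  qed
  then have "Ker.span W \<subseteq> Ker.span B"
    using Ker.span_is_submodule[of B] BK by (intro Ker.span_is_subset) simp_all
  then have "mat_kernel A \<subseteq> Ker.span B" using W(2) span_same[OF W(1)] by simp
  moreover have "Ker.span B \<subseteq> mat_kernel A" using Ker.span_is_subset2[of B] BK by simp
  ultimately have "Ker.basis B" using BW(2) BK by (simp add: Ker.basis_def)
  then have "card B = kernel_dim A" using Ker.dim_basis[OF B(1)] by simp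
  then show ?thesis using B(1) BW lindep_same[OF BK] by blast
qed

end

text \<open>The 2x2 minors are the cross products by which two weightings are compared. Equal
  vectors would collapse in the set \<open>{u, v}\<close>, whence the hypothesis
  \<open>u \<noteq> v\<close>.\<close>

lemma (in vec_space) lin_indpt_pair_iff:
  assumes u: "u \<in> carrier_vec n" and v: "v \<in> carrier_vec n" and ne: "u \<noteq> v" "u \<noteq> 0\<^sub>v n"
  shows "lin_indpt {u, v} \<longleftrightarrow> (\<exists>i<n. \<exists>j<n. u $ i * v $ j \<noteq> u $ j * v $ i)"
proof -
  have carrier: "{u, v} \<subseteq> carrier_vec n" using u v by simp
  have comb: "lincomb a {u, v} $ i = a u * u $ i + a v * v $ i" if "i < n" for a i
    using lincomb_index[OF that carrier] ne(1) by simp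
  have dim: "dim_vec (lincomb a {u, v}) = n" for a using lincomb_dim[OF _ carrier, of a] by simp
  show ?thesis
  proof
    assume indep: "lin_indpt {u, v}"
    show "\<exists>i<n. \<exists>j<n. u $ i * v $ j \<noteq> u $ j * v $ i"
    proof (rule ccontr)
      assume "\<not> ?thesis"
      then have eq: "u $ i * v $ j = u $ j * v $ i" if "i < n" "j < n" for i j using that by blast
      obtain j where j: "j < n" "u $ j \<noteq> 0" using u ne(2) by (metis carrier_vecD eq_vecI index_zero_vec)
      \<comment> \<open>The vanishing minors at index \<open>j\<close> say that \<open>v $ j\<close>
        times \<open>u\<close> equals \<open>u $ j\<close> times \<open>v\<close>; this relation is
        nontrivial because \<open>u $ j\<close> is nonzero.\<close>
      define a where "a w = (if w = u then v $ j else - (u $ j))" for w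
      have "lincomb a {u, v} = 0\<^sub>v n"
        using comb[of _ a] dim[of a] eq[OF _ j(1)] ne(1) by (intro eq_vecI) (auto simp: a_def mult.commute)
      moreover have "a v \<noteq> 0" using j(2) ne(1) by (simp add: a_def)
      ultimately have "lin_dep {u, v}" by (intro lin_dep_crit[where A = "{u, v}" and a = a and v = v]) auto
      then show False using indep by simp
    qed
  next
    assume "\<exists>i<n. \<exists>j<n. u $ i * v $ j \<noteq> u $ j * v $ i"
    then obtain i j where ij: "i < n" "j < n" "u $ i * v $ j \<noteq> u $ j * v $ i" by blast
    show "lin_indpt {u, v}"
    proof (rule finite_lin_indpt2)
      show "\<forall>w\<in>{u, v}. a w = 0" if "lincomb a {u, v} = 0\<^sub>v n" for a
      proof -
        have e: "a u * u $ i + a v * v $ i = 0" "a u * u $ j + a v * v $ j = 0"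
          using comb[OF ij(1), of a] comb[OF ij(2), of a] that ij by simp_all
        \<comment> \<open>Elimination as in Cramer's rule: each coefficient times the nonzero minor
          vanishes.\<close>
        have "a u * (u $ i * v $ j - u $ j * v $ i) =
            (a u * u $ i + a v * v $ i) * v $ j - (a u * u $ j + a v * v $ j) * v $ i"
          "a v * (u $ i * v $ j - u $ j * v $ i) =
            (a u * u $ j + a v * v $ j) * u $ i - (a u * u $ i + a v * v $ i) * u $ j"
          by (simp_all add: algebra_simps)
        then show ?thesis using e ij(3) by auto
      qed
    qed (use carrier in auto)
  qed
qed


section \<open>Balanced weightings as kernel vectors\<close>

lemma mem_lin_space_iff_conormal:
  fixes \<tau> :: "(real ^ 'n) set"
  assumes \<tau>: "\<tau> \<noteq> {}" "aff_dim \<tau> = int k - 1" and x: "conormal_basis k \<tau> x"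
  shows "s \<in> lin_space \<tau> \<longleftrightarrow> (\<forall>l<ridge_codim TYPE('n) k. inner s (x l) = 0)"
proof -
  define L where "L = lin_space \<tau>"
  define t where "t = ridge_codim TYPE('n) k"
  have xs: "inj_on x {..<t}" "independent (x ` {..<t})" "x ` {..<t} \<subseteq> orthogonal_comp L"
    using x unfolding conormal_basis_def Let_def L_def t_def by auto
  have L: "subspace L" by (simp add: L_def)
  have dimL: "int (dim L) = int k - 1" unfolding L_def using dim_lin_space[OF \<tau>(1)] \<tau>(2) by simp
  have comp: "orthogonal_comp L = {y \<in> UNIV. \<forall>x\<in>L. orthogonal x y}" by (simp add: orthogonal_comp_def)
  have "dim (orthogonal_comp L) + dim L = CARD('n)"
    unfolding comp using dim_subspace_orthogonal_to_vectors[OF L subspace_UNIV] by simp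
  \<comment> \<open>Here k - 1 is the dimension of \<open>L\<close>, so it lies between 0 and the
    dimension of the ambient space, and the subtraction in \<open>ridge_codim\<close> is
    exact.\<close>
  then have "dim (orthogonal_comp L) = t"
    using dimL unfolding t_def ridge_codim_def by linarith
  moreover have "card (x ` {..<t}) = t" using xs(1) by (simp add: card_image)
  ultimately have span: "orthogonal_comp L \<subseteq> span (x ` {..<t})"
    using xs(2,3) by (intro card_ge_dim_independent) auto
  have "s \<in> L \<longleftrightarrow> (\<forall>l<t. inner s (x l) = 0)"
  proof
    assume "s \<in> L"
    then show "\<forall>l<t. inner s (x l) = 0"
      using xs(3) by (auto simp: orthogonal_comp_def orthogonal_def)
  next
    assume s: "\<forall>l<t. inner s (x l) = 0"
    have "orthogonal s y" if "y \<in> orthogonal_comp L" for y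
      by (rule orthogonal_to_span[OF subsetD[OF span that]]) (use s in \<open>auto simp: orthogonal_def\<close>)
    then have "s \<in> orthogonal_comp (orthogonal_comp L)"
      by (simp add: orthogonal_comp_def[of "orthogonal_comp L"] orthogonal_commute)
    then show "s \<in> L" using orthogonal_comp_self[OF L] by simp
  qed
  then show ?thesis by (simp add: L_def t_def)
qed

section \<open>Integer vectors spanning the kernel of an integer matrix\<close>

lemma common_denominator:
  fixes f :: "'a \<Rightarrow> rat"
  assumes "finite I"
  shows "\<exists>N>0. \<forall>i\<in>I. \<exists>m::int. of_int N * f i = of_int m"
  using assms
proof (induction I rule: finite_induct)
  case (insert i I)
  then obtain N where N: "N > 0" "\<forall>i\<in>I. \<exists>m::int. of_int N * f i = of_int m" by blast
  obtain a b where ab: "f i = of_int a / of_int b" "b > 0" by (metis quotient_of_div surj_pair quotient_of_denom_pos)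
  have "\<exists>m::int. of_int (N * b) * f j = of_int m" if "j \<in> insert i I" for j
  proof (cases "j = i")
    case True
    then have "of_int (N * b) * f j = of_int (N * a)" using ab by simp
    then show ?thesis by (rule exI)
  next
    case False
    then have "j \<in> I" using that by simp
    then obtain m :: int where m: "of_int N * f j = of_int m" using N(2) by blast
    have "of_int (N * b) * f j = of_int b * (of_int N * f j)" by simp
    also have "\<dots> = of_int (b * m)" unfolding m by simp
    finally show ?thesis by (rule exI)
  qed
  moreover have "N * b > 0" using N(1) ab(2) by simp
  ultimately show ?case by blast
qed (auto intro: exI[of _ 1])

text \<open>Expanding the entries of a real kernel vector in a basis of the reals over the rationals, each
  coordinate is a rational kernel vector.\<close>

lemma mat_kernel_subset_span_integer:
  fixes A :: "real mat"
  assumes A: "A \<in> carrier_mat nr nc"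
    and int: "\<And>i j. i < nr \<Longrightarrow> j < nc \<Longrightarrow> A $$ (i, j) \<in> \<int>"
  shows "mat_kernel A \<subseteq> module.span class_ring (module_vec TYPE(real) nc)
    {u \<in> mat_kernel A. \<forall>j<nc. u $ j \<in> \<int>}"
proof
  interpret V: vec_space "TYPE(real)" nc .
  interpret Q: Vector_Spaces.vector_space "\<lambda>(q::rat) (x::real). of_rat q * x"
    by unfold_locales (simp_all add: algebra_simps of_rat_add of_rat_mult)
  define U where "U = {u \<in> mat_kernel A. \<forall>j<nc. u $ j \<in> \<int>}"
  have U: "U \<subseteq> carrier_vec nc" using mat_kernel_carrier[OF A] by (auto simp: U_def)
  define B where "B = Q.extend_basis {}"
  have indep: "Q.independent B" unfolding B_def by (intro Q.independent_extend_basis Q.independent_empty)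
  have span: "y \<in> Q.span B" for y unfolding B_def using Q.span_extend_basis[OF Q.independent_empty] by simp
  define rep where "rep = Q.representation B"
  fix v assume v: "v \<in> mat_kernel A"
  have vc: "v \<in> carrier_vec nc" and Av: "A *\<^sub>v v = 0\<^sub>v nr" using mat_kernelD[OF A v] by auto
  \<comment> \<open>The vector \<open>q b\<close> collects the coordinates at \<open>b\<close> of
    all entries of \<open>v\<close>, so \<open>v\<close> is the sum of \<open>b\<close> times
    \<open>q b\<close> over the finitely many basis elements that occur.\<close>
  define q where "q b = Matrix.vec nc (\<lambda>j. real_of_rat (rep (v $ j) b))" for b
  have qc: "q b \<in> carrier_vec nc" for b by (simp add: q_def)
  have q: "q b \<in> mat_kernel A" for b
  proof (rule mat_kernelI[OF A qc])
    show "A *\<^sub>v q b = 0\<^sub>v nr"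
    proof (rule eq_vecI)
      show "dim_vec (A *\<^sub>v q b) = dim_vec (0\<^sub>v nr)" using A by simp
      fix i assume "i < dim_vec (0\<^sub>v nr :: real Matrix.vec)"
      then have i: "i < nr" by simp
      have "\<forall>j. \<exists>c. j < nc \<longrightarrow> A $$ (i, j) = of_int c" using int[OF i] by (meson Ints_cases)
      then obtain c where c: "\<And>j. j < nc \<Longrightarrow> A $$ (i, j) = of_int (c j)" by metis
      \<comment> \<open>Taking the coordinate at \<open>b\<close> is linear over the rationals and
        the entries of \<open>A\<close> are integers, so an equation for \<open>v\<close> passes to
        its coordinates.\<close>
      have "(\<Sum>j\<in>{0..<nc}. real_of_rat (of_int (c j)) * v $ j) = (A *\<^sub>v v) $ i"
        using A vc i c by (simp add: scalar_prod_def)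
      also have "\<dots> = 0" using Av i by simp
      finally have "rep (\<Sum>j\<in>{0..<nc}. real_of_rat (of_int (c j)) * v $ j) b = 0"
        unfolding rep_def by (simp only: Q.representation_zero)
      moreover have "rep (\<Sum>j\<in>{0..<nc}. real_of_rat (of_int (c j)) * v $ j) b =
          (\<Sum>j\<in>{0..<nc}. of_int (c j) * rep (v $ j) b)"
        unfolding rep_def
        by (simp only: Q.representation_sum[OF indep span] Q.representation_scale[OF indep span])
      ultimately have "real_of_rat (\<Sum>j\<in>{0..<nc}. of_int (c j) * rep (v $ j) b) = 0" by simp
      then have "(\<Sum>j\<in>{0..<nc}. of_int (c j) * real_of_rat (rep (v $ j) b)) = 0"
        by (simp add: of_rat_sum of_rat_mult)
      then show "(A *\<^sub>v q b) $ i = 0\<^sub>v nr $ i"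
        using A i c by (simp add: scalar_prod_def q_def)
    qed
  qed
  have q_span: "q b \<in> V.span U" for b
  proof -
    obtain N where N: "N > 0" "\<forall>j\<in>{..<nc}. \<exists>m::int. of_int N * rep (v $ j) b = of_int m"
      using common_denominator[of "{..<nc}" "\<lambda>j. rep (v $ j) b"] by blast
    have "of_int N \<cdot>\<^sub>v q b \<in> U"
      unfolding U_def
    proof (intro CollectI conjI allI impI)
      show "of_int N \<cdot>\<^sub>v q b \<in> mat_kernel A" by (rule mat_kernel_smult[OF A q])
      fix j assume j: "j < nc"
      then obtain m where "of_int N * rep (v $ j) b = of_int m" using N(2) by blast
      then have "real_of_rat (of_int N * rep (v $ j) b) = real_of_rat (of_int m)" by simp
      then have "(of_int N \<cdot>\<^sub>v q b) $ j = of_int m" using j by (simp add: q_def of_rat_mult)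
      then show "(of_int N \<cdot>\<^sub>v q b) $ j \<in> \<int>" by simp
    qed
    then have "of_int N \<cdot>\<^sub>v q b \<in> V.span U" by (rule subsetD[OF V.in_own_span[OF U]])
    then have "(1 / of_int N) \<cdot>\<^sub>v (of_int N \<cdot>\<^sub>v q b) \<in> V.span U" by (rule V.smult_in_span[OF U])
    then show ?thesis using N(1) by (simp add: smult_smult_assoc)
  qed
  have part: "Matrix.vec nc (\<lambda>j. \<Sum>b\<in>S. real_of_rat (rep (v $ j) b) * b) \<in> V.span U" if "finite S" for S
    using that
  proof (induction S rule: finite_induct)
    case empty
    have "Matrix.vec nc (\<lambda>j. \<Sum>b\<in>{}. real_of_rat (rep (v $ j) b) * b) = 0 \<cdot>\<^sub>v q 0"
      by (intro eq_vecI) (auto simp: q_def)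
    also have "\<dots> \<in> V.span U" by (rule V.smult_in_span[OF U q_span])
    finally show ?case .
  next
    case (insert b S)
    have "Matrix.vec nc (\<lambda>j. \<Sum>b\<in>insert b S. real_of_rat (rep (v $ j) b) * b) =
        b \<cdot>\<^sub>v q b + Matrix.vec nc (\<lambda>j. \<Sum>b\<in>S. real_of_rat (rep (v $ j) b) * b)"
      using insert.hyps by (intro eq_vecI) (auto simp: q_def)
    also have "\<dots> \<in> V.span U"
      by (rule V.span_add1[OF U V.smult_in_span[OF U q_span] insert.IH])
    finally show ?case .
  qed
  define S where "S = (\<Union>j\<in>{..<nc}. {b. rep (v $ j) b \<noteq> 0})"
  have finS: "finite S" unfolding S_def rep_def using Q.finite_representation by blast
  have "(\<Sum>b\<in>S. real_of_rat (rep (v $ j) b) * b) = v $ j" if "j < nc" for j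
  proof -
    have "(\<Sum>b\<in>S. real_of_rat (rep (v $ j) b) * b) = (\<Sum>b | rep (v $ j) b \<noteq> 0. real_of_rat (rep (v $ j) b) * b)"
      using finS that by (intro sum.mono_neutral_right) (auto simp: S_def)
    also have "\<dots> = v $ j" unfolding rep_def by (rule Q.sum_nonzero_representation_eq[OF indep span])
    finally show ?thesis .
  qed
  then have "Matrix.vec nc (\<lambda>j. \<Sum>b\<in>S. real_of_rat (rep (v $ j) b) * b) = v"
    using vc by (intro eq_vecI) auto
  then show "v \<in> V.span {u \<in> mat_kernel A. \<forall>j<nc. u $ j \<in> \<int>}"
    using part[OF finS] by (simp add: U_def)
qed

lemma block_index:
  fixes j t n :: nat
  assumes "j < t * n"
  shows "j div t < n" "j mod t < t" "j = (j div t) * t + j mod t"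
proof -
  have "t > 0" using assms by (metis gr0I mult_zero_left not_less_zero)
  then show "j div t < n" "j mod t < t" "j = (j div t) * t + j mod t"
    using assms by (simp_all add: div_less_iff_less_mult mult.commute)
qed

text \<open>A normal is primitive modulo the ridge and points into the cell, which fixes it modulo
  \<open>lin_space \<tau>\<close>. The transfer is required because \<open>tropical_variety\<close>
  supplies balancing for some choice of normals, while the matrix is formed with a given
  one.\<close>

lemma (in lattice_complex) balanced_weighting_change_normals:
  assumes z': "lattice_normals k C z'" and bal: "balanced_weighting k C z' \<omega>"
  shows "balanced_weighting k C z \<omega>"
proof -
  interpret Z: lattice_complex k C z' by unfold_locales (rule pure rational z')+
  have "(\<Sum>\<sigma> | \<sigma> \<in> max_cells k C \<and> \<tau> face_of \<sigma>. of_int (\<omega> \<sigma>) *\<^sub>R z \<tau> \<sigma>) \<in> lin_space \<tau>"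
    if \<tau>: "\<tau> \<in> ridges k C" for \<tau>
  proof -
    let ?S = "{\<sigma>. \<sigma> \<in> max_cells k C \<and> \<tau> face_of \<sigma>}"
    have "rel_interior \<tau> \<noteq> {}"
      using rel_interior_eq_empty cellD(2,4)[OF ridgeD(1)[OF \<tau>]] by blast
    then obtain p where p: "p \<in> rel_interior \<tau>" by blast
    have diff: "z \<tau> \<sigma> - z' \<tau> \<sigma> \<in> lin_space \<tau>" if "\<sigma> \<in> ?S" for \<sigma>
    proof -
      have \<sigma>: "\<sigma> \<in> max_cells k C" "\<tau> \<subseteq> \<sigma>" using that face_of_imp_subset by auto
      obtain a where a: "a \<ge> 0" "z \<tau> \<sigma> - a *\<^sub>R z' \<tau> \<sigma> \<in> lin_space \<tau>"
        using normal_in_tangent_cone[OF \<tau> \<sigma> p] unfolding Z.tangent_cone_ridge[OF \<tau> \<sigma> p] by blast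
      have "a = 1 \<or> a = - 1"
        by (rule primitive_modulo_unique[OF subspace_lin_space Z.normal_primitive[OF \<tau> \<sigma>]
              normal_primitive[OF \<tau> \<sigma>] a(2)])
      then have "a = 1" using a(1) by linarith
      then show ?thesis using a(2) by simp
    qed
    have "(\<Sum>\<sigma>\<in>?S. of_int (\<omega> \<sigma>) *\<^sub>R (z \<tau> \<sigma> - z' \<tau> \<sigma>)) \<in> lin_space \<tau>"
      using diff by (intro subspace_sum subspace_scale subspace_lin_space)
    moreover have "(\<Sum>\<sigma>\<in>?S. of_int (\<omega> \<sigma>) *\<^sub>R z' \<tau> \<sigma>) \<in> lin_space \<tau>"
      by (rule bal[unfolded balanced_weighting_def, THEN conjunct2, rule_format, OF \<tau>])
    ultimately have "(\<Sum>\<sigma>\<in>?S. of_int (\<omega> \<sigma>) *\<^sub>R (z \<tau> \<sigma> - z' \<tau> \<sigma>)) +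
        (\<Sum>\<sigma>\<in>?S. of_int (\<omega> \<sigma>) *\<^sub>R z' \<tau> \<sigma>) \<in> lin_space \<tau>"
      by (rule subspace_add[OF subspace_lin_space])
    then show ?thesis by (simp add: scaleR_diff_right sum_subtractf)
  qed
  then show ?thesis using bal unfolding balanced_weighting_def by (intro conjI ballI) (elim conjE)
qed

section \<open>The kernel of the transposed matrix and the weightings of the complex\<close>

locale complex_matrix = lattice_complex k C z
  for k :: nat and C :: "(real ^ 'n) set set" and z +
  fixes x :: "(real ^ 'n) set \<Rightarrow> nat \<Rightarrow> real ^ 'n"
    and Es Vs :: "(real ^ 'n) set list" and cs :: "'n list"
  assumes conormal: "conormal_bases k C x"
    and Es: "enumerates Es (max_cells k C)" and Vs: "enumerates Vs (ridges k C)"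
    and cs: "enumerates cs (UNIV :: 'n set)"
begin

abbreviation "R \<equiv> R_matrix k cs Es Vs z x"

lemma distinct_Es: "distinct Es" and set_Es: "set Es = max_cells k C" and set_Vs: "set Vs = ridges k C"
  using Es Vs by (simp_all add: enumerates_def)

lemma length_Es: "length Es = card (max_cells k C)"
  using distinct_card[OF distinct_Es] set_Es by simp

lemma nth_Es: "i < length Es \<Longrightarrow> Es ! i \<in> max_cells k C"
  using set_Es nth_mem by metis

lemma R_transpose_carrier: "transpose_mat R \<in> carrier_mat (ridge_codim TYPE('n) k * length Vs) (length Es)"
  using R_matrix_carrier by simp

sublocale kernel "ridge_codim TYPE('n) k * length Vs" "length Es" "transpose_mat R"
  by unfold_locales (rule R_transpose_carrier)

lemma R_matrix_integer:
  assumes i: "i < length Es" and j: "j < ridge_codim TYPE('n) k * length Vs"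
  shows "R $$ (i, j) \<in> \<int>"
proof -
  let ?t = "ridge_codim TYPE('n) k"
  note c = block_index[OF j]
  define \<tau> where "\<tau> = Vs ! (j div ?t)"
  have \<tau>: "\<tau> \<in> ridges k C" using c(1) set_Vs nth_mem unfolding \<tau>_def by metis
  have "R $$ (i, j) = (if \<tau> \<subseteq> Es ! i then inner (z \<tau> (Es ! i)) (x \<tau> (j mod ?t)) else 0)"
    using R_matrix_entry[OF cs i c(1,2), of z x] c(3) unfolding \<tau>_def by simp
  moreover have "inner (z \<tau> (Es ! i)) (x \<tau> (j mod ?t)) \<in> \<int>" if "\<tau> \<subseteq> Es ! i"
  proof -
    have "z \<tau> (Es ! i) \<in> integer_points"
      using normal_in_cell_lattice[OF \<tau> nth_Es[OF i] that] by (simp add: cell_lattice_def)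
    moreover have "x \<tau> (j mod ?t) \<in> integer_points"
      using conormal \<tau> c(2) unfolding conormal_bases_def conormal_basis_def Let_def by blast
    ultimately show ?thesis unfolding inner_vec_def integer_points_def by auto
  qed
  ultimately show ?thesis by simp
qed

text \<open>The balancing sum with real coefficients. It runs over indices and tests
  \<open>\<subseteq>\<close> to match the entries of \<open>R\<close>; between cells of a complex,
  inclusion and being a face coincide.\<close>

definition ridge_sum :: "(real ^ 'n) set \<Rightarrow> real Matrix.vec \<Rightarrow> real ^ 'n" where
  "ridge_sum \<tau> v = (\<Sum>i<length Es. if \<tau> \<subseteq> Es ! i then v $ i *\<^sub>R z \<tau> (Es ! i) else 0)"

text \<open>Pairing \<open>v\<close> with the column of \<open>R\<close> at (\<open>\<tau>\<close>,
  \<open>l\<close>) gives the inner product of \<open>ridge_sum \<tau> v\<close> and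
  \<open>x \<tau> l\<close>; its vanishing for all \<open>l\<close> means membership in
  \<open>lin_space \<tau>\<close>.\<close>

lemma mem_kernel_iff:
  "v \<in> mat_kernel (transpose_mat R) \<longleftrightarrow>
    v \<in> carrier_vec (length Es) \<and> (\<forall>\<tau>\<in>ridges k C. ridge_sum \<tau> v \<in> lin_space \<tau>)"
proof -
  let ?t = "ridge_codim TYPE('n) k"
  have entry: "(transpose_mat R *\<^sub>v v) $ (b * ?t + l) = inner (ridge_sum (Vs ! b) v) (x (Vs ! b) l)"
    if v: "v \<in> carrier_vec (length Es)" and b: "b < length Vs" and l: "l < ?t" for b l
  proof -
    have j: "b * ?t + l < ?t * length Vs"
    proof -
      have "b * ?t + l < (b + 1) * ?t" using l by simp
      also have "\<dots> \<le> length Vs * ?t" using b by (intro mult_right_mono) auto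
      finally show ?thesis by (simp add: mult.commute)
    qed
    have dims: "dim_row R = length Es" "dim_col R = ?t * length Vs"
      using R_matrix_carrier[of k cs Es Vs z x] by auto
    have "(transpose_mat R *\<^sub>v v) $ (b * ?t + l) = (\<Sum>i<length Es. R $$ (i, b * ?t + l) * v $ i)"
      using v j dims by (simp add: scalar_prod_def atLeast0LessThan)
    also have "\<dots> = (\<Sum>i<length Es. inner (if Vs ! b \<subseteq> Es ! i then v $ i *\<^sub>R z (Vs ! b) (Es ! i) else 0) (x (Vs ! b) l))"
      by (intro sum.cong) (auto simp: R_matrix_entry[OF cs _ b l])
    finally show ?thesis by (simp add: ridge_sum_def inner_sum_left)
  qed
  have "(transpose_mat R *\<^sub>v v = 0\<^sub>v (?t * length Vs)) \<longleftrightarrow> (\<forall>\<tau>\<in>ridges k C. ridge_sum \<tau> v \<in> lin_space \<tau>)"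
    if v: "v \<in> carrier_vec (length Es)"
  proof -
    have "(transpose_mat R *\<^sub>v v = 0\<^sub>v (?t * length Vs)) \<longleftrightarrow>
        (\<forall>j<?t * length Vs. (transpose_mat R *\<^sub>v v) $ j = 0)"
      using R_transpose_carrier by (auto simp: vec_eq_iff)
    also have "\<dots> \<longleftrightarrow> (\<forall>b<length Vs. \<forall>l<?t. (transpose_mat R *\<^sub>v v) $ (b * ?t + l) = 0)"
    proof (intro iffI allI impI)
      fix b l assume *: "\<forall>j<?t * length Vs. (transpose_mat R *\<^sub>v v) $ j = 0" "b < length Vs" "l < ?t"
      have "b * ?t + l < (b + 1) * ?t" using *(3) by simp
      also have "\<dots> \<le> length Vs * ?t" using *(2) by (intro mult_right_mono) auto
      finally show "(transpose_mat R *\<^sub>v v) $ (b * ?t + l) = 0" using *(1) by (simp add: mult.commute)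
    next
      fix j assume *: "\<forall>b<length Vs. \<forall>l<?t. (transpose_mat R *\<^sub>v v) $ (b * ?t + l) = 0" "j < ?t * length Vs"
      show "(transpose_mat R *\<^sub>v v) $ j = 0"
        using *(1) block_index[OF *(2)] by metis
    qed
    also have "\<dots> \<longleftrightarrow> (\<forall>b<length Vs. ridge_sum (Vs ! b) v \<in> lin_space (Vs ! b))"
    proof (intro all_cong1 imp_cong refl)
      fix b assume b: "b < length Vs"
      then have ridge: "Vs ! b \<in> ridges k C" using set_Vs nth_mem by metis
      have "conormal_basis k (Vs ! b) (x (Vs ! b))" using conormal ridge unfolding conormal_bases_def by blast
      then show "(\<forall>l<?t. (transpose_mat R *\<^sub>v v) $ (b * ?t + l) = 0) \<longleftrightarrow> ridge_sum (Vs ! b) v \<in> lin_space (Vs ! b)"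
        using mem_lin_space_iff_conormal[OF cellD(4)[OF ridgeD(1)[OF ridge]] ridgeD(2)[OF ridge]] entry[OF v b]
        by simp
    qed
    also have "\<dots> \<longleftrightarrow> (\<forall>\<tau>\<in>ridges k C. ridge_sum \<tau> v \<in> lin_space \<tau>)"
      unfolding set_Vs[symmetric] all_set_conv_all_nth ..
    finally show ?thesis .
  qed
  then show ?thesis unfolding mat_kernel[OF R_transpose_carrier] by blast
qed

lemma ridge_sum_weight_vec:
  assumes \<tau>: "\<tau> \<in> ridges k C"
  shows "ridge_sum \<tau> (weight_vec Es w) =
    (\<Sum>\<sigma> | \<sigma> \<in> max_cells k C \<and> \<tau> face_of \<sigma>. of_int (w \<sigma>) *\<^sub>R z \<tau> \<sigma>)"
proof -
  have "ridge_sum \<tau> (weight_vec Es w) =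
    (\<Sum>i<length Es. if \<tau> \<subseteq> Es ! i then of_int (w (Es ! i)) *\<^sub>R z \<tau> (Es ! i) else 0)"
    unfolding ridge_sum_def by (intro sum.cong) (auto simp: weight_vec_def)
  also have "\<dots> = (\<Sum>\<sigma>\<in>max_cells k C. if \<tau> \<subseteq> \<sigma> then of_int (w \<sigma>) *\<^sub>R z \<tau> \<sigma> else 0)"
    using bij_betw_nth[OF distinct_Es refl set_Es[symmetric]]
    by (intro sum.reindex_bij_betw[where g = "\<lambda>\<sigma>. if \<tau> \<subseteq> \<sigma> then of_int (w \<sigma>) *\<^sub>R z \<tau> \<sigma> else 0"]) simp
  also have "\<dots> = (\<Sum>\<sigma> | \<sigma> \<in> max_cells k C \<and> \<tau> \<subseteq> \<sigma>. of_int (w \<sigma>) *\<^sub>R z \<tau> \<sigma>)"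
    using finite_cells(2) by (simp add: sum.inter_filter)
  also have "{\<sigma>. \<sigma> \<in> max_cells k C \<and> \<tau> \<subseteq> \<sigma>} = {\<sigma>. \<sigma> \<in> max_cells k C \<and> \<tau> face_of \<sigma>}"
    using complex_subset_face_of[OF complex ridgeD(1)[OF \<tau>] max_cellD(1)] face_of_imp_subset by blast
  finally show ?thesis .
qed

lemma weight_vec_mem_kernel_iff:
  "weight_vec Es w \<in> mat_kernel (transpose_mat R) \<longleftrightarrow>
    (\<forall>\<tau>\<in>ridges k C. (\<Sum>\<sigma> | \<sigma> \<in> max_cells k C \<and> \<tau> face_of \<sigma>. of_int (w \<sigma>) *\<^sub>R z \<tau> \<sigma>) \<in> lin_space \<tau>)"
  by (simp add: mem_kernel_iff ridge_sum_weight_vec) (simp add: weight_vec_def)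

lemma balanced_weighting_iff:
  "balanced_weighting k C z w \<longleftrightarrow>
    (\<forall>\<sigma>\<in>max_cells k C. w \<sigma> > 0) \<and> weight_vec Es w \<in> mat_kernel (transpose_mat R)"
  unfolding balanced_weighting_def weighting_def weight_vec_mem_kernel_iff ..

text \<open>Distinctness of \<open>Es\<close> recovers the index from the cell; the floor only
  changes the type of an integer entry.\<close>

lemma integer_vec_eq_weight_vec:
  assumes u: "u \<in> carrier_vec (length Es)" "\<forall>i<length Es. u $ i \<in> \<int>"
  obtains w where "u = weight_vec Es w"
proof
  define w where "w \<sigma> = \<lfloor>u $ (THE i. i < length Es \<and> Es ! i = \<sigma>)\<rfloor>" for \<sigma>
  have "of_int (w (Es ! i)) = u $ i" if i: "i < length Es" for i
  proof -
    have "(THE i'. i' < length Es \<and> Es ! i' = Es ! i) = i"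
      using i nth_eq_iff_index_eq[OF distinct_Es] by (intro the_equality) auto
    then show ?thesis using u(2) i by (simp add: w_def)
  qed
  then show "u = weight_vec Es w" using u(1) by (intro eq_vecI) (auto simp: weight_vec_def)
qed

text \<open>Adding a large multiple of a fixed balanced weighting makes an integer kernel vector positive.\<close>

lemma kernel_subset_span_balanced:
  assumes \<omega>: "balanced_weighting k C z \<omega>"
  shows "mat_kernel (transpose_mat R) \<subseteq>
    NC.span {weight_vec Es w |w. balanced_weighting k C z w}"
proof -
  define W where "W = {weight_vec Es w |w. balanced_weighting k C z w}"
  have W: "W \<subseteq> carrier_vec (length Es)" by (auto simp: W_def weight_vec_def)
  have "u \<in> NC.span W" if u: "u \<in> mat_kernel (transpose_mat R)" "\<forall>i<length Es. u $ i \<in> \<int>" for u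
  proof -
    have uc: "u \<in> carrier_vec (length Es)" using u(1) mem_kernel_iff by blast
    obtain w where w: "u = weight_vec Es w" using integer_vec_eq_weight_vec[OF uc u(2)] .
    \<comment> \<open>\<open>M\<close> exceeds the absolute value of every weight of
      \<open>w\<close>, strictly because of the summand 1, and \<open>\<omega>\<close> is at least
      1; hence \<open>w'\<close> is positive.\<close>
    define M where "M = 1 + (\<Sum>\<sigma>\<in>max_cells k C. \<bar>w \<sigma>\<bar>)"
    have M: "\<bar>w \<sigma>\<bar> < M" if "\<sigma> \<in> max_cells k C" for \<sigma>
      using member_le_sum[OF that, of "\<lambda>\<sigma>. \<bar>w \<sigma>\<bar>"] finite_cells(2) by (simp add: M_def)
    define w' where "w' \<sigma> = w \<sigma> + M * \<omega> \<sigma>" for \<sigma>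
    have eq: "weight_vec Es w' = u + of_int M \<cdot>\<^sub>v weight_vec Es \<omega>"
      unfolding w w'_def by (intro eq_vecI) (auto simp: weight_vec_def)
    have "balanced_weighting k C z w'"
      unfolding balanced_weighting_iff
    proof (intro conjI ballI)
      fix \<sigma> assume \<sigma>: "\<sigma> \<in> max_cells k C"
      have "\<omega> \<sigma> \<ge> 1" using \<omega> \<sigma> unfolding balanced_weighting_iff by fastforce
      then have "M * 1 \<le> M * \<omega> \<sigma>" using M[OF \<sigma>] by (intro mult_left_mono) auto
      then show "w' \<sigma> > 0" using M[OF \<sigma>] unfolding w'_def by linarith
    next
      have \<omega>K: "of_int M \<cdot>\<^sub>v weight_vec Es \<omega> \<in> mat_kernel (transpose_mat R)"
        using \<omega> unfolding balanced_weighting_iff by (intro mat_kernel_smult[OF R_transpose_carrier]) blast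
      have "u + of_int M \<cdot>\<^sub>v weight_vec Es \<omega> \<in> mat_kernel (transpose_mat R)"
        using Ker.a_closed[OF u(1) \<omega>K] by simp
      then show "weight_vec Es w' \<in> mat_kernel (transpose_mat R)" unfolding eq .
    qed
    \<comment> \<open>Subtracting the added multiple recovers \<open>u\<close> from two balanced
      weightings.\<close>
    then have "weight_vec Es w' \<in> NC.span W" "weight_vec Es \<omega> \<in> NC.span W"
      using \<omega> subsetD[OF NC.in_own_span[OF W]] unfolding W_def by blast+
    then have "weight_vec Es w' + (- of_int M) \<cdot>\<^sub>v weight_vec Es \<omega> \<in> NC.span W"
      by (intro NC.span_add1[OF W] NC.smult_in_span[OF W])
    moreover have "weight_vec Es w' + (- of_int M) \<cdot>\<^sub>v weight_vec Es \<omega> = u"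
      unfolding eq using uc by (intro eq_vecI) (auto simp: weight_vec_def)
    ultimately show ?thesis by simp
  qed
  then have "NC.span {u \<in> mat_kernel (transpose_mat R). \<forall>i<length Es. u $ i \<in> \<int>} \<subseteq> NC.span W"
    by (intro NC.span_subsetI[OF W]) blast
  moreover have "mat_kernel (transpose_mat R) \<subseteq>
      NC.span {u \<in> mat_kernel (transpose_mat R). \<forall>i<length Es. u $ i \<in> \<int>}"
    using R_matrix_integer R_matrix_carrier[of k cs Es Vs z x]
    by (intro mat_kernel_subset_span_integer[OF R_transpose_carrier]) auto
  ultimately show ?thesis unfolding W_def by blast
qed

lemma has_independent_balanced_weightings_le:
  assumes "has_independent_balanced_weightings k C z Es n"
  shows "n \<le> kernel_dim (transpose_mat R)"
proof -
  obtain W where W: "W \<subseteq> {weight_vec Es \<omega> |\<omega>. balanced_weighting k C z \<omega>}" "card W = n"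
    "lin_indpt_vecs (length Es) W"
    using assms unfolding has_independent_balanced_weightings_def by blast
  have "W \<subseteq> mat_kernel (transpose_mat R)" using W(1) balanced_weighting_iff by blast
  then show ?thesis using card_le_kernel_dim(2) W(2,3) unfolding lin_indpt_vecs_def by blast
qed

lemma has_independent_balanced_weightings_kernel_dim:
  assumes "balanced_weighting k C z \<omega>"
  shows "has_independent_balanced_weightings k C z Es (kernel_dim (transpose_mat R))"
proof -
  have "{weight_vec Es w |w. balanced_weighting k C z w} \<subseteq> mat_kernel (transpose_mat R)"
    using balanced_weighting_iff by blast
  from kernel_dim_attained[OF this kernel_subset_span_balanced[OF assms]]
  show ?thesis unfolding has_independent_balanced_weightings_def lin_indpt_vecs_def by blast
qed

lemma weight_vec_nonzero:
  assumes "\<sigma> \<in> max_cells k C" "w \<sigma> \<noteq> 0" shows "weight_vec Es w \<noteq> 0\<^sub>v (length Es)"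
proof
  assume eq: "weight_vec Es w = 0\<^sub>v (length Es)"
  obtain i where "i < length Es" "Es ! i = \<sigma>" using assms(1) set_Es by (metis in_set_conv_nth)
  then show False using arg_cong[OF eq, of "\<lambda>v. v $ i"] assms(2) by (simp add: weight_vec_def)
qed

lemma lin_indpt_weight_vecs_iff:
  assumes "weight_vec Es u \<noteq> weight_vec Es v" "weight_vec Es u \<noteq> 0\<^sub>v (length Es)"
  shows "NC.lin_indpt {weight_vec Es u, weight_vec Es v} \<longleftrightarrow>
    (\<exists>\<sigma>1\<in>max_cells k C. \<exists>\<sigma>2\<in>max_cells k C. u \<sigma>1 * v \<sigma>2 \<noteq> u \<sigma>2 * v \<sigma>1)"
proof -
  have "NC.lin_indpt {weight_vec Es u, weight_vec Es v} \<longleftrightarrow>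
    (\<exists>i<length Es. \<exists>j<length Es. real_of_int (u (Es ! i) * v (Es ! j)) \<noteq> real_of_int (u (Es ! j) * v (Es ! i)))"
    using assms by (subst NC.lin_indpt_pair_iff) (auto simp: weight_vec_def)
  also have "\<dots> \<longleftrightarrow> (\<exists>\<sigma>1\<in>set Es. \<exists>\<sigma>2\<in>set Es. u \<sigma>1 * v \<sigma>2 \<noteq> u \<sigma>2 * v \<sigma>1)"
    by (simp only: of_int_eq_iff) (metis in_set_conv_nth)
  finally show ?thesis by (simp add: set_Es)
qed

lemma extremal_iff:
  assumes \<omega>: "balanced_weighting k C z \<omega>"
  shows "extremal C \<longleftrightarrow> kernel_dim (transpose_mat R) = 1"
proof
  have \<omega>pos: "\<omega> \<sigma> > 0" if "\<sigma> \<in> max_cells k C" for \<sigma> using \<omega> that unfolding balanced_weighting_iff by blast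
  have \<omega>K: "weight_vec Es \<omega> \<in> mat_kernel (transpose_mat R)" using \<omega> unfolding balanced_weighting_iff by blast
  obtain \<sigma>0 where \<sigma>0: "\<sigma>0 \<in> max_cells k C" using max_cells_nonempty by blast
  {
    assume ext: "extremal C"
    \<comment> \<open>The vector of \<open>\<omega>\<close> lies in the kernel and has positive
      entries.\<close>
    have "kernel_dim (transpose_mat R) \<noteq> 0"
    proof
      assume zero: "kernel_dim (transpose_mat R) = 0"
      obtain B where B: "finite B" "Ker.basis B" using Ker.finite_basis_exists[OF fin_dim] by blast
      have "B = {}" using zero Ker.dim_basis[OF B] B(1) by simp
      then have "mat_kernel (transpose_mat R) = Ker.span {}" using B(2) by (simp add: Ker.basis_def)
      then have "weight_vec Es \<omega> = 0\<^sub>v (length Es)" using \<omega>K Ker.span_empty by simp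
      then show False using weight_vec_nonzero[OF \<sigma>0, of \<omega>] \<omega>pos[OF \<sigma>0] by simp
    qed
    moreover have "\<not> 2 \<le> kernel_dim (transpose_mat R)"
    proof
      assume two: "2 \<le> kernel_dim (transpose_mat R)"
      obtain W where W: "W \<subseteq> {weight_vec Es \<omega> |\<omega>. balanced_weighting k C z \<omega>}"
        "card W = kernel_dim (transpose_mat R)" "NC.lin_indpt W"
        using has_independent_balanced_weightings_kernel_dim[OF \<omega>]
        unfolding has_independent_balanced_weightings_def lin_indpt_vecs_def by blast
      \<comment> \<open>Any two vectors of an independent set have a nonzero 2x2 minor; for
        weightings this says that their ratio is not constant, as the decomposition
        requires.\<close>
      obtain P where P: "P \<subseteq> W" "card P = 2" using two W(2) by (metis obtain_subset_with_card_n)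
      then obtain a b where ab: "P = {a, b}" "a \<noteq> b" by (metis card_2_iff)
      have "a \<in> {weight_vec Es \<omega> |\<omega>. balanced_weighting k C z \<omega>}"
        "b \<in> {weight_vec Es \<omega> |\<omega>. balanced_weighting k C z \<omega>}" using P(1) W(1) ab(1) by auto
      then obtain u v where u: "a = weight_vec Es u" "balanced_weighting k C z u"
        and v: "b = weight_vec Es v" "balanced_weighting k C z v" by (elim CollectE exE conjE)
      have "u \<sigma>0 \<noteq> 0" using u(2) \<sigma>0 unfolding balanced_weighting_iff by force
      then have "weight_vec Es u \<noteq> 0\<^sub>v (length Es)" by (rule weight_vec_nonzero[OF \<sigma>0])
      moreover have "NC.lin_indpt P" by (rule NC.subset_li_is_li[OF W(3) P(1)])
      then have "NC.lin_indpt {weight_vec Es u, weight_vec Es v}" unfolding ab(1) u(1) v(1) .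
      moreover have "weight_vec Es u \<noteq> weight_vec Es v" using ab(2) unfolding u(1) v(1) .
      ultimately have "\<exists>\<sigma>1\<in>max_cells k C. \<exists>\<sigma>2\<in>max_cells k C. u \<sigma>1 * v \<sigma>2 \<noteq> u \<sigma>2 * v \<sigma>1"
        using lin_indpt_weight_vecs_iff by metis
      then obtain \<sigma>1 \<sigma>2 where
        "\<sigma>1 \<in> max_cells k C" "\<sigma>2 \<in> max_cells k C" "u \<sigma>1 * v \<sigma>2 \<noteq> u \<sigma>2 * v \<sigma>1" by blast
      from two_weightings_not_extremal[OF u(2) v(2) this] show False using ext by (rule notE)
    qed
    ultimately show "kernel_dim (transpose_mat R) = 1" by linarith
  }
  {
    assume one: "kernel_dim (transpose_mat R) = 1"
    show "extremal C"
    proof (rule ccontr)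
      assume "\<not> extremal C"
      from not_extremal_weight[OF this] obtain m :: "(real ^ 'n) set \<Rightarrow> int" where
        zero: "\<exists>\<sigma>\<in>max_cells k C. m \<sigma> = 0" and nonzero: "\<exists>\<sigma>\<in>max_cells k C. m \<sigma> \<noteq> 0"
        and mK: "weight_vec Es m \<in> mat_kernel (transpose_mat R)"
        unfolding weight_vec_mem_kernel_iff[symmetric] by (elim exE conjE)
      obtain \<sigma>1 \<sigma>2 where \<sigma>: "\<sigma>1 \<in> max_cells k C" "m \<sigma>1 = 0" "\<sigma>2 \<in> max_cells k C" "m \<sigma>2 \<noteq> 0"
        using zero nonzero by blast
      \<comment> \<open>\<open>m\<close> vanishes at \<open>\<sigma>1\<close> but not at
        \<open>\<sigma>2\<close>, and \<open>\<omega>\<close> is positive at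
        \<open>\<sigma>1\<close>, so one product is 0 and the other is not.\<close>
      have cross: "\<omega> \<sigma>1 * m \<sigma>2 \<noteq> \<omega> \<sigma>2 * m \<sigma>1" using \<sigma> \<omega>pos[OF \<sigma>(1)] by simp
      have ne: "weight_vec Es \<omega> \<noteq> weight_vec Es m"
      proof
        assume eq: "weight_vec Es \<omega> = weight_vec Es m"
        obtain i where "i < length Es" "Es ! i = \<sigma>1" using \<sigma>(1) set_Es by (metis in_set_conv_nth)
        then show False using arg_cong[OF eq, of "\<lambda>v. v $ i"] \<sigma>(2) \<omega>pos[OF \<sigma>(1)] by (simp add: weight_vec_def)
      qed
      have "weight_vec Es \<omega> \<noteq> 0\<^sub>v (length Es)" using weight_vec_nonzero[OF \<sigma>0, of \<omega>] \<omega>pos[OF \<sigma>0] by simp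
      then have "NC.lin_indpt {weight_vec Es \<omega>, weight_vec Es m}"
        using lin_indpt_weight_vecs_iff[OF ne] \<sigma>(1,3) cross by blast
      then have "card {weight_vec Es \<omega>, weight_vec Es m} \<le> kernel_dim (transpose_mat R)"
        using \<omega>K mK by (intro card_le_kernel_dim(2)) auto
      then show False using one ne by simp
    qed
  }
qed

end

theorem theorem1p3:
  fixes C :: "(real ^ 'n) set set" and k :: nat
    and z :: "(real ^ 'n) set \<Rightarrow> (real ^ 'n) set \<Rightarrow> real ^ 'n"
    and x :: "(real ^ 'n) set \<Rightarrow> nat \<Rightarrow> real ^ 'n"
    and Es Vs :: "(real ^ 'n) set list" and cs :: "'n list"
  assumes "tropical_variety k C"
    and "lattice_normals k C z"
    and "conormal_bases k C x"
    and "enumerates Es (max_cells k C)"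
    and "enumerates Vs (ridges k C)"
    and "enumerates cs (UNIV :: 'n set)"
    and "R = R_matrix k cs Es Vs z x"
  shows "(has_independent_balanced_weightings k C z Es (kernel_dim (transpose_mat R)) \<and>
          (\<forall>n. has_independent_balanced_weightings k C z Es n \<longrightarrow> n \<le> kernel_dim (transpose_mat R))) \<and>
         (extremal C \<longleftrightarrow>
            int (vec_space.rank (card (max_cells k C)) R) = int (card (max_cells k C)) - 1)"
proof -
  have struct: "pure_complex k C" "rational_complex k C" and
    ex: "\<exists>z'. lattice_normals k C z' \<and> (\<exists>\<omega>. balanced_weighting k C z' \<omega>)"
    using assms(1) by (simp_all add: tropical_variety_def)
  interpret M: complex_matrix k C z x Es Vs cs
    by unfold_locales (rule struct assms)+
  obtain \<omega> where \<omega>: "balanced_weighting k C z \<omega>"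
    using ex M.balanced_weighting_change_normals by blast
  \<comment> \<open>\<open>R\<close> has one row for each maximal cell, so the kernel of its
    transpose measures how far its rank falls short of their number.\<close>
  have "vec_space.rank (card (max_cells k C)) R + kernel_dim (transpose_mat R) = card (max_cells k C)"
    using kernel_dim_transpose[OF R_matrix_carrier[of k cs Es Vs z x]] unfolding assms(7) M.length_Es .
  then have "kernel_dim (transpose_mat R) = 1 \<longleftrightarrow>
      int (vec_space.rank (card (max_cells k C)) R) = int (card (max_cells k C)) - 1"
    by linarith
  then show ?thesis
    using M.has_independent_balanced_weightings_kernel_dim[OF \<omega>] M.has_independent_balanced_weightings_le
      M.extremal_iff[OF \<omega>] unfolding assms(7) by blast
qed

end
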